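(* Assume that the set $\{t>0 : G(t),G'(t),G''(t)<\infty \text{ and } (G(t)-tG'(t))^2 = 2t^2 G(t)G''(t)\}$ is nonempty, and let $t_c$ be its infimum. Then the parking process is subcritical if and only if $$ t_c>1 \qquad\text{and}\qquad \frac{t_c\, G(t_c)}{\varphi(t_c)^2}\le q(1-q),$$ where $\varphi(y) = (y+1)G(y) - y(y-1)G'(y)$.
   Context: Fix $q\in(1/2,1)$. Let $\mathcal T$ be a Bienaymé–Galton–Watson plane tree rooted at $\varnothing$ with geometric offspring distribution $\nu(k)=q^k(1-q)$, $k\ge 0$ (mean $q/(1-q)>1$, so $\mathcal T$ is infinite with positive probability). Let $\mu$ be a probability law on $\{0,1,2,\dots\}$ with $\mu(\{0,1\})<1$, write $\mu_k=\mu(\{k\})$ and $G(t)=\sum_{k\ge0}\mu_k t^k$. Conditionally on $\mathcal T$, let $(A_u)_{u\in\mathcal T}$ be i.i.d. with law $\mu$; $A_u$ is the number of cars arriving at vertex $u$. Parking rule: each vertex can hold at most one car; each car goes to its arrival vertex, parks there if it is free, otherwise drives towards the root and parks at the first free vertex on its way; if it finds none it exits through the root. On a finite tree the final configuration does not depend on the order of the cars. For general $\mathcal T$: for $n\ge 0$ let $[\mathcal T]_n$ be the subtree of vertices at height at most $n$, park only the cars arriving on $[\mathcal T]_n$, and let $X_n(u)$ be the number of cars visiting $u$ (i.e. arriving at $u$ or reaching $u$ while driving towards the root); $X_n(u)$ is nondecreasing in $n$ and $X(u):=\lim_n X_n(u)\in\{0,1,\dots\}\cup\{\infty\}$. Set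 $X:=X(\varnothing)$, the number of cars visiting the root. The parking process is called subcritical if $X<\infty$ almost surely, and supercritical otherwise. *)

theory Defs
  imports "HOL-Probability.Probability"
begin

text \<open>Vertices are Ulam-Harris words (nat lists); the children of u are u @ [i].
  A configuration assigns to every word u a pair (K u, A u): the number of children
  K u (offspring variable) and the number of cars A u arriving at u.  The BGW tree is
  generated by the offspring variables; the i.i.d. family of pairs has law
  geometric offspring times mu.\<close>

definition offspring_law :: "real \<Rightarrow> nat pmf" where
  "offspring_law q = geometric_pmf (1 - q)"   \<comment> \<open>pmf k = q^k (1-q)\<close>

definition config_space :: "real \<Rightarrow> nat pmf \<Rightarrow> (nat list \<Rightarrow> nat \<times> nat) measure" where
  "config_space q mu = PiM UNIV (\<lambda>_. measure_pmf (pair_pmf (offspring_law q) mu))"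

text \<open>visits w m u = number of cars visiting vertex u when parking only the cars arriving
  in the subtree of u at relative height at most m.  Visiting u = arriving at u or
  arriving from a child that was already occupied (children send visits - 1 cars up).\<close>
fun visits :: "(nat list \<Rightarrow> nat \<times> nat) \<Rightarrow> nat \<Rightarrow> nat list \<Rightarrow> nat" where
  "visits w 0 u = snd (w u)"
| "visits w (Suc m) u = snd (w u) + (\<Sum>i<fst (w u). visits w m (u @ [i]) - 1)"

definition Xn_root :: "(nat list \<Rightarrow> nat \<times> nat) \<Rightarrow> nat \<Rightarrow> nat" where
  "Xn_root w n = visits w n []"

definition X_root :: "(nat list \<Rightarrow> nat \<times> nat) \<Rightarrow> enat" where
  "X_root w = (SUP n. enat (Xn_root w n))"

definition subcritical :: "real \<Rightarrow> nat pmf \<Rightarrow> bool" where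
  "subcritical q mu = (AE w in config_space q mu. X_root w < \<infinity>)"

text \<open>Generating function of mu and its first two derivatives, as power series
  (values in [0,\<infinity>]; finiteness = summability).\<close>
definition G_fin :: "nat pmf \<Rightarrow> real \<Rightarrow> bool" where
  "G_fin mu t = (summable (\<lambda>k. pmf mu k * t ^ k) \<and>
                 summable (\<lambda>k. real k * pmf mu k * t ^ (k - 1)) \<and>
                 summable (\<lambda>k. real k * (real k - 1) * pmf mu k * t ^ (k - 2)))"

definition G :: "nat pmf \<Rightarrow> real \<Rightarrow> real" where
  "G mu t = (\<Sum>k. pmf mu k * t ^ k)"

definition G' :: "nat pmf \<Rightarrow> real \<Rightarrow> real" where
  "G' mu t = (\<Sum>k. real k * pmf mu k * t ^ (k - 1))"

definition G'' :: "nat pmf \<Rightarrow> real \<Rightarrow> real" where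
  "G'' mu t = (\<Sum>k. real k * (real k - 1) * pmf mu k * t ^ (k - 2))"

definition crit_set :: "nat pmf \<Rightarrow> real set" where
  "crit_set mu = {t. t > 0 \<and> G_fin mu t \<and>
      (G mu t - t * G' mu t)^2 = 2 * t^2 * G mu t * G'' mu t}"

definition phi :: "nat pmf \<Rightarrow> real \<Rightarrow> real" where
  "phi mu y = (y + 1) * G mu y - y * (y - 1) * G' mu y"

end

theory Submission
  imports Defs
begin

text \<open>
  A generating function \<open>F\<close> of a law of \<open>X\<close> solves \<open>(2qF - \<ell>)\<^sup>2 = \<ell>\<^sup>2 - f\<^sup>2\<close>, where
  \<open>\<ell>(x) = c + (1 - c) x\<close> with \<open>c = q F(0)\<close> and \<open>f(x)\<^sup>2 = 4 q (1 - q) x G(x)\<close>.  The point \<open>t\<^sub>c\<close> is the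
  unique inflection point of \<open>f\<close>, which is concave before it, and the criterion says that \<open>t\<^sub>c > 1\<close> and that the tangent of
  \<open>f\<close> at \<open>t\<^sub>c\<close> passes through or above \<open>(1, 1)\<close>, that is, that some line through \<open>(1, 1)\<close> is tangent to \<open>f\<close> at a
  point of \<open>(1, t\<^sub>c]\<close>.

  If \<open>X\<close> is finite, the coefficients of \<open>\<Delta> = 2qF - \<ell>\<close> are nonnegative from degree 2 on, those of
  \<open>\<Delta>\<^sup>2 = \<ell>\<^sup>2 - f\<^sup>2\<close> are nonpositive from degree 3 on, and \<open>\<Delta>(1) = 2q - 1 > 0\<close>.  The series \<open>\<Delta>\<close>
  then extends as long as it stays positive, so it vanishes at some \<open>y > 1\<close>, and there \<open>\<ell>\<close> touches \<open>f\<close>.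

  Conversely, for the tangent at \<open>s\<close>, write \<open>\<Delta>\<^sub>s = (s - x) S\<^sub>s\<close>, where all coefficients of \<open>S\<^sub>s\<close> but the
  first are nonpositive.  Then \<open>\<partial>\<Delta>\<^sub>s/\<partial>s = - f''(s) \<ell>\<^sub>s / S\<^sub>s\<close> has nonnegative coefficients as long as
  \<open>f\<close> is concave.  Starting from \<open>s \<rightarrow> 0\<close>, this makes \<open>(\<ell>\<^sub>y + \<Delta>\<^sub>y) / 2q\<close> the generating function of a
  probability law for the tangent through \<open>(1, 1)\<close> at \<open>y\<close>; this law is a fixed point of the recursion
  for \<open>X\<^sub>n\<close> and dominates every \<open>X\<^sub>n\<close> stochastically.
\<close>

section \<open>The law of the number of visits\<close>

text \<open>The quadratic comes from the recursion: a geometric number of children, each passing on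
  \<open>X - 1\<close> cars when this is positive, gives \<open>F = (1-q) G / (1 - q H)\<close> with
  \<open>x H = F - F(0) (1 - x)\<close>, hence \<open>q F^2 - \<ell> F + (1-q) x G = 0\<close>.
  Besides \<open>F\<close> only \<open>F(0)\<close> is unknown, and since
  \<open>\<ell>(1) = 1\<close>, choosing it means choosing a line through (1,1); tangency selects
  it. The root is fixed by \<open>F(1) = 1\<close>, that is \<open>\<Delta>(1) = 2q - 1\<close>. The
  criterion is the same condition because the height at 1 of the tangent at \<open>t\<close> has
  derivative \<open>(1 - t) f''(t)\<close>: it equals \<open>f(1) < 1\<close> at
  \<open>t = 1\<close> and grows up to \<open>t\<^sub>c\<close>. Two obstacles shape the work. From
  a finite law, nothing places the touching point in the range where \<open>G\<close> is known to be
  finite, and the series may end exactly there; finiteness of \<open>G\<close>, \<open>G'\<close>,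
  \<open>G''\<close> is a conclusion, drawn from differences on the left. From a tangency point,
  \<open>F\<close> is at first only a formal series: the signs of its coefficients, convergence at 1
  and the choice of the root there all have to be proved.\<close>

lemma visits_cong:
  assumes "\<And>t. w (u @ t) = w' (u @ t)"
  shows "visits w n u = visits w' n u"
  using assms
proof (induction n arbitrary: u)
  case 0
  from 0[of "[]"] show ?case by simp
next
  case (Suc n)
  have "visits w n (u @ [i]) = visits w' n (u @ [i])" for i
    using Suc.prems[of "i # _"] by (intro Suc.IH) simp
  then show ?case using Suc.prems[of "[]"] by simp
qed

lemma visits_mono_Suc: "visits w n u \<le> visits w (Suc n) u"
proof (induction n arbitrary: u)
  case (Suc n)
  have "(\<Sum>i<fst (w u). visits w n (u @ [i]) - 1) \<le> (\<Sum>i<fst (w u). visits w (Suc n) (u @ [i]) - 1)"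
    by (intro sum_mono diff_le_mono Suc.IH)
  then show ?case
    by (simp only: visits.simps(2)[of w _ u] add_le_cancel_left)
qed simp

lemma visits_mono: "m \<le> n \<Longrightarrow> visits w m u \<le> visits w n u"
  by (rule lift_Suc_mono_le[where f = "\<lambda>n. visits w n u"]) (auto intro: visits_mono_Suc simp del: visits.simps)

text \<open>Stated for a random configuration \<open>W\<close> on an arbitrary space, so that it
  applies both to the full product space and to the coordinates of a single subtree.\<close>

lemma measurable_visits:
  assumes W [measurable]: "\<And>v. (\<lambda>x. W x v) \<in> measurable N (count_space UNIV)"
  shows "(\<lambda>x. visits (W x) n u) \<in> measurable N (count_space UNIV)"
proof (induction n arbitrary: u)
  case 0
  show ?case using measurable_compose[OF W[of u], of snd "count_space UNIV"] by simp
next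
  case (Suc n)
  note [measurable] = Suc.IH
  have "(\<lambda>x. (\<lambda>k x. snd (W x u) + (\<Sum>i<k. visits (W x) n (u @ [i]) - 1)) (fst (W x u)) x)
      \<in> measurable N (count_space UNIV)"
    by (rule measurable_compose_countable) measurable
  then show ?case by simp
qed

section \<open>The distributional recursion and stochastic domination\<close>

primrec iid_sum :: "nat \<Rightarrow> nat pmf \<Rightarrow> nat pmf" where
  "iid_sum 0 p = return_pmf 0"
| "iid_sum (Suc k) p = bind_pmf p (\<lambda>z. map_pmf (\<lambda>s. s + z) (iid_sum k p))"

definition outflow :: "nat pmf \<Rightarrow> nat pmf" where
  "outflow p = map_pmf (\<lambda>k. k - 1) p"

definition parking_step :: "real \<Rightarrow> nat pmf \<Rightarrow> nat pmf \<Rightarrow> nat pmf" where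
  "parking_step q mu p = bind_pmf (offspring_law q) (\<lambda>k. bind_pmf mu (\<lambda>a.
     map_pmf (\<lambda>s. a + s) (iid_sum k (outflow p))))"

primrec visit_law :: "real \<Rightarrow> nat pmf \<Rightarrow> nat \<Rightarrow> nat pmf" where
  "visit_law q mu 0 = mu"
| "visit_law q mu (Suc n) = parking_step q mu (visit_law q mu n)"

lemma rel_pmf_iid_sum:
  assumes "rel_pmf (\<le>) p p'"
  shows "rel_pmf (\<le>) (iid_sum k p) (iid_sum k p')"
proof (induction k)
  case (Suc k)
  show ?case
    unfolding iid_sum.simps
  proof (rule rel_pmf_bindI[OF assms])
    fix x y :: nat assume "x \<le> y"
    then show "rel_pmf (\<le>) (map_pmf (\<lambda>s. s + x) (iid_sum k p)) (map_pmf (\<lambda>s. s + y) (iid_sum k p'))"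
      by (auto simp: pmf.rel_map intro!: pmf.rel_mono_strong[OF Suc])
  qed
qed simp

text \<open>\<open>rel_pmf (\<le>)\<close> is the existence of an ordered coupling, i.e. stochastic
  domination. The recursion preserves it because truncated subtraction and addition are
  monotone.\<close>

lemma rel_pmf_parking_step:
  assumes "rel_pmf (\<le>) p p'"
  shows "rel_pmf (\<le>) (parking_step q mu p) (parking_step q mu p')"
proof -
  have "rel_pmf (\<le>) (outflow p) (outflow p')"
    unfolding outflow_def by (auto simp: pmf.rel_map intro!: pmf.rel_mono_strong[OF assms])
  then have *: "rel_pmf (\<le>) (iid_sum k (outflow p)) (iid_sum k (outflow p'))" for k
    by (rule rel_pmf_iid_sum)
  show ?thesis
    unfolding parking_step_def
  proof (rule rel_pmf_bindI[where R = "(=)"])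
    fix k l :: nat assume "k = l"
    show "rel_pmf (\<le>) (bind_pmf mu (\<lambda>a. map_pmf (\<lambda>s. a + s) (iid_sum k (outflow p))))
        (bind_pmf mu (\<lambda>a. map_pmf (\<lambda>s. a + s) (iid_sum l (outflow p'))))"
    proof (rule rel_pmf_bindI[where R = "(=)"])
      fix a b :: nat assume "a = b"
      then show "rel_pmf (\<le>) (map_pmf (\<lambda>s. a + s) (iid_sum k (outflow p)))
        (map_pmf (\<lambda>s. b + s) (iid_sum l (outflow p')))"
        using \<open>k = l\<close> by (auto simp: pmf.rel_map intro!: pmf.rel_mono_strong[OF *])
    qed (simp add: pmf.rel_eq)
  qed (simp add: pmf.rel_eq)
qed

text \<open>The iteration starts at \<open>mu\<close>, which every fixed point dominates since one
  step only adds a nonnegative inflow to it; monotonicity of the step does the rest.\<close>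

lemma rel_pmf_visit_law:
  assumes "parking_step q mu p = p"
  shows "rel_pmf (\<le>) (visit_law q mu n) p"
proof (induction n)
  case 0
  \<comment> \<open>\<open>mu\<close> is written with an ignored offspring number, so that it can be
    coupled layer by layer with \<open>parking_step\<close>.\<close>
  have "rel_pmf (\<le>) (bind_pmf (offspring_law q) (\<lambda>k. bind_pmf mu return_pmf)) (parking_step q mu p)"
    unfolding parking_step_def
    by (intro rel_pmf_bindI[where R = "(=)"])
       (auto simp: pmf.rel_eq rel_pmf_return_pmf1)
  then show ?case by (simp add: assms bind_return_pmf')
next
  case (Suc n)
  then show ?case using rel_pmf_parking_step[OF Suc, of q mu] by (simp add: assms)
qed

section \<open>Independence in the space of configurations\<close>

context
  fixes q :: real and mu :: "nat pmf"
begin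

interpretation prob_space "config_space q mu"
  unfolding config_space_def by (intro prob_space_PiM measure_pmf.prob_space_axioms)

lemma space_config_space: "space (config_space q mu) = UNIV"
  unfolding config_space_def by (simp add: space_PiM)

lemma measurable_config_component [measurable]:
  "(\<lambda>w. w v) \<in> measurable (config_space q mu) (count_space UNIV)"
proof -
  have "(\<lambda>w. w v) \<in> measurable (config_space q mu) (measure_pmf (pair_pmf (offspring_law q) mu))"
    unfolding config_space_def by (rule measurable_component_singleton) simp
  then show ?thesis by simp
qed

lemma measurable_visits_config [measurable]:
  "(\<lambda>w. visits w n u) \<in> measurable (config_space q mu) (count_space UNIV)"
  by (rule measurable_visits) simp

lemma distr_config_component:
  "distr (config_space q mu) (measure_pmf (pair_pmf (offspring_law q) mu)) (\<lambda>w. w v)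
    = measure_pmf (pair_pmf (offspring_law q) mu)"
  unfolding config_space_def
  by (rule distr_PiM_component) (auto intro: measure_pmf.prob_space_axioms)

lemma prob_config_component:
  "prob {w. w v \<in> E} = measure_pmf.prob (pair_pmf (offspring_law q) mu) E"
proof -
  have "measure_pmf.prob (pair_pmf (offspring_law q) mu) E
     = measure (distr (config_space q mu) (measure_pmf (pair_pmf (offspring_law q) mu)) (\<lambda>w. w v)) E"
    by (simp only: distr_config_component)
  also have "\<dots> = prob ((\<lambda>w. w v) -` E \<inter> space (config_space q mu))"
    by (rule measure_distr) auto
  finally show ?thesis by (simp add: space_config_space vimage_def)
qed

lemma indep_vars_config:
  "indep_vars (\<lambda>_. measure_pmf (pair_pmf (offspring_law q) mu)) (\<lambda>v w. w v) UNIV"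
proof -
  let ?M = "measure_pmf (pair_pmf (offspring_law q) mu)"
  have "distr (config_space q mu) (PiM UNIV (\<lambda>_. ?M)) (\<lambda>w. \<lambda>i\<in>UNIV. w i) = config_space q mu"
    unfolding config_space_def restrict_UNIV by (rule distr_id2) simp
  also have "\<dots> = PiM UNIV (\<lambda>v. distr (config_space q mu) ?M (\<lambda>w. w v))"
    unfolding distr_config_component by (simp add: config_space_def)
  finally show ?thesis
    by (subst indep_vars_iff_distr_eq_PiM) auto
qed

text \<open>The word \<open>u\<close> and the sets of words below the different children are
  pairwise disjoint groups of coordinates. The index type \<open>option\<close> and the sum type put
  the pair at \<open>u\<close> and the visits at the children into one family.\<close>

lemma indep_children:
  "indep_vars (\<lambda>_. count_space UNIV)
     (\<lambda>j w. case j of None \<Rightarrow> Inl (w u) | Some i \<Rightarrow> Inr (visits w n (u @ [i]))) UNIV"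
proof -
  let ?M = "measure_pmf (pair_pmf (offspring_law q) mu)"
  define K where "K = (\<lambda>j. case j of None \<Rightarrow> {u} | Some i \<Rightarrow> {v. \<exists>t. v = u @ [i] @ t})"
  define Y where "Y = (\<lambda>j (x :: nat list \<Rightarrow> nat \<times> nat). case j of None \<Rightarrow> Inl (x u) | Some i \<Rightarrow> Inr (visits x n (u @ [i])))"
  have "disjoint_family_on K UNIV"
    unfolding disjoint_family_on_def K_def by (auto split: option.splits)
  then have "indep_vars (\<lambda>j. PiM (K j) (\<lambda>_. ?M)) (\<lambda>j w. restrict (\<lambda>v. w v) (K j)) UNIV"
    by (intro indep_vars_restrict[OF indep_vars_config]) auto
  moreover have "Y j \<in> measurable (PiM (K j) (\<lambda>_. ?M)) (count_space UNIV)" for j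
  proof -
    have comp [measurable]: "(\<lambda>x. x v) \<in> measurable (PiM (K j) (\<lambda>_. ?M)) (count_space UNIV)" for v
    proof (cases "v \<in> K j")
      case True
      then have "(\<lambda>x. x v) \<in> measurable (PiM (K j) (\<lambda>_. ?M)) ?M"
        by (rule measurable_component_singleton)
      then show ?thesis by simp
    next
      case False
      then show ?thesis
        by (subst measurable_cong[where g = "\<lambda>_. undefined"])
           (auto simp: space_PiM PiE_def extensional_def)
    qed
    show ?thesis
    proof (cases j)
      case None
      then show ?thesis
        unfolding Y_def using measurable_compose[OF comp[of u], of Inl "count_space UNIV"] by simp
    next
      case (Some i)
      have "(\<lambda>x. visits x n (u @ [i])) \<in> measurable (PiM (K j) (\<lambda>_. ?M)) (count_space UNIV)"
        by (rule measurable_visits[OF comp])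
      then show ?thesis
        unfolding Y_def using Some measurable_compose[where g = Inr and L = "count_space UNIV"] by simp
    qed
  qed
  ultimately have "indep_vars (\<lambda>_. count_space UNIV) (\<lambda>j w. Y j (restrict (\<lambda>v. w v) (K j))) UNIV"
    by (rule indep_vars_compose2)
  moreover have "Y j (restrict (\<lambda>v. w v) (K j))
      = (case j of None \<Rightarrow> Inl (w u) | Some i \<Rightarrow> Inr (visits w n (u @ [i])))" for j w
    unfolding Y_def K_def by (auto split: option.splits intro!: visits_cong)
  ultimately show ?thesis by simp
qed

lemma prob_children:
  assumes "finite J"
  shows "prob {w. w u = e \<and> (\<forall>i\<in>J. visits w n (u @ [i]) \<in> B i)}
    = pmf (pair_pmf (offspring_law q) mu) e * (\<Prod>i\<in>J. prob {w. visits w n (u @ [i]) \<in> B i})"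
proof -
  let ?Y = "\<lambda>j w. case j of None \<Rightarrow> Inl (w u) | Some i \<Rightarrow> Inr (visits w n (u @ [i]))"
  let ?A = "\<lambda>j. case j of None \<Rightarrow> {Inl e} | Some i \<Rightarrow> Inr ` B i"
  let ?J = "insert None (Some ` J)"
  have "prob (\<Inter>j\<in>?J. ?Y j -` ?A j \<inter> space (config_space q mu))
      = (\<Prod>j\<in>?J. prob (?Y j -` ?A j \<inter> space (config_space q mu)))"
    using assms by (intro indep_varsD[OF indep_children]) auto
  also have "\<dots> = prob {w. w u = e} * (\<Prod>i\<in>J. prob {w. visits w n (u @ [i]) \<in> B i})"
    using assms by (simp add: space_config_space prod.reindex vimage_def image_iff)
  also have "prob {w. w u = e} = pmf (pair_pmf (offspring_law q) mu) e"
    using prob_config_component[of u "{e}"] by (simp add: measure_pmf_single)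
  also have "(\<Inter>j\<in>?J. ?Y j -` ?A j \<inter> space (config_space q mu))
      = {w. w u = e \<and> (\<forall>i\<in>J. visits w n (u @ [i]) \<in> B i)}"
    by (auto simp: space_config_space)
  finally show ?thesis .
qed

lemma distr_eq_measure_pmf:
  fixes Y :: "_ \<Rightarrow> nat"
  assumes [measurable]: "Y \<in> measurable (config_space q mu) (count_space UNIV)"
    and p: "\<And>k. prob {w. Y w = k} = pmf p k"
  shows "distr (config_space q mu) (count_space UNIV) Y = measure_pmf p"
proof (rule measure_eqI_countable[where A = UNIV])
  fix a
  have "emeasure (distr (config_space q mu) (count_space UNIV) Y) {a} = ennreal (prob {w. Y w = a})"
    by (subst emeasure_distr) (auto simp: emeasure_eq_measure space_config_space vimage_def)
  then show "emeasure (distr (config_space q mu) (count_space UNIV) Y) {a} = emeasure (measure_pmf p) {a}"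
    by (simp add: p emeasure_pmf_single)
qed auto

text \<open>The event on a finite set \<open>J\<close> of further children carries the induction:
  the last summand is removed by prescribing the outflow \<open>c\<close> of child \<open>k\<close>,
  that is by moving \<open>k\<close> into \<open>J\<close>, and then summing over
  \<open>c\<close>.\<close>

lemma prob_iid_sum:
  assumes p: "\<And>i k. prob {w. visits w n (u @ [i]) = k} = pmf p k"
    and "finite J" "J \<inter> {..<k} = {}"
  shows "prob {w. w u = e \<and> (\<Sum>i<k. visits w n (u @ [i]) - 1) = s
        \<and> (\<forall>i\<in>J. visits w n (u @ [i]) - 1 = z i)}
    = pmf (pair_pmf (offspring_law q) mu) e * pmf (iid_sum k (outflow p)) s * (\<Prod>i\<in>J. pmf (outflow p) (z i))"
  using assms(2,3)
proof (induction k arbitrary: s J z)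
  case 0
  have "prob {w. visits w n (u @ [i]) - 1 = c} = pmf (outflow p) c" for i c
  proof -
    note distr_law = distr_eq_measure_pmf[OF measurable_visits_config p]
    have "prob {w. visits w n (u @ [i]) - 1 = c} = measure (distr (config_space q mu) (count_space UNIV) (\<lambda>w. visits w n (u @ [i]))) {k. k - 1 = c}"
      by (subst measure_distr) (auto simp: space_config_space vimage_def)
    also have "\<dots> = measure (outflow p) {c}"
      unfolding distr_law outflow_def by (simp add: vimage_def)
    finally show ?thesis by (simp add: measure_pmf_single)
  qed
  then show ?case
    using prob_children[OF 0(1), of u e n "\<lambda>i. {k. k - 1 = z i}"]
    by (cases "s = 0") (auto simp: pmf_return)
next
  case (Suc k)
  let ?e = "pmf (pair_pmf (offspring_law q) mu) e"
  let ?P = "\<lambda>c w. w u = e \<and> (\<Sum>i<k. visits w n (u @ [i]) - 1) = s - c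
        \<and> (\<forall>i\<in>insert k J. visits w n (u @ [i]) - 1 = (z(k := c)) i)"
  have k: "k \<notin> J" using Suc.prems by auto
  have eq: "prob {w. ?P c w} = ?e * pmf (iid_sum k (outflow p)) (s - c) * (pmf (outflow p) c * (\<Prod>i\<in>J. pmf (outflow p) (z i)))" for c
  proof -
    have "(\<Prod>i\<in>J. pmf (outflow p) ((z(k := c)) i)) = (\<Prod>i\<in>J. pmf (outflow p) (z i))"
      using k by (intro prod.cong) auto
    then show ?thesis
      using Suc.prems k by (subst Suc.IH) auto
  qed
  have split: "{w. w u = e \<and> (\<Sum>i<Suc k. visits w n (u @ [i]) - 1) = s \<and> (\<forall>i\<in>J. visits w n (u @ [i]) - 1 = z i)}
      = (\<Union>c\<in>{..s}. {w. ?P c w})"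
    using k by (auto simp: fun_upd_def)
  have "prob (\<Union>c\<in>{..s}. {w. ?P c w}) = (\<Sum>c\<le>s. prob {w. ?P c w})"
  proof (rule finite_measure_finite_Union)
    show "(\<lambda>c. {w. ?P c w}) ` {..s} \<subseteq> events"
    proof -
      have [measurable]: "finite (insert k J)" using Suc.prems by auto
      have "{w \<in> space (config_space q mu). ?P c w} \<in> events" for c
        by measurable
      then have "{w. ?P c w} \<in> events" for c
        by (simp only: space_config_space UNIV_I simp_thms)
      then show ?thesis by blast
    qed
    show "disjoint_family_on (\<lambda>c. {w. ?P c w}) {..s}"
      by (auto simp: disjoint_family_on_def)
  qed simp
  also have "\<dots> = ?e * (\<Sum>c\<le>s. pmf (iid_sum k (outflow p)) (s - c) * pmf (outflow p) c) * (\<Prod>i\<in>J. pmf (outflow p) (z i))"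
  proof -
    have "prob {w. ?P c w} = ?e * (pmf (iid_sum k (outflow p)) (s - c) * pmf (outflow p) c) * (\<Prod>i\<in>J. pmf (outflow p) (z i))" for c
      by (rule trans[OF eq]) (simp only: mult.assoc)
    then show ?thesis
      by (simp only: sum_distrib_left sum_distrib_right)
  qed
  also have "(\<Sum>c\<le>s. pmf (iid_sum k (outflow p)) (s - c) * pmf (outflow p) c) = pmf (iid_sum (Suc k) (outflow p)) s"
  proof -
    have *: "pmf (map_pmf (\<lambda>t. t + c) (iid_sum k (outflow p))) s = (if c \<le> s then pmf (iid_sum k (outflow p)) (s - c) else 0)" for c
    proof (cases "c \<le> s")
      case True
      then have "pmf (map_pmf (\<lambda>t. t + c) (iid_sum k (outflow p))) ((s - c) + c) = pmf (iid_sum k (outflow p)) (s - c)"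
        by (intro pmf_map_inj') (auto simp: inj_def)
      then show ?thesis using True by simp
    next
      case False
      then show ?thesis by (auto simp: pmf_eq_0_set_pmf)
    qed
    have "pmf (iid_sum (Suc k) (outflow p)) s = measure_pmf.expectation (outflow p) (\<lambda>c. if c \<le> s then pmf (iid_sum k (outflow p)) (s - c) else 0)"
      by (simp add: pmf_bind *)
    also have "\<dots> = (\<Sum>c\<le>s. pmf (outflow p) c * (if c \<le> s then pmf (iid_sum k (outflow p)) (s - c) else 0))"
      by (subst integral_measure_pmf[where A = "{..s}"]) (auto split: if_splits)
    finally show ?thesis by (simp add: mult_ac)
  qed
  finally show ?case unfolding split .
qed

lemma prob_visits: "prob {w. visits w n u = s} = pmf (visit_law q mu n) s"
proof (induction n arbitrary: u s)
  case 0
  have "prob {w. snd (w u) = s} = measure_pmf.prob (pair_pmf (offspring_law q) mu) (snd -` {s})"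
    using prob_config_component[of u "snd -` {s}"] by simp
  also have "\<dots> = measure_pmf.prob (map_pmf snd (pair_pmf (offspring_law q) mu)) {s}"
    by simp
  finally show ?case by (simp add: map_snd_pair_pmf measure_pmf_single)
next
  case (Suc n)
  let ?p = "visit_law q mu n" and ?S = "\<lambda>k w. \<Sum>i<k. visits w n (u @ [i]) - 1"
  let ?D = "pair_pmf (offspring_law q) mu"
  let ?f = "\<lambda>(k, a). map_pmf (\<lambda>t. a + t) (iid_sum k (outflow ?p))"
  \<comment> \<open>The number of children is random, so the event is split according to the pair at
    \<open>u\<close>; for a given pair the inflow is a sum over a fixed number of children.\<close>
  have pos: "prob {w. w u = (k, a) \<and> visits w (Suc n) u = s} = pmf ?D (k, a) * pmf (?f (k, a)) s" for k a
  proof (cases "a \<le> s")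
    case True
    then have "{w. w u = (k, a) \<and> visits w (Suc n) u = s} = {w. w u = (k, a) \<and> ?S k w = s - a \<and> (\<forall>i\<in>{}. visits w n (u @ [i]) - 1 = i)}"
      by auto
    also have "prob \<dots> = pmf ?D (k, a) * pmf (iid_sum k (outflow ?p)) (s - a)"
      by (subst prob_iid_sum[OF Suc]) auto
    also have "pmf (iid_sum k (outflow ?p)) (s - a) = pmf (?f (k, a)) (a + (s - a))"
      unfolding prod.case by (intro pmf_map_inj'[symmetric]) (auto simp: inj_def)
    finally show ?thesis using True by simp
  next
    case False
    then have "pmf (?f (k, a)) s = 0" "{w. w u = (k, a) \<and> visits w (Suc n) u = s} = {}"
      by (auto simp: pmf_eq_0_set_pmf)
    then show ?thesis by (simp only: measure_empty)
  qed
  have "emeasure (config_space q mu) {w. visits w (Suc n) u = s}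
     = emeasure (config_space q mu) (\<Union>e. {w \<in> space (config_space q mu). w u = e \<and> visits w (Suc n) u = s})"
    by (intro arg_cong[where f = "emeasure _"]) (auto simp: space_config_space)
  also have "\<dots> = (\<integral>\<^sup>+e. emeasure (config_space q mu) {w \<in> space (config_space q mu). w u = e \<and> visits w (Suc n) u = s} \<partial>count_space UNIV)"
    by (rule emeasure_UN_countable) (auto simp: disjoint_family_on_def simp del: visits.simps)
  also have "\<dots> = (\<integral>\<^sup>+e. ennreal (pmf ?D e) * ennreal (pmf (?f e) s) \<partial>count_space UNIV)"
    by (intro nn_integral_cong)
       (auto simp: emeasure_eq_measure space_config_space pos ennreal_mult simp del: visits.simps)
  also have "\<dots> = (\<integral>\<^sup>+e. ennreal (pmf (?f e) s) \<partial>measure_pmf ?D)"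
    by (simp add: nn_integral_measure_pmf)
  also have "\<dots> = ennreal (pmf (bind_pmf ?D ?f) s)"
    by (simp add: ennreal_pmf_bind)
  also have "bind_pmf ?D ?f = visit_law q mu (Suc n)"
    by (simp add: parking_step_def pair_pmf_def bind_assoc_pmf bind_return_pmf)
  finally show ?case by (simp add: emeasure_eq_measure del: visits.simps visit_law.simps)
qed


lemma distr_visits:
  "distr (config_space q mu) (count_space UNIV) (\<lambda>w. visits w n u) = measure_pmf (visit_law q mu n)"
  by (rule distr_eq_measure_pmf) (auto simp: prob_visits)

lemma prob_visits_ge: "prob {w. k \<le> visits w n u} = measure_pmf.prob (visit_law q mu n) {k..}"
  unfolding distr_visits[of n u, symmetric]
  by (subst measure_distr) (auto simp: space_config_space vimage_def)

text \<open>Domination bounds the tail at \<open>k\<close> of every finite-height number of visits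
  by that of \<open>p\<close>, uniformly in the height. Letting the height and then \<open>k\<close>
  tend to infinity shows that infinitely many visits have probability 0.\<close>

lemma subcritical_if_fixed_point:
  assumes fix_p: "parking_step q mu p = p"
  shows "subcritical q mu"
proof -
  define E where "E = (\<lambda>k n. {w. k \<le> visits w n []})"
  have meas_E [measurable]: "E k n \<in> events" for k n
  proof -
    have "{w \<in> space (config_space q mu). k \<le> visits w n []} \<in> events"
      by measurable
    then show ?thesis by (simp add: E_def space_config_space)
  qed
  have "prob (\<Union>n. E k n) \<le> measure_pmf.prob p {k..}" for k
  proof (rule LIMSEQ_le_const2)
    show "(\<lambda>n. prob (E k n)) \<longlonglongrightarrow> prob (\<Union>n. E k n)"
    proof (rule finite_Lim_measure_incseq)
      show "incseq (E k)"
        unfolding E_def incseq_def using visits_mono order_trans by blast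
    qed auto
    have "prob (E k n) \<le> measure_pmf.prob p {k..}" for n
    proof -
      have "{y. \<exists>x\<in>{k..}. x \<le> y} = {k..}" by auto
      then show ?thesis
        using rel_pmf_measureD[OF rel_pmf_visit_law[OF fix_p, of n], of "{k..}"]
        by (simp add: E_def prob_visits_ge)
    qed
    then show "\<exists>N. \<forall>n\<ge>N. prob (E k n) \<le> measure_pmf.prob p {k..}" by blast
  qed
  moreover have "prob (\<Inter>k. \<Union>n. E k n) \<le> prob (\<Union>n. E k n)" for k
    by (intro finite_measure_mono) auto
  ultimately have le: "prob (\<Inter>k. \<Union>n. E k n) \<le> measure_pmf.prob p {k..}" for k
    using order_trans by blast
  have "(\<lambda>k. measure_pmf.prob p {k..}) \<longlonglongrightarrow> measure_pmf.prob p (\<Inter>k. {k..})"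
    by (rule measure_pmf.finite_Lim_measure_decseq) (auto simp: decseq_def)
  moreover have "(\<Inter>k. {k..}) = ({} :: nat set)"
    using not_less_eq_eq by blast
  ultimately have "prob (\<Inter>k. \<Union>n. E k n) \<le> 0"
    using le by (intro LIMSEQ_le_const[where X = "\<lambda>k. measure_pmf.prob p {k..}"]) auto
  then have "(\<Inter>k. \<Union>n. E k n) \<in> null_sets (config_space q mu)"
    by (intro null_setsI) (auto simp: emeasure_eq_measure measure_le_0_iff)
  moreover have "w \<in> (\<Inter>k. \<Union>n. E k n)" if "\<not> X_root w < \<infinity>" for w
  proof safe
    fix k
    have "enat k < X_root w" using that by simp
    then obtain n where "enat k < enat (Xn_root w n)"
      unfolding X_root_def less_SUP_iff by blast
    then show "w \<in> (\<Union>n. E k n)"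
      by (auto simp: E_def Xn_root_def intro!: exI[of _ n])
  qed
  ultimately show ?thesis
    unfolding subcritical_def by (intro AE_I'[of "\<Inter>k. \<Union>n. E k n"]) auto
qed

lemma expectation_power_pmf:
  assumes "\<bar>x\<bar> \<le> 1"
  shows "measure_pmf.expectation p (\<lambda>k. x ^ k) = G p x"
    and "summable (\<lambda>k. \<bar>pmf p k * x ^ k\<bar>)"
proof -
  have "integrable (measure_pmf p) (\<lambda>k. x ^ k)"
    using assms by (intro measure_pmf.integrable_const_bound[where B = 1]) (auto simp: power_abs power_le_one)
  then have "integrable (count_space UNIV) (\<lambda>k. pmf p k * x ^ k)"
    unfolding measure_pmf_eq_density by (subst (asm) integrable_density) auto
  moreover have "measure_pmf.expectation p (\<lambda>k. x ^ k) = (\<integral>k. pmf p k * x ^ k \<partial>count_space UNIV)"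
    unfolding measure_pmf_eq_density by (subst integral_density) auto
  ultimately show "measure_pmf.expectation p (\<lambda>k. x ^ k) = G p x"
     "summable (\<lambda>k. \<bar>pmf p k * x ^ k\<bar>)"
    by (auto simp: G_def integral_count_space_nat integrable_count_space_nat_iff)
qed

lemma subcritical_imp_limit_law:
  assumes "subcritical q mu"
  shows "\<exists>p. \<forall>x. 0 \<le> x \<longrightarrow> x \<le> 1 \<longrightarrow> (\<lambda>n. G (visit_law q mu n) x) \<longlonglongrightarrow> G p x"
proof -
  \<comment> \<open>The limit of the visits wherever they are bounded. Elsewhere
    \<open>LEAST\<close> is an unspecified number, but by subcriticality this happens only on a null
    set.\<close>
  define Y where "Y = (\<lambda>w. LEAST m. \<forall>n. visits w n [] \<le> m)"
  have [measurable]: "Y \<in> measurable (config_space q mu) (count_space UNIV)"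
    unfolding Y_def by measurable
  have ev: "AE w in config_space q mu. \<forall>\<^sub>F n in sequentially. visits w n [] = Y w"
    using assms unfolding subcritical_def
  proof eventually_elim
    case (elim w)
    then obtain m where "X_root w = enat m" by auto
    then have "\<exists>m. \<forall>n. visits w n [] \<le> m"
      unfolding X_root_def Xn_root_def by (metis SUP_upper UNIV_I enat_ord_simps(1))
    then have bd: "visits w n [] \<le> Y w" for n
      unfolding Y_def by (rule LeastI2_ex) blast
    have "\<exists>N. visits w N [] = Y w"
    proof (rule ccontr)
      assume "\<not> ?thesis"
      then have "visits w n [] < Y w" for n using bd[of n] by (metis le_neq_implies_less)
      then have "\<forall>n. visits w n [] \<le> Y w - 1" "Y w > 0"
        by (metis Suc_pred' less_Suc_eq_le not_gr_zero not_less_zero)+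
      then have "Y w \<le> Y w - 1" unfolding Y_def by (intro Least_le) 
      with \<open>Y w > 0\<close> show False by simp
    qed
    then obtain N where "visits w N [] = Y w" by blast
    then show ?case
      using visits_mono[of N _ w "[]"] bd
      by (intro eventually_sequentiallyI[of N]) (metis antisym)
  qed
  define p where "p = embed_pmf (\<lambda>k. prob {w. Y w = k})"
  have "(\<integral>\<^sup>+k. ennreal (prob {w. Y w = k}) \<partial>count_space UNIV)
      = (\<integral>\<^sup>+k. emeasure (config_space q mu) {w \<in> space (config_space q mu). Y w = k} \<partial>count_space UNIV)"
    by (simp add: emeasure_eq_measure space_config_space)
  also have "\<dots> = emeasure (config_space q mu) (\<Union>k. {w \<in> space (config_space q mu). Y w = k})"
    by (rule emeasure_UN_countable[symmetric]) (auto simp: disjoint_family_on_def)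
  also have "(\<Union>k. {w \<in> space (config_space q mu). Y w = k}) = space (config_space q mu)"
    by auto
  finally have pmf_p: "pmf p k = prob {w. Y w = k}" for k
    unfolding p_def by (intro pmf_embed_pmf) (auto simp: emeasure_space_1)
  have distr_p: "distr (config_space q mu) (count_space UNIV) Y = measure_pmf p"
    by (rule distr_eq_measure_pmf) (auto simp: pmf_p)
  have "(\<lambda>n. G (visit_law q mu n) x) \<longlonglongrightarrow> G p x" if x: "0 \<le> x" "x \<le> 1" for x
  proof -
    have "(\<lambda>n. \<integral>w. x ^ visits w n [] \<partial>config_space q mu) \<longlonglongrightarrow> (\<integral>w. x ^ Y w \<partial>config_space q mu)"
    proof (rule integral_dominated_convergence[where w = "\<lambda>_. 1"])
      show "AE w in config_space q mu. (\<lambda>n. x ^ visits w n []) \<longlonglongrightarrow> x ^ Y w"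
        using ev
      proof eventually_elim
        case (elim w)
        then show ?case by (intro tendsto_eventually) (auto elim: eventually_mono)
      qed
    qed (use x in \<open>auto simp: power_le_one\<close>)
    moreover have "(\<integral>w. x ^ visits w n [] \<partial>config_space q mu) = G (visit_law q mu n) x" for n
    proof -
      have "(\<integral>w. x ^ visits w n [] \<partial>config_space q mu) = (\<integral>k. x ^ k \<partial>distr (config_space q mu) (count_space UNIV) (\<lambda>w. visits w n []))"
        by (subst integral_distr) auto
      then show ?thesis using x by (simp add: distr_visits expectation_power_pmf)
    qed
    moreover have "(\<integral>w. x ^ Y w \<partial>config_space q mu) = G p x"
    proof -
      have "(\<integral>w. x ^ Y w \<partial>config_space q mu) = (\<integral>k. x ^ k \<partial>distr (config_space q mu) (count_space UNIV) Y)"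
        by (subst integral_distr) auto
      then show ?thesis using x by (simp add: distr_p expectation_power_pmf)
    qed
    ultimately show ?thesis by simp
  qed
  then show ?thesis by blast
qed

end


section \<open>Generating functions\<close>

lemma G_nonneg: "0 \<le> x \<Longrightarrow> x \<le> 1 \<Longrightarrow> 0 \<le> G p x"
  and G_le_1: "0 \<le> x \<Longrightarrow> x \<le> 1 \<Longrightarrow> G p x \<le> 1"
  by (auto simp: expectation_power_pmf(1)[symmetric] power_le_one
      intro!: integral_nonneg measure_pmf.integral_le_const measure_pmf.integrable_const_bound[where B = 1])

text \<open>Working in \<open>ennreal\<close> lets generating functions of nested
  \<open>bind_pmf\<close> be computed without integrability conditions.\<close>

lemma nn_integral_power_pmf:
  assumes "0 \<le> x" "x \<le> 1"
  shows "(\<integral>\<^sup>+k. ennreal x ^ k \<partial>measure_pmf p) = ennreal (G p x)"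
proof -
  have "(\<integral>\<^sup>+k. ennreal x ^ k \<partial>measure_pmf p) = (\<integral>\<^sup>+k. ennreal (x ^ k) \<partial>measure_pmf p)"
    using assms by (simp add: ennreal_power)
  also have "\<dots> = ennreal (measure_pmf.expectation p (\<lambda>k. x ^ k))"
    using assms by (intro nn_integral_eq_integral measure_pmf.integrable_const_bound[where B = 1])
      (auto simp: power_le_one)
  finally show ?thesis using assms by (simp add: expectation_power_pmf)
qed

lemma nn_integral_power_iid_sum:
  "(\<integral>\<^sup>+s. a ^ s \<partial>measure_pmf (iid_sum k p)) = (\<integral>\<^sup>+s. a ^ s \<partial>measure_pmf p) ^ k" for a :: ennreal
  by (induction k) (simp_all add: power_add nn_integral_cmult nn_integral_multc mult.commute)

lemma G_outflow:
  assumes "0 \<le> x" "x \<le> 1"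
  shows "x * G (outflow p) x = G p x - pmf p 0 * (1 - x)"
proof -
  have "x * G (outflow p) x = (\<integral>k. x * x ^ (k - 1) \<partial>measure_pmf p)"
    using assms by (simp add: expectation_power_pmf(1)[symmetric] outflow_def)
  \<comment> \<open>\<open>x * x ^ (k - 1)\<close> is \<open>x ^ k\<close> except at
    \<open>k = 0\<close>, where truncated subtraction yields \<open>x\<close> instead of 1.\<close>
  also have "\<dots> = (\<integral>k. x ^ k - (1 - x) * indicator {0} k \<partial>measure_pmf p)"
    by (intro Bochner_Integration.integral_cong) (auto simp: indicator_def power_eq_if)
  also have "\<dots> = G p x - (1 - x) * pmf p 0"
    using assms
    by (subst Bochner_Integration.integral_diff)
       (auto simp: expectation_power_pmf(1) measure_pmf_single power_le_one
         intro!: measure_pmf.integrable_const_bound[where B = 1])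
  finally show ?thesis by simp
qed

lemma mult_less_one: "q * h < 1" if "0 < q" "q < 1" "h \<le> 1" for q h :: real
proof -
  have "q * h \<le> q * 1" using that by (intro mult_left_mono) auto
  then show ?thesis using that by linarith
qed

lemma G_offspring_law:
  assumes "0 < q" "q < 1" "0 \<le> h" "h \<le> 1"
  shows "G (offspring_law q) h = (1 - q) / (1 - q * h)"
proof -
  have "q * h < 1" using assms by (intro mult_less_one) auto
  then have "(\<lambda>k. (1 - q) * (q * h) ^ k) sums ((1 - q) * (1 / (1 - q * h)))"
    using assms by (intro sums_mult geometric_sums) auto
  then have "(\<lambda>k. pmf (offspring_law q) k * h ^ k) sums ((1 - q) / (1 - q * h))"
    using assms by (simp add: offspring_law_def power_mult_distrib mult_ac)
  then show ?thesis by (simp add: G_def sums_iff)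
qed

lemma G_parking_step:
  assumes "0 < q" "q < 1" "0 \<le> x" "x \<le> 1"
  shows "G (parking_step q mu p) x * (1 - q * G (outflow p) x) = (1 - q) * G mu x"
proof -
  let ?h = "G (outflow p) x"
  have h: "0 \<le> ?h" "?h \<le> 1" using assms G_nonneg G_le_1 by auto
  then have qh: "q * ?h < 1" using assms by (intro mult_less_one) auto
  have "ennreal (G (parking_step q mu p) x)
      = (\<integral>\<^sup>+k. \<integral>\<^sup>+a. ennreal x ^ a * ennreal ?h ^ k \<partial>mu \<partial>offspring_law q)"
    using assms by (simp add: nn_integral_power_pmf[symmetric] parking_step_def power_add
        nn_integral_cmult nn_integral_power_iid_sum)
  also have "\<dots> = ennreal (G mu x) * ennreal (G (offspring_law q) ?h)"
    using assms h by (simp add: nn_integral_power_pmf[symmetric] nn_integral_multc nn_integral_cmult)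
  also have "\<dots> = ennreal (G mu x * ((1 - q) / (1 - q * ?h)))"
    using assms h G_nonneg[of x mu] by (simp only: G_offspring_law ennreal_mult')
  finally have "G (parking_step q mu p) x = G mu x * ((1 - q) / (1 - q * ?h))"
    using assms h qh G_nonneg[of x] by (subst (asm) ennreal_inj) auto
  then show ?thesis using qh by (simp add: field_simps)
qed

text \<open>Equality is given only on (0,1). Once the first \<open>n\<close> coefficients of the
  difference vanish, dividing by \<open>x ^ n\<close> and letting \<open>x\<close> tend to 0 from
  the right isolates the next one.\<close>

lemma power_series_eq_imp_coeff_eq:
  fixes a b :: "nat \<Rightarrow> real"
  assumes "\<And>x. 0 < x \<Longrightarrow> x < 1 \<Longrightarrow> summable (\<lambda>k. a k * x ^ k)"
    and "\<And>x. 0 < x \<Longrightarrow> x < 1 \<Longrightarrow> summable (\<lambda>k. b k * x ^ k)"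
    and "\<And>x. 0 < x \<Longrightarrow> x < 1 \<Longrightarrow> (\<Sum>k. a k * x ^ k) = (\<Sum>k. b k * x ^ k)"
  shows "a = b"
proof -
  define c where "c = (\<lambda>k. a k - b k)"
  have c: "(\<lambda>k. c k * x ^ k) sums 0" if "0 < x" "x < 1" for x
    using sums_diff[OF summable_sums[OF assms(1)[of x]] summable_sums[OF assms(2)[of x]]] assms(3)[of x] that
    by (simp add: c_def left_diff_distrib)
  have "c n = 0" for n
  proof (induction n rule: less_induct)
    case (less n)
    have s: "(\<lambda>k. c (k + n) * x ^ k) sums 0" if "0 < x" "x < 1" for x
    proof -
      have "(\<lambda>k. c (k + n) * x ^ (k + n)) sums (0 - (\<Sum>k<n. c k * x ^ k))"
        using c[OF that] by (rule sums_split_initial_segment)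
      then have "(\<lambda>k. x ^ n * (c (k + n) * x ^ k)) sums (x ^ n * 0)"
        using less by (simp add: power_add mult_ac)
      then show ?thesis using that by (subst (asm) sums_mult_iff) auto
    qed
    have "((\<lambda>x. \<Sum>k. c (k + n) * x ^ k) \<longlongrightarrow> c (0 + n)) (at 0)"
    proof (rule powser_limit_0_strong)
      fix x :: real assume "x \<noteq> 0" "norm x < 1/2"
      have "summable (\<lambda>k. c (k + n) * (1/2) ^ k)" using s[of "1/2"] by (simp add: sums_iff)
      then have "summable (\<lambda>k. c (k + n) * x ^ k)"
        by (rule powser_inside) (use \<open>norm x < 1/2\<close> in simp)
      then show "(\<lambda>k. c (k + n) * x ^ k) sums (\<Sum>k. c (k + n) * x ^ k)" by (rule summable_sums)
    qed simp
    then have "((\<lambda>x. \<Sum>k. c (k + n) * x ^ k) \<longlongrightarrow> c n) (at_right 0)"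
      by (simp add: filterlim_at_split)
    moreover have "((\<lambda>x. \<Sum>k. c (k + n) * x ^ k) \<longlongrightarrow> 0) (at_right 0)"
    proof (rule tendsto_eventually)
      have "\<forall>\<^sub>F x :: real in at_right 0. x \<in> {0<..<1}"
        by (rule eventually_at_right_real) simp
      then show "\<forall>\<^sub>F x in at_right 0. (\<Sum>k. c (k + n) * x ^ k) = 0"
        by eventually_elim (use s in \<open>auto simp: sums_iff\<close>)
    qed
    ultimately show ?case using tendsto_unique trivial_limit_at_right_real by blast
  qed
  then show ?thesis unfolding c_def by auto
qed

lemma pmf_eqI_G:
  assumes "\<And>x. 0 < x \<Longrightarrow> x < 1 \<Longrightarrow> G p x = G p' x"
  shows "p = p'"
proof -
  have "summable (\<lambda>k. pmf r k * x ^ k)" if "0 < x" "x < 1" for r :: "nat pmf" and x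
    using expectation_power_pmf(2)[of x r] that by (simp add: summable_rabs_cancel)
  then have "pmf p = pmf p'"
    using assms by (intro power_series_eq_imp_coeff_eq) (auto simp: G_def)
  then show ?thesis by (simp add: pmf_eqI)
qed

text \<open>The hypothesis is \<open>x\<close> times the fixed point relation for generating
  functions: \<open>G p x\<close> and \<open>G (parking_step q mu p) x\<close> solve the same linear
  equation, whose factor \<open>1 - q * h\<close> is positive.\<close>

lemma fixed_point_if_equation:
  assumes q: "0 < q" "q < 1"
    and eq: "\<And>x. 0 < x \<Longrightarrow> x < 1 \<Longrightarrow>
      G p x * (x - q * (G p x - pmf p 0 * (1 - x))) = (1 - q) * x * G mu x"
  shows "parking_step q mu p = p"
proof (rule pmf_eqI_G)
  fix x :: real assume x: "0 < x" "x < 1"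
  let ?h = "G (outflow p) x"
  have h: "0 \<le> ?h" "?h \<le> 1" using x G_nonneg G_le_1 by auto
  then have qh: "q * ?h < 1" using q by (intro mult_less_one) auto
  have "G p x * (x - q * (x * ?h)) = (1 - q) * x * G mu x"
    using eq[OF x] x by (simp add: G_outflow)
  then have "x * (G p x * (1 - q * ?h)) = x * ((1 - q) * G mu x)"
    by (simp add: algebra_simps)
  also have "\<dots> = x * (G (parking_step q mu p) x * (1 - q * ?h))"
    using x q by (simp add: G_parking_step)
  finally show "G (parking_step q mu p) x = G p x"
    using x qh by simp
qed

text \<open>The recursion between consecutive heights passes to the limit; convergence of the
  generating functions at 0 supplies that of the atom at 0.\<close>

lemma subcritical_imp_equation:
  assumes q: "0 < q" "q < 1" and "subcritical q mu"
  shows "\<exists>p. \<forall>x. 0 < x \<longrightarrow> x < 1 \<longrightarrow>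
      G p x * (x - q * (G p x - pmf p 0 * (1 - x))) = (1 - q) * x * G mu x"
proof -
  obtain p where p: "\<And>x. 0 \<le> x \<Longrightarrow> x \<le> 1 \<Longrightarrow> (\<lambda>n. G (visit_law q mu n) x) \<longlonglongrightarrow> G p x"
    using subcritical_imp_limit_law[OF assms(3)] by blast
  have G0: "G r 0 = pmf r 0" for r
    unfolding G_def by (subst suminf_finite[where N = "{0}"]) auto
  have "G p x * (x - q * (G p x - pmf p 0 * (1 - x))) = (1 - q) * x * G mu x"
    if x: "0 < x" "x < 1" for x
  proof (rule LIMSEQ_unique)
    let ?L = "visit_law q mu"
    have "G (?L (Suc n)) x * (x - q * (G (?L n) x - pmf (?L n) 0 * (1 - x)))
        = (1 - q) * x * G mu x" for n
    proof -
      have "G (?L (Suc n)) x * (x - q * (x * G (outflow (?L n)) x))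
          = x * (G (parking_step q mu (?L n)) x * (1 - q * G (outflow (?L n)) x))"
        by (simp add: algebra_simps)
      then show ?thesis using x q by (simp add: G_outflow G_parking_step)
    qed
    then show "(\<lambda>n. G (?L (Suc n)) x * (x - q * (G (?L n) x - pmf (?L n) 0 * (1 - x))))
        \<longlonglongrightarrow> (1 - q) * x * G mu x" by simp
    show "(\<lambda>n. G (?L (Suc n)) x * (x - q * (G (?L n) x - pmf (?L n) 0 * (1 - x))))
        \<longlonglongrightarrow> G p x * (x - q * (G p x - pmf p 0 * (1 - x)))"
      using p[of x] p[of 0] x by (intro tendsto_intros LIMSEQ_Suc) (auto simp: G0)
  qed
  then show ?thesis by blast
qed

section \<open>The inflection point and the tangent lines\<close>

text \<open>\<open>inflection\<close> has the sign of \<open>- f''\<close>.\<close>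

definition inflection :: "nat pmf \<Rightarrow> real \<Rightarrow> real" where
  "inflection mu t = (G mu t - t * G' mu t)^2 - 2 * t^2 * G mu t * G'' mu t"

lemma G_fin_mono:
  assumes "G_fin mu t" "0 \<le> s" "s \<le> t"
  shows "G_fin mu s"
proof -
  have *: "summable (\<lambda>k. c k * s ^ m k)" if "summable (\<lambda>k. c k * t ^ m k)" "\<And>k. 0 \<le> c k"
    for c :: "nat \<Rightarrow> real" and m :: "nat \<Rightarrow> nat"
  proof (rule summable_comparison_test'[OF that(1), of 0])
    show "norm (c k * s ^ m k) \<le> c k * t ^ m k" for k
      using that(2)[of k] assms by (simp add: abs_mult mult_left_mono power_mono)
  qed
  have nn: "0 \<le> real k * (real k - 1) * pmf mu k" for k
    by (cases k) auto
  show ?thesis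
    using assms(1) unfolding G_fin_def by (intro conjI *) (auto intro: nn)
qed

lemma G_fin_sums:
  assumes "G_fin mu t"
  shows "(\<lambda>k. pmf mu k * t ^ k) sums G mu t"
    and "(\<lambda>k. real k * pmf mu k * t ^ (k - 1)) sums G' mu t"
    and "(\<lambda>k. real k * (real k - 1) * pmf mu k * t ^ (k - 2)) sums G'' mu t"
    and "(\<lambda>k. real k * pmf mu k * t ^ k) sums (t * G' mu t)"
    and "(\<lambda>k. real k * (real k - 1) * pmf mu k * t ^ k) sums (t^2 * G'' mu t)"
proof -
  show 1: "(\<lambda>k. pmf mu k * t ^ k) sums G mu t"
    and 2: "(\<lambda>k. real k * pmf mu k * t ^ (k - 1)) sums G' mu t"
    and 3: "(\<lambda>k. real k * (real k - 1) * pmf mu k * t ^ (k - 2)) sums G'' mu t"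
    using assms unfolding G_fin_def G_def G'_def G''_def by (auto intro: summable_sums)
  have eq1: "t * (real k * pmf mu k * t ^ (k - 1)) = real k * pmf mu k * t ^ k" for k
    by (cases k) auto
  show "(\<lambda>k. real k * pmf mu k * t ^ k) sums (t * G' mu t)"
    using sums_mult[OF 2, of t] by (simp only: eq1)
  have eq2: "t^2 * (real k * (real k - 1) * pmf mu k * t ^ (k - 2)) = real k * (real k - 1) * pmf mu k * t ^ k" for k
  proof -
    consider "k = 0" | "k = 1" | j where "k = Suc (Suc j)"
      by (metis One_nat_def not0_implies_Suc)
    then show ?thesis by cases (auto simp: power2_eq_square)
  qed
  show "(\<lambda>k. real k * (real k - 1) * pmf mu k * t ^ k) sums (t^2 * G'' mu t)"
    using sums_mult[OF 3, of "t^2"] by (simp only: eq2)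
qed

lemma exists_pmf_ge_2:
  fixes mu :: "nat pmf"
  assumes "pmf mu 0 + pmf mu 1 < 1"
  shows "\<exists>k\<ge>2. 0 < pmf mu k"
proof (rule ccontr)
  assume "\<not> ?thesis"
  then have "k < 2" if "k \<in> set_pmf mu" for k
    using pmf_positive[OF that] by (meson not_le)
  then have "set_pmf mu \<subseteq> {0, 1}"
    by (auto simp: less_2_cases_iff)
  then have "(\<Sum>k\<in>{0, 1}. pmf mu k) = 1"
    by (intro sum_pmf_eq_1) auto
  then show False using assms by simp
qed

lemma G_pos:
  assumes "G_fin mu t" "0 < t"
  shows "0 < G mu t"
proof -
  obtain k where "k \<in> set_pmf mu"
    using set_pmf_not_empty[of mu] by blast
  then have "0 < pmf mu k" by (rule pmf_positive)
  then show ?thesis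
    unfolding G_def using assms by (intro suminf_pos2[of _ k]) (auto simp: G_fin_def)
qed

lemma G'_nonneg: "G_fin mu t \<Longrightarrow> 0 \<le> t \<Longrightarrow> 0 \<le> G' mu t"
  unfolding G'_def G_fin_def by (intro suminf_nonneg) auto

context
  fixes mu :: "nat pmf"
  assumes two: "pmf mu 0 + pmf mu 1 < 1"
begin

lemma G''_pos:
  assumes "G_fin mu t" "0 < t"
  shows "0 < G'' mu t"
proof -
  obtain k where k: "k \<ge> 2" "0 < pmf mu k"
    using exists_pmf_ge_2[OF two] by blast
  have "0 \<le> real k * (real k - 1) * pmf mu k * t ^ (k - 2)" for k
    using assms by (cases k) auto
  then show ?thesis
    unfolding G''_def using assms k by (intro suminf_pos2[of _ k]) (auto simp: G_fin_def)
qed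

text \<open>Cauchy--Schwarz for the weights \<open>\<mu>\<^sub>k t\<^sup>k\<close> applied to \<open>k - 1\<close>, in discriminant form.\<close>

lemma inflection_neg:
  assumes fin: "G_fin mu t" and "0 < t" and le: "G mu t \<le> t * G' mu t"
  shows "inflection mu t < 0"
proof -
  define A where "A = t * G' mu t - G mu t"
  have pos: "0 < G mu t" "0 < G'' mu t" using G_pos G''_pos fin \<open>0 < t\<close> by auto
  \<comment> \<open>The mean of \<open>k - 1\<close> under the normalised weights, which minimises
    the weighted sum of \<open>(k - 1 - z)^2\<close>.\<close>
  define z where "z = A / G mu t"
  note s = G_fin_sums[OF fin]
  have "(\<lambda>k. (real k * (real k - 1) * pmf mu k * t ^ k - (1 + 2 * z) * (real k * pmf mu k * t ^ k))
      + (1 + z)^2 * (pmf mu k * t ^ k)) sums (t^2 * G'' mu t - (1 + 2 * z) * (t * G' mu t) + (1 + z)^2 * G mu t)"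
    by (intro sums_add sums_diff sums_mult s)
  then have S: "(\<lambda>k. pmf mu k * t ^ k * (real k - 1 - z)^2)
     sums (t^2 * G'' mu t - (1 + 2 * z) * (t * G' mu t) + (1 + z)^2 * G mu t)"
    by (rule sums_cong[THEN iffD1, rotated]) (auto simp: power2_eq_square algebra_simps)
  have "0 \<le> t^2 * G'' mu t - (1 + 2 * z) * (t * G' mu t) + (1 + z)^2 * G mu t"
    by (rule sums_le[OF _ sums_zero S]) (use \<open>0 < t\<close> in auto)
  also have "\<dots> = t^2 * G'' mu t - A - A * z"
    using pos by (simp add: A_def z_def power2_eq_square field_simps)
  finally have "A * z \<le> t^2 * G'' mu t"
    using le by (simp add: A_def)
  then have "A^2 \<le> t^2 * G'' mu t * G mu t"
    using pos by (simp add: z_def power2_eq_square field_simps)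
  moreover have "0 < t^2 * G'' mu t * G mu t" using pos \<open>0 < t\<close> by simp
  ultimately show ?thesis
    unfolding inflection_def by (simp add: A_def power2_commute mult_ac)
qed

lemma G_minus_antimono:
  assumes "G_fin mu t" "0 \<le> s" "s \<le> t"
  shows "G mu t - t * G' mu t \<le> G mu s - s * G' mu s"
proof (rule sums_le)
  note s = G_fin_sums[OF assms(1)] G_fin_sums[OF G_fin_mono[OF assms]]
  show "(\<lambda>k. pmf mu k * t ^ k - real k * pmf mu k * t ^ k) sums (G mu t - t * G' mu t)"
    "(\<lambda>k. pmf mu k * s ^ k - real k * pmf mu k * s ^ k) sums (G mu s - s * G' mu s)"
    by (intro sums_diff s)+
  show "pmf mu k * t ^ k - real k * pmf mu k * t ^ k \<le> pmf mu k * s ^ k - real k * pmf mu k * s ^ k" for k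
  proof (cases k)
    case (Suc j)
    have "real j * (pmf mu k * s ^ k) \<le> real j * (pmf mu k * t ^ k)"
      using assms by (intro mult_left_mono power_mono) auto
    then show ?thesis using Suc by (simp add: algebra_simps)
  qed simp
qed

text \<open>As long as \<open>G - t G'\<close> is nonnegative, its square does not increase, while
  \<open>t^2 G G''\<close> strictly increases.\<close>

lemma inflection_strict_antimono:
  assumes fin: "G_fin mu t" and st: "0 < s" "s < t" and ge: "t * G' mu t \<le> G mu t"
  shows "inflection mu t < inflection mu s"
proof -
  have fins: "G_fin mu s" using G_fin_mono fin st by auto
  have "(G mu t - t * G' mu t)^2 \<le> (G mu s - s * G' mu s)^2"
    using G_minus_antimono[OF fin, of s] st ge by (intro power_mono) auto
  moreover have "G mu s \<le> G mu t"
    by (rule sums_le[OF _ G_fin_sums(1)[OF fins] G_fin_sums(1)[OF fin]])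
       (use st in \<open>auto intro!: mult_left_mono power_mono\<close>)
  moreover have "G'' mu s \<le> G'' mu t"
  proof (rule sums_le[OF _ G_fin_sums(3)[OF fins] G_fin_sums(3)[OF fin]])
    fix k
    have "0 \<le> real k * (real k - 1) * pmf mu k" by (cases k) auto
    then show "real k * (real k - 1) * pmf mu k * s ^ (k - 2) \<le> real k * (real k - 1) * pmf mu k * t ^ (k - 2)"
      using st by (intro mult_left_mono power_mono) auto
  qed
  moreover have "0 < G mu s" "0 < G'' mu s" using G_pos G''_pos fins st by auto
  ultimately have "G mu s * G'' mu s \<le> G mu t * G'' mu t" "0 < G mu s * G'' mu s"
    by (auto intro!: mult_mono)
  moreover have "2 * s^2 < 2 * t^2" using st by (simp add: power_strict_mono)
  ultimately have "2 * s^2 * (G mu s * G'' mu s) < 2 * t^2 * (G mu t * G'' mu t)"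
    using st \<open>0 < G mu s * G'' mu s\<close> by (intro mult_less_le_imp_less[of "2 * s^2"]) auto
  then show ?thesis
    unfolding inflection_def using \<open>(G mu t - t * G' mu t)^2 \<le> _\<close> by (simp add: mult.assoc)
qed

lemma crit_set_iff: "t \<in> crit_set mu \<longleftrightarrow> 0 < t \<and> G_fin mu t \<and> inflection mu t = 0"
  unfolding crit_set_def inflection_def by auto

text \<open>A zero of \<open>inflection\<close> cannot lie where \<open>t G' \<ge> G\<close>, since
  \<open>inflection\<close> is negative there; before that range it is strictly decreasing. So there
  is a single zero, with a sign change, and the infimum in the criterion is attained.\<close>

lemma crit_point_props:
  assumes "tc \<in> crit_set mu"
  shows "tc * G' mu tc < G mu tc"
    and "\<And>t. 0 < t \<Longrightarrow> t < tc \<Longrightarrow> 0 < inflection mu t"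
    and "\<And>t. tc < t \<Longrightarrow> G_fin mu t \<Longrightarrow> inflection mu t < 0"
    and "crit_set mu = {tc}"
proof -
  have tc: "0 < tc" "G_fin mu tc" "inflection mu tc = 0" using assms crit_set_iff by auto
  show 1: "tc * G' mu tc < G mu tc"
    using inflection_neg[of tc] tc by force
  show 2: "0 < inflection mu t" if "0 < t" "t < tc" for t
    using inflection_strict_antimono[of tc t] tc 1 that by auto
  show 3: "inflection mu t < 0" if "tc < t" "G_fin mu t" for t
    using inflection_strict_antimono[of t tc] inflection_neg[of t] tc that by (cases "t * G' mu t \<le> G mu t") auto
  show "crit_set mu = {tc}"
    using assms 2 3 crit_set_iff by (metis (mono_tags, opaque_lifting) less_irrefl linorder_neqE_linordered_idom subset_antisym subsetI singletonD singletonI)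
qed

text \<open>\<open>G - t G'\<close> starts from \<open>pmf mu 0\<close> at 0, never increases, and
  is still positive at \<open>tc\<close>.\<close>

lemma pmf_0_pos:
  assumes "tc \<in> crit_set mu"
  shows "0 < pmf mu 0"
proof -
  have tc: "0 < tc" "G_fin mu tc" using assms crit_set_iff by auto
  have "G mu 0 - 0 * G' mu 0 \<ge> G mu tc - tc * G' mu tc"
    using tc by (intro G_minus_antimono) auto
  moreover have "G mu 0 = pmf mu 0"
    unfolding G_def by (subst suminf_finite[where N = "{0}"]) auto
  ultimately show ?thesis using crit_point_props(1)[OF assms] by simp
qed

end

section \<open>Regularity of the generating function and of its tangent lines\<close>

lemma continuous_on_power_series_nonneg:
  fixes a :: "nat \<Rightarrow> real" and m :: "nat \<Rightarrow> nat"
  assumes "summable (\<lambda>k. a k * r ^ m k)" "\<And>k. 0 \<le> a k"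
  shows "continuous_on {0..r} (\<lambda>x. \<Sum>k. a k * x ^ m k)"
proof (rule uniform_limit_theorem)
  show "uniform_limit {0..r} (\<lambda>n x. \<Sum>k<n. a k * x ^ m k) (\<lambda>x. \<Sum>k. a k * x ^ m k) sequentially"
    by (rule Weierstrass_m_test[OF _ assms(1)])
       (use assms(2) in \<open>auto simp: abs_mult power_abs intro!: mult_left_mono power_mono\<close>)
qed (auto intro!: continuous_intros always_eventually)

text \<open>The endpoint \<open>r\<close> is included because it may be the radius of convergence;
  derivatives are taken only strictly inside.\<close>

lemma continuous_on_G:
  assumes "G_fin mu r"
  shows "continuous_on {0..r} (G mu)" "continuous_on {0..r} (G' mu)"
proof -
  show "continuous_on {0..r} (G mu)"
    unfolding G_def[abs_def] using assms by (intro continuous_on_power_series_nonneg) (auto simp: G_fin_def)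
  show "continuous_on {0..r} (G' mu)"
    unfolding G'_def[abs_def] using assms by (intro continuous_on_power_series_nonneg) (auto simp: G_fin_def)
qed

lemma DERIV_G:
  assumes fin: "G_fin mu r" and t: "0 < t" "t < r"
  shows "(G mu has_real_derivative G' mu t) (at t)" "(G' mu has_real_derivative G'' mu t) (at t)"
proof -
  define a b where "a = pmf mu" and "b = diffs (pmf mu)"
  have b: "b k = real (Suc k) * pmf mu (Suc k)" for k
    by (simp add: b_def diffs_def)
  have b': "diffs b k = real (Suc (Suc k)) * (real (Suc (Suc k)) - 1) * pmf mu (Suc (Suc k))" for k
    by (simp add: diffs_def b)
  have G'_eq: "G' mu x = (\<Sum>k. b k * x ^ k)" if "G_fin mu x" for x
    using suminf_split_head[OF sums_summable[OF G_fin_sums(2)[OF that]]]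
    by (simp add: G'_def b)
  have G''_eq: "G'' mu x = (\<Sum>k. diffs b k * x ^ k)" if "G_fin mu x" for x
    using suminf_split_initial_segment[OF sums_summable[OF G_fin_sums(3)[OF that]], of 2]
    by (simp add: G''_def b' numeral_2_eq_2)
  have "summable (\<lambda>k. a k * r ^ k)" using fin unfolding G_fin_def a_def by simp
  then have "DERIV (\<lambda>x. \<Sum>k. a k * x ^ k) t :> (\<Sum>k. diffs a k * t ^ k)"
    by (rule termdiffs_strong) (use t in auto)
  then show "(G mu has_real_derivative G' mu t) (at t)"
    using G'_eq[OF G_fin_mono[OF fin]] t by (simp add: G_def[abs_def] a_def b_def)
  have "summable (\<lambda>k. real (Suc k) * pmf mu (Suc k) * r ^ (Suc k - 1))"
    using fin unfolding G_fin_def by (subst summable_Suc_iff) auto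
  then have "summable (\<lambda>k. b k * r ^ k)" by (simp add: b)
  then have "DERIV (\<lambda>x. \<Sum>k. b k * x ^ k) t :> (\<Sum>k. diffs b k * t ^ k)"
    by (rule termdiffs_strong) (use t in auto)
  then have "(G' mu has_real_derivative (\<Sum>k. diffs b k * t ^ k)) (at t)"
  proof (rule has_field_derivative_transform_within_open[where S = "{0<..<r}"])
    show "(\<Sum>k. b k * x ^ k) = G' mu x" if "x \<in> {0<..<r}" for x
      using G'_eq[OF G_fin_mono[OF fin]] that by auto
  qed (use t in auto)
  then show "(G' mu has_real_derivative G'' mu t) (at t)"
    using G''_eq[OF G_fin_mono[OF fin]] t by simp
qed

text \<open>For \<open>f(t) = 2\<kappa> (t G(t))\<^sup>1\<^sup>/\<^sup>2\<close>, \<open>slope\<close> is \<open>f'(t)\<close>, and \<open>intercept\<close>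
  is the value at \<open>0\<close> of the tangent line of \<open>f\<close> at \<open>t\<close>.\<close>

definition slope :: "real \<Rightarrow> nat pmf \<Rightarrow> real \<Rightarrow> real" where
  "slope \<kappa> mu t = \<kappa> * (G mu t + t * G' mu t) / sqrt (t * G mu t)"

definition intercept :: "real \<Rightarrow> nat pmf \<Rightarrow> real \<Rightarrow> real" where
  "intercept \<kappa> mu t = \<kappa> * t * (G mu t - t * G' mu t) / sqrt (t * G mu t)"

text \<open>The left side is the height at 1 of the tangent line at \<open>t\<close>; this is the
  origin of \<open>phi\<close>.\<close>

lemma slope_plus_intercept: "slope \<kappa> mu t + intercept \<kappa> mu t = \<kappa> * phi mu t / sqrt (t * G mu t)"
  unfolding slope_def intercept_def phi_def
  by (simp add: add_divide_distrib[symmetric]) (simp add: algebra_simps power2_eq_square)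

lemma tangent_value:
  assumes "0 < G mu t" "0 < t"
  shows "intercept \<kappa> mu t + slope \<kappa> mu t * t = 2 * \<kappa> * sqrt (t * G mu t)"
proof -
  have "intercept \<kappa> mu t + slope \<kappa> mu t * t = \<kappa> * 2 * (t * G mu t) / sqrt (t * G mu t)"
    unfolding slope_def intercept_def
    by (simp add: add_divide_distrib[symmetric]) (simp add: algebra_simps power2_eq_square)
  also have "\<dots> = 2 * \<kappa> * sqrt (t * G mu t)"
    using assms by (simp add: field_simps)
  finally show ?thesis .
qed

lemma continuous_on_tangent:
  assumes "G_fin mu r"
  shows "continuous_on {0<..r} (slope \<kappa> mu)" "continuous_on {0<..r} (intercept \<kappa> mu)"
proof -
  have G: "continuous_on {0<..r} (G mu)" "continuous_on {0<..r} (G' mu)"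
    by (rule continuous_on_subset[OF continuous_on_G(1)[OF assms]] continuous_on_subset[OF continuous_on_G(2)[OF assms]]; auto)+
  have "t * G mu t \<noteq> 0" if "t \<in> {0<..r}" for t
    using G_pos[OF G_fin_mono[OF assms]] that by force
  then show "continuous_on {0<..r} (slope \<kappa> mu)" "continuous_on {0<..r} (intercept \<kappa> mu)"
    unfolding slope_def[abs_def] intercept_def[abs_def]
    by (auto intro!: continuous_intros G)
qed

text \<open>These are \<open>f''\<close> and \<open>- t f''\<close>. The second follows from the
  first by differentiating \<open>f - t f'\<close>.\<close>

lemma DERIV_tangent:
  assumes fin: "G_fin mu r" and t: "0 < t" "t < r"
  shows "(slope \<kappa> mu has_real_derivative - (\<kappa> * inflection mu t / (2 * sqrt (t * G mu t) ^ 3))) (at t)"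
    and "(intercept \<kappa> mu has_real_derivative t * (\<kappa> * inflection mu t / (2 * sqrt (t * G mu t) ^ 3))) (at t)"
proof -
  have pos: "0 < G mu t" using G_pos[OF G_fin_mono[OF fin]] t by auto
  define h where "h = sqrt (t * G mu t)"
  have h: "0 < h" "h ^ 2 = t * G mu t" using pos t by (auto simp: h_def)
  note [derivative_intros] = DERIV_G[OF fin t]
  have dh: "((\<lambda>t. sqrt (t * G mu t)) has_real_derivative (G mu t + t * G' mu t) / (2 * h)) (at t)"
  proof -
    have "((\<lambda>t. t * G mu t) has_real_derivative G mu t + t * G' mu t) (at t)"
      by (auto intro!: derivative_eq_intros)
    then have "((\<lambda>t. sqrt (t * G mu t)) has_real_derivative inverse (sqrt (t * G mu t)) / 2 * (G mu t + t * G' mu t)) (at t)"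
      by (rule DERIV_chain2[where f = sqrt, rotated]) (rule DERIV_real_sqrt[OF mult_pos_pos[OF t(1) pos]])
    moreover have "inverse h / 2 * (G mu t + t * G' mu t) = (G mu t + t * G' mu t) / (2 * h)"
      using h(1) by (simp add: field_simps)
    ultimately show ?thesis by (simp only: h_def)
  qed
  have h3: "h ^ 3 = h * (t * G mu t)" using h(2) by (simp add: power3_eq_cube power2_eq_square mult.assoc)
  have "(slope \<kappa> mu has_real_derivative
      (\<kappa> * (2 * G' mu t + t * G'' mu t) * h - \<kappa> * (G mu t + t * G' mu t) * ((G mu t + t * G' mu t) / (2 * h))) / (h * h)) (at t)"
  proof -
    have "((\<lambda>t. \<kappa> * (G mu t + t * G' mu t)) has_real_derivative \<kappa> * (2 * G' mu t + t * G'' mu t)) (at t)"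
      by (auto intro!: derivative_eq_intros simp: algebra_simps)
    from DERIV_divide[OF this dh] show ?thesis
      unfolding slope_def[abs_def] using h by (simp only: h_def less_imp_neq[symmetric] not_False_eq_True)
  qed
  moreover have "(\<kappa> * (2 * G' mu t + t * G'' mu t) * h - \<kappa> * (G mu t + t * G' mu t) * ((G mu t + t * G' mu t) / (2 * h))) / (h * h)
     = (\<kappa> * (2 * G' mu t + t * G'' mu t) * (2 * h^2) - \<kappa> * (G mu t + t * G' mu t)^2) / (2 * h ^ 3)"
    using h(1) by (simp add: field_simps power2_eq_square power3_eq_cube)
  moreover have "\<kappa> * (2 * G' mu t + t * G'' mu t) * (2 * h^2) - \<kappa> * (G mu t + t * G' mu t)^2 = - (\<kappa> * inflection mu t)"
    unfolding h(2) inflection_def by (simp add: algebra_simps power2_eq_square)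
  ultimately show 1: "(slope \<kappa> mu has_real_derivative - (\<kappa> * inflection mu t / (2 * sqrt (t * G mu t) ^ 3))) (at t)"
    by (simp add: h_def)
  have "((\<lambda>t. 2 * \<kappa> * sqrt (t * G mu t) - slope \<kappa> mu t * t) has_real_derivative
      t * (\<kappa> * inflection mu t / (2 * sqrt (t * G mu t) ^ 3))) (at t)"
  proof -
    note DERIV_diff[OF DERIV_cmult[OF dh, of "2 * \<kappa>"] DERIV_mult[OF 1 DERIV_ident]]
    moreover have "2 * \<kappa> * ((G mu t + t * G' mu t) / (2 * h)) = slope \<kappa> mu t"
      by (simp add: slope_def h_def)
    ultimately show ?thesis by (simp add: mult.commute)
  qed
  then show "(intercept \<kappa> mu has_real_derivative t * (\<kappa> * inflection mu t / (2 * sqrt (t * G mu t) ^ 3))) (at t)"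
  proof (rule has_field_derivative_transform_within_open[where S = "{0<..<r}"])
    fix x assume x: "x \<in> {0<..<r}"
    then have "0 < G mu x" using G_pos[OF G_fin_mono[OF fin]] by auto
    then show "2 * \<kappa> * sqrt (x * G mu x) - slope \<kappa> mu x * x = intercept \<kappa> mu x"
      using tangent_value[of mu x \<kappa>] x by auto
  qed (use t in auto)
qed

section \<open>A tangency point from a finite law\<close>

lemma Cauchy_product_power_sums:
  fixes a b :: "nat \<Rightarrow> real"
  assumes "summable (\<lambda>k. \<bar>a k * x ^ k\<bar>)" "summable (\<lambda>k. \<bar>b k * x ^ k\<bar>)"
  shows "(\<lambda>n. (\<Sum>i\<le>n. a i * b (n - i)) * x ^ n) sums ((\<Sum>k. a k * x ^ k) * (\<Sum>k. b k * x ^ k))"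
proof -
  have "(\<lambda>n. \<Sum>i\<le>n. (a i * x ^ i) * (b (n - i) * x ^ (n - i)))
      sums ((\<Sum>k. a k * x ^ k) * (\<Sum>k. b k * x ^ k))"
    using assms by (intro Cauchy_product_sums) auto
  moreover have "(\<Sum>i\<le>n. (a i * x ^ i) * (b (n - i) * x ^ (n - i))) = (\<Sum>i\<le>n. a i * b (n - i)) * x ^ n" for n
    unfolding sum_distrib_right
  proof (rule sum.cong[OF refl])
    fix i assume "i \<in> {..n}"
    then have "x ^ i * x ^ (n - i) = x ^ n" by (simp add: power_add[symmetric])
    moreover have "(a i * x ^ i) * (b (n - i) * x ^ (n - i)) = a i * b (n - i) * (x ^ i * x ^ (n - i))"
      by (simp only: mult_ac)
    ultimately show "(a i * x ^ i) * (b (n - i) * x ^ (n - i)) = a i * b (n - i) * x ^ n"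
      by (simp only:)
  qed
  ultimately show ?thesis by simp
qed

text \<open>The triangle \<open>i + j \<le> K\<close> contains the rectangle with sides
  \<open>J\<close> and \<open>K - J\<close> in both orientations, and the two copies overlap in the
  square of side \<open>J\<close>.\<close>

lemma convolution_partial_sum_ge:
  fixes a :: "nat \<Rightarrow> real"
  assumes nn: "\<And>k. 0 \<le> a k" and K: "2 * J \<le> K"
  shows "2 * (\<Sum>k\<le>J. a k) * (\<Sum>k\<le>K - J. a k) - (\<Sum>k\<le>J. a k)^2 \<le> (\<Sum>n\<le>K. \<Sum>i\<le>n. a i * a (n - i))"
proof -
  let ?A = "{..J} \<times> {..K - J}" and ?B = "{..K - J} \<times> {..J}"
  let ?g = "\<lambda>(i, j). a i * a j"
  have "sum ?g (?A \<union> ?B) + sum ?g (?A \<inter> ?B) = sum ?g ?A + sum ?g ?B"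
    by (rule sum.union_inter) auto
  moreover have "?A \<inter> ?B = {..J} \<times> {..J}" using K by auto
  moreover have "sum ?g ({..m} \<times> {..n}) = (\<Sum>k\<le>m. a k) * (\<Sum>k\<le>n. a k)" for m n
    by (simp add: sum_product sum.cartesian_product)
  moreover have "sum ?g (?A \<union> ?B) \<le> sum ?g {(i, j). i + j \<le> K}"
  proof (rule sum_mono2)
    show "finite {(i, j). i + j \<le> K}"
      by (rule finite_subset[of _ "{..K} \<times> {..K}"]) auto
  qed (use K nn in auto)
  moreover have "sum ?g {(i, j). i + j \<le> K} = (\<Sum>n\<le>K. \<Sum>i\<le>n. a i * a (n - i))"
    by (rule sum.triangle_reindex_eq)
  ultimately show ?thesis by (simp add: power2_eq_square mult_ac)
qed

text \<open>If the series diverged just to the right of \<open>x\<close>, the partial sums \<open>T\<^sub>K\<close> there would satisfy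
  \<open>T\<^sub>K\<^sub>-\<^sub>J \<ge> \<beta> T\<^sub>K\<close> for arbitrarily large \<open>K\<close>, because they grow at most like \<open>(t/x)\<^sup>K\<close>;
  summing the recursive inequality up to such a \<open>K\<close> would bound \<open>T\<^sub>K\<close>.\<close>

lemma summable_beyond:
  fixes a :: "nat \<Rightarrow> real"
  assumes nn: "\<And>k. 0 \<le> a k" and a01: "a 0 = 0" "a 1 = 0" and c: "0 < c" and d: "0 \<le> d"
    and ineq: "\<And>n. 3 \<le> n \<Longrightarrow> 2 * c * a n + (\<Sum>i\<le>n. a i * a (n - i)) \<le> 2 * d * a (n - 1)"
    and x: "0 < x" "summable (\<lambda>k. a k * x ^ k)" and pos: "0 < c - d * x + (\<Sum>k. a k * x ^ k)"
  shows "\<exists>t>x. summable (\<lambda>k. a k * t ^ k)"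
proof -
  define S where "S = (\<Sum>k. a k * x ^ k)"
  define T where "T = (\<lambda>t K. \<Sum>k\<le>K. a k * t ^ k)"
  have T_mono: "T t K \<le> T t K'" if "K \<le> K'" "0 \<le> t" for t K K'
    unfolding T_def using that nn by (intro sum_mono2) auto
  \<comment> \<open>The order of the choices matters: \<open>J\<close> makes the strict inequality
    hold for a partial sum, \<open>\<beta> < 1\<close> leaves room in it, and only then is
    \<open>t > x\<close> taken so close to \<open>x\<close> that the inequality persists and
    \<open>\<beta> * (t / x) ^ J < 1\<close>.\<close>
  have "(\<lambda>J. c - d * x + T x J) \<longlonglongrightarrow> c - d * x + S"
    unfolding T_def S_def by (intro tendsto_intros summable_LIMSEQ' x)
  then have "\<forall>\<^sub>F J in sequentially. 0 < c - d * x + T x J"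
    using pos unfolding S_def by (auto dest: order_tendstoD)
  then obtain J0 where J0: "0 < c - d * x + T x J0" unfolding eventually_sequentially by blast
  define J where "J = Suc J0"
  have J: "0 < c - d * x + T x J" using J0 T_mono[of J0 J x] x by (simp add: J_def)
  have "((\<lambda>\<beta>. c - d * x + \<beta> * T x J) \<longlongrightarrow> c - d * x + 1 * T x J) (at_left 1)"
    by (intro tendsto_intros)
  then have "\<forall>\<^sub>F \<beta> in at_left 1. 0 < c - d * x + \<beta> * T x J"
    using J by (auto dest: order_tendstoD)
  moreover have "\<forall>\<^sub>F \<beta> :: real in at_left 1. \<beta> \<in> {0<..<1}"
    by (rule eventually_at_left_real) simp
  ultimately have "\<forall>\<^sub>F \<beta> in at_left 1. 0 < c - d * x + \<beta> * T x J \<and> \<beta> \<in> {0<..<1}"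
    by eventually_elim auto
  then obtain \<beta> where \<beta>: "0 < c - d * x + \<beta> * T x J" "0 < \<beta>" "\<beta> < 1"
    using eventually_happens[of _ "at_left (1::real)"] by (auto simp: trivial_limit_at_left_real)
  have "((\<lambda>t. c - d * t + \<beta> * T x J) \<longlongrightarrow> c - d * x + \<beta> * T x J) (at_right x)"
    by (intro tendsto_intros)
  then have "\<forall>\<^sub>F t in at_right x. 0 < c - d * t + \<beta> * T x J"
    using \<beta> by (auto dest: order_tendstoD)
  moreover have "((\<lambda>t. \<beta> * (t / x) ^ J) \<longlongrightarrow> \<beta> * (x / x) ^ J) (at_right x)"
    using x by (intro tendsto_intros) auto
  then have "\<forall>\<^sub>F t in at_right x. \<beta> * (t / x) ^ J < 1"
    using \<beta> x by (auto dest: order_tendstoD)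
  moreover have "\<forall>\<^sub>F t in at_right x. x < t"
    by (rule eventually_at_right_less)
  ultimately have "\<forall>\<^sub>F t in at_right x. 0 < c - d * t + \<beta> * T x J \<and> \<beta> * (t / x) ^ J < 1 \<and> x < t"
    by eventually_elim auto
  then obtain t where t: "0 < c - d * t + \<beta> * T x J" "\<beta> * (t / x) ^ J < 1" "x < t"
    using eventually_happens[of _ "at_right x"] by (auto simp: trivial_limit_at_right_real)
  have t0: "0 < t" using t x by simp
  define e where "e = c - d * t + \<beta> * T t J"
  have "T x J \<le> T t J"
    unfolding T_def using t x nn by (intro sum_mono mult_left_mono power_mono) auto
  then have e: "0 < e" unfolding e_def using t \<beta> by (smt (verit) mult_left_mono)
  define C where "C = (T t J)^2 + 2 * c * a 2 * t ^ 2"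
  have step: "2 * T t K * e \<le> C" if K: "2 * J \<le> K" "3 \<le> K" and ge: "\<beta> * T t K \<le> T t (K - J)" for K
  proof -
    let ?\<alpha> = "\<lambda>k. a k * t ^ k"
    have conv: "(\<Sum>i\<le>n. ?\<alpha> i * ?\<alpha> (n - i)) = t ^ n * (\<Sum>i\<le>n. a i * a (n - i))" for n
      unfolding sum_distrib_left
    proof (rule sum.cong[OF refl])
      fix i assume "i \<in> {..n}"
      then have "t ^ i * t ^ (n - i) = t ^ n" by (simp add: power_add[symmetric])
      moreover have "?\<alpha> i * ?\<alpha> (n - i) = (t ^ i * t ^ (n - i)) * (a i * a (n - i))"
        by (simp only: mult_ac)
      ultimately show "?\<alpha> i * ?\<alpha> (n - i) = t ^ n * (a i * a (n - i))"
        by (simp only:)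
    qed
    have n2: "n = 0 \<or> n = 1 \<or> n = 2" if "n < 3" for n :: nat using that by auto
    have "2 * T t J * T t (K - J) - (T t J)^2 \<le> (\<Sum>n\<le>K. t ^ n * (\<Sum>i\<le>n. a i * a (n - i)))"
      using convolution_partial_sum_ge[of ?\<alpha> J K] nn t0 K unfolding T_def conv by simp
    also have "\<dots> \<le> (\<Sum>n\<le>K. 2 * d * t * (if n = 0 then 0 else ?\<alpha> (n - 1)) - 2 * c * ?\<alpha> n + (if n = 2 then 2 * c * a 2 * t ^ 2 else 0))"
    proof (rule sum_mono)
      fix n assume "n \<in> {..K}"
      show "t ^ n * (\<Sum>i\<le>n. a i * a (n - i)) \<le> 2 * d * t * (if n = 0 then 0 else ?\<alpha> (n - 1)) - 2 * c * ?\<alpha> n + (if n = 2 then 2 * c * a 2 * t ^ 2 else 0)"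
      proof (cases "3 \<le> n")
        case True
        have tn: "t * t ^ (n - 1) = t ^ n" using True by (cases n) auto
        have "t ^ n * (2 * c * a n + (\<Sum>i\<le>n. a i * a (n - i))) \<le> t ^ n * (2 * d * a (n - 1))"
          using ineq[OF True] t0 by (intro mult_left_mono) auto
        also have "\<dots> = 2 * d * t * ?\<alpha> (n - 1)"
          unfolding tn[symmetric] by simp
        finally show ?thesis using True by (simp add: algebra_simps)
      next
        case False
        then show ?thesis using n2[of n] a01 by (auto simp: numeral_2_eq_2)
      qed
    qed
    also have "\<dots> = 2 * d * t * (\<Sum>n\<le>K. if n = 0 then 0 else ?\<alpha> (n - 1)) - 2 * c * T t K + 2 * c * a 2 * t ^ 2"
      using K by (simp add: sum.distrib sum_subtractf sum_distrib_left T_def mult.assoc)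
    also have "(\<Sum>n\<le>K. if n = 0 then 0 else ?\<alpha> (n - 1)) = T t (K - 1)"
      using K unfolding T_def by (cases K) (simp_all del: sum.atMost_Suc add: sum.atMost_Suc_shift)
    also have "2 * d * t * T t (K - 1) \<le> 2 * d * t * T t K"
      using d t0 T_mono[of "K - 1" K t] by (intro mult_left_mono) auto
    finally have "2 * T t J * T t (K - J) + 2 * c * T t K - 2 * d * t * T t K \<le> C"
      by (simp add: C_def)
    moreover have "T t J * (\<beta> * T t K) \<le> T t J * T t (K - J)"
      using nn t0 by (intro mult_left_mono ge) (auto simp: T_def intro!: sum_nonneg)
    ultimately show ?thesis by (simp add: e_def algebra_simps)
  qed
  have "summable (\<lambda>k. a k * t ^ k)"
  proof (rule ccontr)
    assume div: "\<not> summable (\<lambda>k. a k * t ^ k)"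
    have unb: "\<exists>K. B < T t K" for B
    proof (rule ccontr)
      assume "\<not> ?thesis"
      then have "(\<Sum>k<n. a k * t ^ k) \<le> max B 0" for n
        unfolding T_def by (cases n) (auto simp: lessThan_Suc_atMost not_less le_max_iff_disj)
      then have "summable (\<lambda>k. a k * t ^ k)"
        using nn t0 by (intro summableI_nonneg_bounded[where x = "max B 0"]) auto
      with div show False by simp
    qed
    obtain K1 where K1: "max (C / (2 * e)) 0 < T t K1" using unb by blast
    define K0 where "K0 = max K1 (2 * J + 3)"
    have big: "C / (2 * e) < T t K" "0 < T t K" if "K0 \<le> K" for K
      using K1 T_mono[of K1 K t] t0 that by (auto simp: K0_def)
    have lt: "T t (K - J) < \<beta> * T t K" if "K0 \<le> K" for K
    proof (rule ccontr)
      assume "\<not> ?thesis"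
      then have "2 * T t K * e \<le> C" using step[of K] that by (auto simp: K0_def)
      then show False using big(1)[OF that] e by (simp add: field_simps)
    qed
    have low: "T t K0 \<le> \<beta> ^ m * T t (K0 + m * J)" for m
    proof (induction m)
      case (Suc m)
      have "T t (K0 + m * J) \<le> \<beta> * T t (K0 + Suc m * J)"
        using lt[of "K0 + Suc m * J"] by (simp add: algebra_simps)
      then have "\<beta> ^ m * T t (K0 + m * J) \<le> \<beta> ^ m * (\<beta> * T t (K0 + Suc m * J))"
        using \<beta> by (intro mult_left_mono) auto
      then show ?case using Suc by (simp add: mult_ac)
    qed simp
    have up: "T t K \<le> (t / x) ^ K * S" for K
    proof -
      have "T t K \<le> (\<Sum>k\<le>K. (t / x) ^ K * (a k * x ^ k))"
        unfolding T_def
      proof (rule sum_mono)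
        fix k assume "k \<in> {..K}"
        have "a k * t ^ k = (t / x) ^ k * (a k * x ^ k)" using x by (simp add: power_divide)
        also have "\<dots> \<le> (t / x) ^ K * (a k * x ^ k)"
          using \<open>k \<in> {..K}\<close> x t nn by (intro mult_right_mono power_increasing) auto
        finally show "a k * t ^ k \<le> (t / x) ^ K * (a k * x ^ k)" .
      qed
      also have "\<dots> \<le> (t / x) ^ K * S"
        unfolding S_def sum_distrib_left[symmetric] using x t nn
        by (intro mult_left_mono sum_le_suminf) auto
      finally show ?thesis .
    qed
    define r where "r = \<beta> * (t / x) ^ J"
    have r: "0 \<le> r" "r < 1" using t \<beta> x by (auto simp: r_def)
    have "T t K0 \<le> r ^ m * ((t / x) ^ K0 * S)" for m
    proof -
      have "T t K0 \<le> \<beta> ^ m * ((t / x) ^ (K0 + m * J) * S)"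
        using low[of m] up[of "K0 + m * J"] \<beta> by (meson mult_left_mono order_trans zero_le_power less_imp_le)
      also have "\<dots> = r ^ m * ((t / x) ^ K0 * S)"
        by (simp add: r_def power_add power_mult_distrib power_mult[symmetric] mult.commute[of J])
      finally show ?thesis .
    qed
    moreover have "(\<lambda>m. r ^ m * ((t / x) ^ K0 * S)) \<longlonglongrightarrow> 0 * ((t / x) ^ K0 * S)"
      using r by (intro tendsto_intros LIMSEQ_power_zero) auto
    ultimately have "T t K0 \<le> 0 * ((t / x) ^ K0 * S)"
      by (intro LIMSEQ_le_const[where X = "\<lambda>m. r ^ m * ((t / x) ^ K0 * S)"]) auto
    then show False using big(2)[of K0] by simp
  qed
  then show ?thesis using t by blast
qed

text \<open>Convexity and second-order Taylor bounds for a monomial, with the bounding derivative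
  taken at one end of the interval. Summed against nonnegative weights, they turn differences of a
  series to the left of \<open>y\<close> into statements about its derivatives at
  \<open>y\<close>.\<close>

lemma power_diff_ge:
  fixes x y :: real
  assumes "0 \<le> x" "x \<le> y"
  shows "real k * x ^ (k - 1) * (y - x) \<le> y ^ k - x ^ k"
    and "y ^ k - x ^ k \<le> real k * y ^ (k - 1) * (y - x)"
    and "real k * (real k - 1) / 2 * x ^ (k - 2) * (x - y)^2 \<le> x ^ k - y ^ k - real k * y ^ (k - 1) * (x - y)"
proof -
  have pw: "x ^ k \<le> y ^ k" for k using assms by (intro power_mono) auto
  show 1: "real k * x ^ (k - 1) * (y - x) \<le> y ^ k - x ^ k" for k
  proof (induction k)
    case (Suc k)
    have "real (Suc k) * x ^ (Suc k - 1) * (y - x) = x * (real k * x ^ (k - 1) * (y - x)) + x ^ k * (y - x)"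
      by (cases k) (auto simp: algebra_simps)
    also have "\<dots> \<le> x * (y ^ k - x ^ k) + y ^ k * (y - x)"
      using Suc assms pw by (intro add_mono mult_left_mono mult_right_mono) auto
    finally show ?case by (simp add: algebra_simps)
  qed simp
  show 2: "real k * (real k - 1) / 2 * x ^ (k - 2) * (x - y)^2 \<le> x ^ k - y ^ k - real k * y ^ (k - 1) * (x - y)" for k
  proof (induction k)
    case (Suc k)
    have a: "x ^ Suc k - y ^ Suc k - real (Suc k) * y ^ (Suc k - 1) * (x - y)
       = x * (x ^ k - y ^ k - real k * y ^ (k - 1) * (x - y)) + real k * y ^ (k - 1) * (x - y)^2"
      by (cases k) (auto simp: algebra_simps power2_eq_square)
    have b: "real (Suc k) * (real (Suc k) - 1) / 2 * x ^ (Suc k - 2) * (x - y)^2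
       = x * (real k * (real k - 1) / 2 * x ^ (k - 2) * (x - y)^2) + real k * x ^ (k - 1) * (x - y)^2"
    proof -
      consider "k = 0" | "k = 1" | j where "k = Suc (Suc j)" by (metis One_nat_def not0_implies_Suc)
      then show ?thesis by cases (auto simp: field_simps)
    qed
    show ?case unfolding a b
      using Suc assms pw by (intro add_mono mult_left_mono mult_right_mono) auto
  qed simp
  show "y ^ k - x ^ k \<le> real k * y ^ (k - 1) * (y - x)"
  proof -
    have "0 \<le> real k * (real k - 1) / 2 * x ^ (k - 2) * (x - y)^2"
      using assms by (cases k) auto
    moreover have "real k * y ^ (k - 1) * (x - y) = - (real k * y ^ (k - 1) * (y - x))"
      by (simp add: algebra_simps)
    ultimately show ?thesis using 2[of k] by linarith
  qed
qed

text \<open>\<open>y\<close> is found as the end of the maximal interval starting at 1 on which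
  \<open>\<Delta>\<close> converges and is positive. The last two conclusions express that the line
  touching at \<open>y\<close> has height 1 at 1.\<close>

lemma right_tangent_point:
  fixes mu p :: "nat pmf"
  assumes q: "1/2 < q" "q < 1" and two: "pmf mu 0 + pmf mu 1 < 1" and mu0: "0 < pmf mu 0"
    and eq: "\<And>x. 0 < x \<Longrightarrow> x < 1 \<Longrightarrow>
      G p x * (x - q * (G p x - pmf p 0 * (1 - x))) = (1 - q) * x * G mu x"
  shows "\<exists>y>1. G_fin mu y \<and> 0 \<le> inflection mu y \<and> 0 < phi mu y \<and> q * (1 - q) * (phi mu y)^2 = y * G mu y"
proof -
  define \<kappa>2 c \<sigma> where "\<kappa>2 = q * (1 - q)" and "c = q * pmf p 0" and "\<sigma> = 1 - c"
  \<comment> \<open>\<open>- d\<close> is the linear coefficient of \<open>\<Delta>\<close>, which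
    may have the wrong sign. Hence the affine part \<open>e\<close> is kept apart from the
    coefficients \<open>a\<close>, which are nonnegative.\<close>
  define d where "d = \<sigma> - 2 * q * pmf p 1"
  define a where "a = (\<lambda>k. if k < 2 then 0 else 2 * q * pmf p k)"
  define e where "e = (\<lambda>k::nat. if k = 0 then c else if k = 1 then - d else 0)"
  define D where "D = (\<lambda>k. a k + e k)"
  define P where "P = (\<lambda>k. if k = 0 then 0 else 4 * \<kappa>2 * pmf mu (k - 1))"
  define l2 where "l2 = (\<lambda>k::nat. if k = 0 then c^2 else if k = 1 then 2 * c * \<sigma> else if k = 2 then \<sigma>^2 else 0)"
  define S where "S = (\<lambda>x. \<Sum>k. a k * x ^ k)"
  define \<Delta> where "\<Delta> = (\<lambda>x. c - d * x + S x)"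
  define l where "l = (\<lambda>x. c + \<sigma> * x)"
  have \<kappa>2: "0 < \<kappa>2" using q by (simp add: \<kappa>2_def)
  have nn: "0 \<le> a k" for k using q by (simp add: a_def)
  have P_nn: "0 \<le> P k" for k using \<kappa>2 by (simp add: P_def)
  have c0: "0 \<le> c" using q by (simp add: c_def)
  have c1: "c < 1"
    using mult_less_one[of q "pmf p 0"] q by (simp add: c_def pmf_le_1)
  have e_sums: "(\<lambda>k. e k * x ^ k) sums (c - d * x)" "summable (\<lambda>k. \<bar>e k * x ^ k\<bar>)" for x
  proof -
    have "(\<lambda>k. e k * x ^ k) sums (\<Sum>k\<in>{0,1}. e k * x ^ k)"
      by (rule sums_finite) (auto simp: e_def)
    then show "(\<lambda>k. e k * x ^ k) sums (c - d * x)" by (simp add: e_def)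
    show "summable (\<lambda>k. \<bar>e k * x ^ k\<bar>)"
      by (rule summable_finite[of "{0,1}"]) (auto simp: e_def)
  qed
  have l2_sums: "(\<lambda>k. l2 k * x ^ k) sums (l x)^2" for x
  proof -
    have "(\<lambda>k. l2 k * x ^ k) sums (\<Sum>k\<in>{0,1,2}. l2 k * x ^ k)"
      by (rule sums_finite) (auto simp: l2_def)
    then show ?thesis by (simp add: l2_def l_def power2_eq_square algebra_simps)
  qed
  have D_sums: "(\<lambda>k. D k * x ^ k) sums \<Delta> x" "summable (\<lambda>k. \<bar>D k * x ^ k\<bar>)"
    if "0 \<le> x" "summable (\<lambda>k. a k * x ^ k)" for x
  proof -
    show "(\<lambda>k. D k * x ^ k) sums \<Delta> x"
      using sums_add[OF e_sums(1) summable_sums[OF that(2)], of x]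
      by (simp add: D_def \<Delta>_def S_def algebra_simps)
    have "\<bar>D k * x ^ k\<bar> \<le> a k * x ^ k + \<bar>e k * x ^ k\<bar>" for k
      using abs_triangle_ineq[of "a k * x ^ k" "e k * x ^ k"] nn[of k] that(1)
      by (simp add: D_def distrib_right abs_mult)
    then show "summable (\<lambda>k. \<bar>D k * x ^ k\<bar>)"
      by (intro summable_comparison_test'[OF summable_add[OF that(2) e_sums(2)[of x]], of 0]) auto
  qed
  have conv_sums: "(\<lambda>n. (\<Sum>i\<le>n. D i * D (n - i)) * x ^ n) sums (\<Delta> x)^2"
    if "0 \<le> x" "summable (\<lambda>k. a k * x ^ k)" for x
    using Cauchy_product_power_sums[OF D_sums(2)[OF that] D_sums(2)[OF that]] D_sums(1)[OF that]
    by (simp add: sums_iff power2_eq_square)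
  have Delta_F: "summable (\<lambda>k. a k * x ^ k)" "\<Delta> x = 2 * q * G p x - l x" if "0 \<le> x" "x \<le> 1" for x
  proof -
    have "summable (\<lambda>k. pmf p k * x ^ k)"
      by (rule summable_rabs_cancel[OF expectation_power_pmf(2)]) (use that in simp)
    then have F: "(\<lambda>k. 2 * q * (pmf p k * x ^ k)) sums (2 * q * G p x)"
      unfolding G_def by (intro sums_mult summable_sums)
    have "(\<lambda>k. 2 * q * (pmf p k * x ^ k) - (if k \<in> {0, 1} then 2 * q * (pmf p k * x ^ k) else 0))
       sums (2 * q * G p x - (\<Sum>k\<in>{0,1}. 2 * q * (pmf p k * x ^ k)))"
      by (intro sums_diff F sums_If_finite_set) auto
    moreover have "2 * q * (pmf p k * x ^ k) - (if k \<in> {0, 1} then 2 * q * (pmf p k * x ^ k) else 0) = a k * x ^ k" for k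
      by (auto simp: a_def)
    ultimately have "(\<lambda>k. a k * x ^ k) sums (2 * q * G p x - 2 * q * (pmf p 0 + pmf p 1 * x))"
      by (simp add: algebra_simps)
    then show "summable (\<lambda>k. a k * x ^ k)" "\<Delta> x = 2 * q * G p x - l x"
      by (auto simp: sums_iff \<Delta>_def S_def l_def d_def c_def algebra_simps)
  qed
  have P_sums01: "(\<lambda>k. P k * x ^ k) sums (4 * \<kappa>2 * (x * G mu x))" if "0 \<le> x" "x \<le> 1" for x
  proof -
    have "summable (\<lambda>k. pmf mu k * x ^ k)"
      by (rule summable_rabs_cancel[OF expectation_power_pmf(2)]) (use that in simp)
    then have "(\<lambda>k. 4 * \<kappa>2 * (x * (pmf mu k * x ^ k))) sums (4 * \<kappa>2 * (x * G mu x))"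
      unfolding G_def by (intro sums_mult summable_sums)
    then have "(\<lambda>k. P (Suc k) * x ^ Suc k) sums (4 * \<kappa>2 * (x * G mu x))"
      by (simp add: P_def mult_ac)
    then show ?thesis by (subst (asm) sums_Suc_iff) (simp add: P_def)
  qed
  have "(\<lambda>n. \<Sum>i\<le>n. D i * D (n - i)) = (\<lambda>n. l2 n - P n)"
  proof (rule power_series_eq_imp_coeff_eq)
    fix x :: real assume x: "0 < x" "x < 1"
    have 1: "(\<lambda>n. (\<Sum>i\<le>n. D i * D (n - i)) * x ^ n) sums (\<Delta> x)^2"
      using x Delta_F by (intro conv_sums) auto
    have 2: "(\<lambda>n. (l2 n - P n) * x ^ n) sums ((l x)^2 - 4 * \<kappa>2 * (x * G mu x))"
      using sums_diff[OF l2_sums P_sums01, of x] x by (simp add: left_diff_distrib)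
    have "(\<Delta> x)^2 = (l x)^2 - 4 * q * (G p x * (l x - q * G p x))"
      unfolding Delta_F(2)[OF less_imp_le[OF x(1)] less_imp_le[OF x(2)]]
      by (simp add: power2_eq_square algebra_simps)
    also have "l x - q * G p x = x - q * (G p x - pmf p 0 * (1 - x))"
      by (simp add: l_def c_def \<sigma>_def algebra_simps)
    finally have "(\<Delta> x)^2 = (l x)^2 - 4 * \<kappa>2 * (x * G mu x)"
      unfolding eq[OF x] by (simp add: \<kappa>2_def)
    then show "summable (\<lambda>n. (\<Sum>i\<le>n. D i * D (n - i)) * x ^ n)" "summable (\<lambda>n. (l2 n - P n) * x ^ n)"
      "(\<Sum>n. (\<Sum>i\<le>n. D i * D (n - i)) * x ^ n) = (\<Sum>n. (l2 n - P n) * x ^ n)"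
      using 1 2 by (auto simp: sums_iff)
  qed
  then have conv: "(\<Sum>i\<le>n. D i * D (n - i)) = l2 n - P n" for n by metis
  have P_sums: "(\<lambda>k. P k * x ^ k) sums ((l x)^2 - (\<Delta> x)^2)"
    if "0 \<le> x" "summable (\<lambda>k. a k * x ^ k)" for x
    using sums_diff[OF l2_sums[of x] conv_sums[OF that]] by (simp add: conv left_diff_distrib)
  \<comment> \<open>The coefficient of degree \<open>n\<close> in
    \<open>\<Delta>^2 = l^2 - P\<close>: from degree 3 on \<open>l^2\<close> does not contribute,
    and the products with the affine part of \<open>\<Delta>\<close> are written out
    separately.\<close>
  have rec: "2 * c * a n + (\<Sum>i\<le>n. a i * a (n - i)) + P n = 2 * d * a (n - 1)" if n: "3 \<le> n" for n
  proof -
    obtain m where m: "n = Suc (Suc (Suc m))" using n by (metis numeral_3_eq_3 Suc_le_D Suc_le_mono)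
    have split: "(\<Sum>i\<le>n. f i * f (n - i)) = 2 * f 0 * f n + 2 * f 1 * f (n - 1) + (\<Sum>i<m. f (i + 2) * f (m + 1 - i))" for f :: "nat \<Rightarrow> real"
    proof -
      have "(\<Sum>i\<le>n. f i * f (n - i)) = f 0 * f n + f 1 * f (n - 1) + (\<Sum>i\<le>Suc m. f (i + 2) * f (m + 1 - i))"
        unfolding m by (subst sum.atMost_Suc_shift, subst sum.atMost_Suc_shift) (simp del: sum.atMost_Suc)
      also have "(\<Sum>i\<le>Suc m. f (i + 2) * f (m + 1 - i)) = (\<Sum>i<m. f (i + 2) * f (m + 1 - i)) + f (n - 1) * f 1 + f n * f 0"
        unfolding m by (simp add: lessThan_Suc_atMost[symmetric])
      finally show ?thesis by simp
    qed
    have "(\<Sum>i<m. D (i + 2) * D (m + 1 - i)) = (\<Sum>i<m. a (i + 2) * a (m + 1 - i))"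
      by (intro sum.cong) (auto simp: D_def e_def)
    moreover have "D 0 = c" "D 1 = - d" "D n = a n" "D (n - 1) = a (n - 1)" "a 0 = 0" "a 1 = 0"
      using n by (auto simp: D_def e_def a_def)
    moreover have "l2 n = 0" using n by (simp add: l2_def)
    ultimately show ?thesis using conv[of n] split[of D] split[of a] by simp
  qed
  \<comment> \<open>An index \<open>m \<ge> 2\<close> charged by \<open>mu\<close> makes the
    relation in degree \<open>m + 1\<close> strict, forcing \<open>d > 0\<close> and
    \<open>a m > 0\<close>. Degree 1 then gives \<open>c > 0\<close> because
    \<open>pmf mu 0 > 0\<close>.\<close>
  obtain m where m: "2 \<le> m" "0 < pmf mu m" using exists_pmf_ge_2[OF two] by blast
  have "0 < P (Suc m)" using m \<kappa>2 by (simp add: P_def)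
  moreover have "0 \<le> 2 * c * a (Suc m) + (\<Sum>i\<le>Suc m. a i * a (Suc m - i))"
    using nn c0 by (intro add_nonneg_nonneg mult_nonneg_nonneg sum_nonneg) auto
  ultimately have "0 < d * a m" using rec[of "Suc m"] m by simp
  then have d: "0 < d" and am: "0 < a m" using nn[of m] by (auto simp: zero_less_mult_iff)
  have "2 * (c * (\<sigma> + d)) = P 1"
    using conv[of 1] by (simp add: D_def e_def a_def l2_def algebra_simps)
  then have c: "0 < c" using c0 \<kappa>2 mu0 by (cases "c = 0") (auto simp: P_def)
  have \<sigma>: "0 < \<sigma>" using c1 by (simp add: \<sigma>_def)
  have l_pos: "0 < l x" if "0 \<le> x" for x using c \<sigma> that by (simp add: l_def add_pos_nonneg)

  have Delta_le: "\<bar>\<Delta> x\<bar> \<le> l x" if "0 \<le> x" "summable (\<lambda>k. a k * x ^ k)" for x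
  proof -
    have "0 \<le> (l x)^2 - (\<Delta> x)^2"
      by (rule sums_le[OF _ sums_zero P_sums[OF that]]) (use P_nn that in auto)
    then show ?thesis using l_pos[OF that(1)] by (simp add: abs_le_square_iff[symmetric])
  qed
  have S_le: "S x \<le> (\<sigma> + d) * x" if "0 \<le> x" "summable (\<lambda>k. a k * x ^ k)" for x
    using Delta_le[OF that] by (simp add: \<Delta>_def l_def algebra_simps)
  have sm_mono: "summable (\<lambda>k. a k * z ^ k)" if "summable (\<lambda>k. a k * x ^ k)" "0 \<le> z" "z \<le> x" for x z
    by (rule summable_comparison_test'[OF that(1), of 0])
       (use nn that in \<open>auto simp: abs_mult power_abs intro!: mult_left_mono power_mono\<close>)
  have S_mono: "S z \<le> S x" if "summable (\<lambda>k. a k * x ^ k)" "0 \<le> z" "z \<le> x" for x z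
    unfolding S_def using that nn by (intro suminf_le sm_mono[OF that] mult_left_mono power_mono) auto
  have cont: "continuous_on {0..x} \<Delta>" if "summable (\<lambda>k. a k * x ^ k)" for x
    unfolding \<Delta>_def S_def
    by (intro continuous_intros continuous_on_power_series_nonneg that nn)

  \<comment> \<open>Bounded, since \<open>a m * x ^ m\<close> with \<open>m \<ge> 2\<close> cannot
    stay below the linear function that bounds \<open>S\<close>.\<close>
  define I where "I = {x. 1 \<le> x \<and> summable (\<lambda>k. a k * x ^ k) \<and> (\<forall>z\<in>{1..x}. 0 < \<Delta> z)}"
  have "G p 1 = 1" using expectation_power_pmf(1)[of 1 p] by simp
  then have D1: "\<Delta> 1 = 2 * q - 1" using Delta_F(2)[of 1] by (simp add: l_def \<sigma>_def)
  then have I1: "1 \<in> I" using Delta_F(1)[of 1] q by (auto simp: I_def)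
  have "x \<le> max 1 ((\<sigma> + d) / a m)" if "x \<in> I" for x
  proof -
    have x: "1 \<le> x" "summable (\<lambda>k. a k * x ^ k)" using that by (auto simp: I_def)
    have "a m * x ^ m \<le> S x"
      unfolding S_def using sum_le_suminf[OF x(2), of "{m}"] nn x by auto
    also have "\<dots> \<le> (\<sigma> + d) * x" using x by (intro S_le) auto
    finally have "x * (a m * x ^ (m - 1)) \<le> x * (\<sigma> + d)"
      using m by (cases m) (auto simp: mult_ac)
    then have "a m * x ^ (m - 1) \<le> \<sigma> + d" using x by simp
    moreover have "a m * x ^ 1 \<le> a m * x ^ (m - 1)"
      using m x am by (intro mult_left_mono power_increasing) auto
    ultimately have "a m * x \<le> \<sigma> + d" by (metis order_trans power_one_right)
    then have "x \<le> (\<sigma> + d) / a m" using am by (simp add: field_simps)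
    then show ?thesis by simp
  qed
  then have bdd: "bdd_above I" by (rule bdd_aboveI)
  define y where "y = Sup I"
  have y1: "1 \<le> y" unfolding y_def using I1 bdd by (rule cSup_upper)
  have below: "summable (\<lambda>k. a k * x ^ k) \<and> 0 < \<Delta> x" if x: "1 \<le> x" "x < y" for x
  proof -
    obtain x' where "x' \<in> I" "x < x'"
      using x(2) less_cSup_iff[OF _ bdd, of x] I1 unfolding y_def by blast
    then show ?thesis using x sm_mono[of x' x] by (auto simp: I_def)
  qed
  have sm_y: "summable (\<lambda>k. a k * y ^ k)"
  proof (cases "y = 1")
    case True
    then show ?thesis using I1 by (simp add: I_def)
  next
    case False
    then have y: "1 < y" using y1 by simp
    have "(\<Sum>k<n. a k * y ^ k) \<le> (\<sigma> + d) * y" for n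
    proof (rule tendsto_le[of "at_left y"])
      show "((\<lambda>x. \<Sum>k<n. a k * x ^ k) \<longlongrightarrow> (\<Sum>k<n. a k * y ^ k)) (at_left y)"
        by (intro tendsto_intros)
      show "((\<lambda>x. (\<sigma> + d) * x) \<longlongrightarrow> (\<sigma> + d) * y) (at_left y)"
        by (intro tendsto_intros)
      have "\<forall>\<^sub>F x in at_left y. x \<in> {1<..<y}"
        by (rule eventually_at_left_real[OF y])
      then show "\<forall>\<^sub>F x in at_left y. (\<Sum>k<n. a k * x ^ k) \<le> (\<sigma> + d) * x"
      proof eventually_elim
        case (elim x)
        then have "(\<Sum>k<n. a k * x ^ k) \<le> S x"
          unfolding S_def using below[of x] nn by (intro sum_le_suminf) auto
        also have "\<dots> \<le> (\<sigma> + d) * x" using elim below[of x] by (intro S_le) auto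
        finally show ?case .
      qed
    qed (simp add: trivial_limit_at_left_real)
    then show ?thesis using nn y by (intro summableI_nonneg_bounded) auto
  qed
  \<comment> \<open>If \<open>\<Delta> y\<close> were positive, \<open>summable_beyond\<close> would
    continue the series past \<open>y\<close>, and continuity would keep it positive there, against
    the choice of \<open>y\<close> as a supremum.\<close>
  have Dy: "\<Delta> y = 0"
  proof (rule ccontr)
    assume "\<Delta> y \<noteq> 0"
    moreover have "0 \<le> \<Delta> y"
    proof (cases "y = 1")
      case True
      then show ?thesis using D1 q by simp
    next
      case False
      then have y: "1 < y" using y1 by simp
      have "(\<Delta> \<longlongrightarrow> \<Delta> y) (at y within {0..y})"
        using cont[OF sm_y] y by (auto simp: continuous_on_def)
      then have "(\<Delta> \<longlongrightarrow> \<Delta> y) (at_left y)"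
        using y by (simp add: at_within_Icc_at_left)
      moreover have "\<forall>\<^sub>F x in at_left y. 0 \<le> \<Delta> x"
        using eventually_at_left_real[OF y] by eventually_elim (use below less_imp_le in auto)
      ultimately show ?thesis
        by (intro tendsto_lowerbound) (auto simp: trivial_limit_at_left_real)
    qed
    ultimately have pos: "0 < \<Delta> y" by simp
    obtain t where t: "y < t" "summable (\<lambda>k. a k * t ^ k)"
    proof -
      have "a 0 = 0" "a 1 = 0" by (auto simp: a_def)
      moreover have "2 * c * a n + (\<Sum>i\<le>n. a i * a (n - i)) \<le> 2 * d * a (n - 1)" if "3 \<le> n" for n
        using rec[OF that] P_nn[of n] by linarith
      ultimately show ?thesis
        using summable_beyond[of a c d y] nn c d sm_y pos y1 that unfolding \<Delta>_def S_def by auto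
    qed
    have "continuous_on {y..t} \<Delta>"
      by (rule continuous_on_subset[OF cont[OF t(2)]]) (use y1 in auto)
    then have "(\<Delta> \<longlongrightarrow> \<Delta> y) (at_right y)"
      using t by (auto simp: continuous_on_def at_within_Icc_at_right dest!: bspec[of _ _ y])
    then have "\<forall>\<^sub>F x in at_right y. 0 < \<Delta> x" using pos by (auto dest: order_tendstoD)
    then obtain b where b: "y < b" "\<And>x. y < x \<Longrightarrow> x < b \<Longrightarrow> 0 < \<Delta> x"
      by (auto simp: eventually_at_right_field)
    define s where "s = min ((y + b) / 2) t"
    have s: "y < s" "s < b" "s \<le> t" using b t by (auto simp: s_def min_def)
    have "0 < \<Delta> z" if "z \<in> {1..s}" for z
      using that below[of z] b(2)[of z] pos s by (cases z y rule: linorder_cases) auto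
    then have "s \<in> I" using sm_mono[OF t(2), of s] s y1 by (auto simp: I_def)
    then have "s \<le> y" unfolding y_def using bdd by (rule cSup_upper)
    then show False using s by simp
  qed
  then have y: "1 < y" using D1 q y1 by (cases "y = 1") auto
  \<comment> \<open>Since \<open>\<Delta>\<close> vanishes at \<open>y\<close>, the difference
    \<open>l^2 - P = \<Delta>^2\<close> is of order \<open>(y - x)^2\<close>. Only points to the
    left of \<open>y\<close> are used, because the series may diverge beyond it.\<close>
  have gap: "l y ^ 2 - l x ^ 2 + (\<Delta> x)^2 = (\<Sum>k. P k * (y ^ k - x ^ k))" "(\<Delta> x)^2 \<le> d^2 * (y - x)^2"
    "summable (\<lambda>k. P k * (y ^ k - x ^ k))" "summable (\<lambda>k. P k * x ^ k)"
    if x: "1 \<le> x" "x < y" for x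
  proof -
    have sm: "summable (\<lambda>k. a k * x ^ k)" using below[OF x] by simp
    have 1: "(\<lambda>k. P k * y ^ k) sums (l y)^2" using P_sums[OF _ sm_y] y Dy by simp
    have 2: "(\<lambda>k. P k * x ^ k) sums ((l x)^2 - (\<Delta> x)^2)" using P_sums[OF _ sm] x by simp
    have "(\<lambda>k. P k * (y ^ k - x ^ k)) sums ((l y)^2 - ((l x)^2 - (\<Delta> x)^2))"
      using sums_diff[OF 1 2] by (simp add: right_diff_distrib)
    then show "l y ^ 2 - l x ^ 2 + (\<Delta> x)^2 = (\<Sum>k. P k * (y ^ k - x ^ k))"
      "summable (\<lambda>k. P k * (y ^ k - x ^ k))"
      by (auto simp: sums_iff)
    show "summable (\<lambda>k. P k * x ^ k)" using 2 by (simp add: sums_iff)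
    have "\<Delta> x - \<Delta> y \<le> d * (y - x)"
      using S_mono[OF sm_y, of x] x by (simp add: \<Delta>_def algebra_simps)
    then have "(\<Delta> x)^2 \<le> (d * (y - x))^2"
      using below[OF x] Dy by (intro power_mono) auto
    then show "(\<Delta> x)^2 \<le> d^2 * (y - x)^2" by (simp add: power_mult_distrib)
  qed
  have l_diff: "l y - l x = \<sigma> * (y - x)" for x by (simp add: l_def algebra_simps)
  have l2_diff: "l y ^ 2 - l x ^ 2 = (y - x) * (\<sigma> * (l y + l x))" for x
  proof -
    have "l y ^ 2 - l x ^ 2 = (l y - l x) * (l y + l x)"
      by (simp add: power2_eq_square algebra_simps)
    then show ?thesis unfolding l_diff by (simp only: mult_ac)
  qed
  have near: "\<forall>\<^sub>F x in at_left y. 1 < x \<and> x < y"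
    using eventually_at_left_real[OF y] by eventually_elim auto
  have lim_l: "(l \<longlongrightarrow> l y) (at_left y)"
    unfolding l_def by (intro tendsto_intros)

  \<comment> \<open>Convexity compares the difference quotient on the left of \<open>y\<close> with
    the derivative series of \<open>P\<close>. Letting \<open>x\<close> tend to \<open>y\<close>
    gives its convergence at \<open>y\<close> and, with the reverse bound below, the tangency
    relation \<open>P' = 2 \<sigma> l\<close>.\<close>
  have P1_le: "(\<Sum>k<n. P k * (real k * y ^ (k - 1))) \<le> \<sigma> * (l y + l y) + d^2 * (y - y)" for n
  proof (rule tendsto_le[of "at_left y"])
    show "((\<lambda>x. \<Sum>k<n. P k * (real k * x ^ (k - 1))) \<longlongrightarrow> (\<Sum>k<n. P k * (real k * y ^ (k - 1)))) (at_left y)"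
      by (intro tendsto_intros)
    show "((\<lambda>x. \<sigma> * (l y + l x) + d^2 * (y - x)) \<longlongrightarrow> \<sigma> * (l y + l y) + d^2 * (y - y)) (at_left y)"
      by (intro tendsto_intros lim_l)
    show "\<forall>\<^sub>F x in at_left y. (\<Sum>k<n. P k * (real k * x ^ (k - 1))) \<le> \<sigma> * (l y + l x) + d^2 * (y - x)"
      using near
    proof eventually_elim
      case (elim x)
      then have x: "1 \<le> x" "x < y" by auto
      have "(y - x) * (\<Sum>k<n. P k * (real k * x ^ (k - 1))) = (\<Sum>k<n. P k * (real k * x ^ (k - 1) * (y - x)))"
        by (simp add: sum_distrib_left mult_ac)
      also have "\<dots> \<le> (\<Sum>k<n. P k * (y ^ k - x ^ k))"
        using x P_nn by (intro sum_mono mult_left_mono power_diff_ge) auto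
      also have "\<dots> \<le> (\<Sum>k. P k * (y ^ k - x ^ k))"
        using x P_nn by (intro sum_le_suminf gap(3)) (auto intro!: mult_nonneg_nonneg power_mono)
      also have "\<dots> \<le> (y - x) * (\<sigma> * (l y + l x)) + d^2 * (y - x)^2"
        using gap(1,2)[OF x] l2_diff[of x] by linarith
      also have "\<dots> = (y - x) * (\<sigma> * (l y + l x) + d^2 * (y - x))"
        by (simp add: power2_eq_square algebra_simps)
      finally show ?case using x by simp
    qed
  qed (simp add: trivial_limit_at_left_real)
  have P1_sm: "summable (\<lambda>k. P k * (real k * y ^ (k - 1)))"
    using P1_le P_nn y by (intro summableI_nonneg_bounded) auto
  define P1 where "P1 = (\<Sum>k. P k * (real k * y ^ (k - 1)))"
  have "P1 \<le> 2 * \<sigma> * l y"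
    unfolding P1_def using P1_le by (intro suminf_le_const[OF P1_sm]) (auto simp: mult_ac)
  moreover have "\<sigma> * (l y + l y) \<le> P1"
  proof (rule tendsto_upperbound)
    show "((\<lambda>x. \<sigma> * (l y + l x)) \<longlongrightarrow> \<sigma> * (l y + l y)) (at_left y)"
      by (intro tendsto_intros lim_l)
    show "\<forall>\<^sub>F x in at_left y. \<sigma> * (l y + l x) \<le> P1"
      using near
    proof eventually_elim
      case (elim x)
      then have x: "1 \<le> x" "x < y" by auto
      have "(y - x) * (\<sigma> * (l y + l x)) \<le> (\<Sum>k. P k * (y ^ k - x ^ k))"
        using gap(1)[OF x] l2_diff[of x] zero_le_power2[of "\<Delta> x"] by linarith
      also have "\<dots> \<le> (\<Sum>k. (y - x) * (P k * (real k * y ^ (k - 1))))"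
      proof (rule suminf_le[OF _ gap(3)[OF x] summable_mult[OF P1_sm]])
        show "P k * (y ^ k - x ^ k) \<le> (y - x) * (P k * (real k * y ^ (k - 1)))" for k
          using mult_left_mono[OF power_diff_ge(2)[of x y k] P_nn[of k]] x by (simp add: mult_ac)
      qed
      also have "\<dots> = (y - x) * P1" unfolding P1_def by (rule suminf_mult[OF P1_sm])
      finally show ?case using x by simp
    qed
  qed (simp add: trivial_limit_at_left_real)
  ultimately have P1: "P1 = 2 * \<sigma> * l y" by simp

  \<comment> \<open>Half of the second derivative. The second-order remainder of \<open>P\<close> at
    \<open>y\<close> is \<open>(x - y)^2 * \<sigma>^2 - (\<Delta> x)^2\<close>, and dropping
    \<open>(\<Delta> x)^2\<close> leaves exactly the bound by the second derivative of
    \<open>l^2\<close>.\<close>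
  have P2_le: "(\<Sum>k<n. P k * (real k * (real k - 1) / 2 * y ^ (k - 2))) \<le> \<sigma>^2" for n
  proof (rule tendsto_upperbound)
    show "((\<lambda>x. \<Sum>k<n. P k * (real k * (real k - 1) / 2 * x ^ (k - 2))) \<longlongrightarrow> (\<Sum>k<n. P k * (real k * (real k - 1) / 2 * y ^ (k - 2)))) (at_left y)"
      by (intro tendsto_intros)
    show "\<forall>\<^sub>F x in at_left y. (\<Sum>k<n. P k * (real k * (real k - 1) / 2 * x ^ (k - 2))) \<le> \<sigma>^2"
      using near
    proof eventually_elim
      case (elim x)
      then have x: "1 \<le> x" "x < y" by auto
      let ?R = "\<lambda>k. x ^ k - y ^ k - real k * y ^ (k - 1) * (x - y)"
      have R: "real k * (real k - 1) / 2 * x ^ (k - 2) * (x - y)^2 \<le> ?R k" for k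
        using x by (intro power_diff_ge) auto
      have R0: "0 \<le> ?R k" for k
      proof (rule order_trans[OF _ R])
        show "0 \<le> real k * (real k - 1) / 2 * x ^ (k - 2) * (x - y)^2" using x by (cases k) auto
      qed
      have eq: "P k * ?R k = (y - x) * (P k * (real k * y ^ (k - 1))) - P k * (y ^ k - x ^ k)" for k
        by (simp add: algebra_simps)
      have R_sums: "(\<lambda>k. P k * ?R k) sums ((y - x) * P1 - (l y ^ 2 - l x ^ 2 + (\<Delta> x)^2))"
        unfolding eq P1_def gap(1)[OF x] by (intro sums_diff sums_mult summable_sums P1_sm gap(3)[OF x])
      have "(x - y)^2 * (\<Sum>k<n. P k * (real k * (real k - 1) / 2 * x ^ (k - 2)))
          = (\<Sum>k<n. P k * (real k * (real k - 1) / 2 * x ^ (k - 2) * (x - y)^2))"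
        by (simp add: sum_distrib_left mult_ac)
      also have "\<dots> \<le> (\<Sum>k<n. P k * ?R k)"
        using P_nn R by (intro sum_mono mult_left_mono) auto
      also have "\<dots> \<le> (\<Sum>k. P k * ?R k)"
        using P_nn R0 by (intro sum_le_suminf sums_summable[OF R_sums]) auto
      also have "\<dots> = (y - x) * P1 - (l y ^ 2 - l x ^ 2 + (\<Delta> x)^2)"
        using R_sums by (simp add: sums_iff)
      also have "\<dots> = (y - x) * (\<sigma> * (l y - l x)) - (\<Delta> x)^2"
        unfolding P1 l2_diff by (simp add: algebra_simps)
      also have "\<dots> = (x - y)^2 * \<sigma>^2 - (\<Delta> x)^2"
        unfolding l_diff by (simp add: power2_eq_square algebra_simps)
      also have "\<dots> \<le> (x - y)^2 * \<sigma>^2" by simp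
      finally show ?case using x by simp
    qed
  qed (simp add: trivial_limit_at_left_real)
  have k1: "0 \<le> real k * (real k - 1)" for k by (cases k) auto
  have P2_sm: "summable (\<lambda>k. P k * (real k * (real k - 1) / 2 * y ^ (k - 2)))"
    using P2_le P_nn y k1 by (intro summableI_nonneg_bounded) auto
  define P2 where "P2 = (\<Sum>k. P k * (real k * (real k - 1) / 2 * y ^ (k - 2)))"
  have P2: "P2 \<le> \<sigma>^2" unfolding P2_def using P2_le by (intro suminf_le_const[OF P2_sm]) auto

  have P_y: "(\<lambda>k. P k * y ^ k) sums (l y)^2" using P_sums[OF _ sm_y] y Dy by simp
  \<comment> \<open>Since \<open>P\<close> is \<open>4 * \<kappa>2 * x * G\<close>, index shifts
    convert the series for \<open>P\<close> and its two derivatives into series for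
    \<open>mu\<close>; this is how \<open>G_fin mu y\<close> is obtained.\<close>
  have s0: "(\<lambda>k. pmf mu k * y ^ k) sums ((l y)^2 / (4 * \<kappa>2 * y))"
  proof -
    have "(\<lambda>k. P (Suc k) * y ^ Suc k) sums (l y)^2"
      using P_y by (subst sums_Suc_iff) (simp add: P_def)
    from sums_divide[OF this, of "4 * \<kappa>2 * y"] show ?thesis
      using y \<kappa>2 by (simp add: P_def mult_ac)
  qed
  have s1: "(\<lambda>k. (real k + 1) * pmf mu k * y ^ k) sums (P1 / (4 * \<kappa>2))"
  proof -
    have "(\<lambda>k. P (Suc k) * (real (Suc k) * y ^ (Suc k - 1))) sums P1"
      using summable_sums[OF P1_sm] unfolding P1_def by (subst sums_Suc_iff) (simp add: P_def)
    moreover have "P (Suc k) * (real (Suc k) * y ^ (Suc k - 1)) / (4 * \<kappa>2) = (real k + 1) * pmf mu k * y ^ k" for k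
      using \<kappa>2 by (simp add: P_def field_simps)
    ultimately show ?thesis using sums_divide[of _ P1 "4 * \<kappa>2"] by fastforce
  qed
  have s2: "(\<lambda>k. (real k + 1) * real k * pmf mu k * y ^ (k - 1)) sums (P2 / (2 * \<kappa>2))"
  proof -
    have "(\<lambda>k. P (Suc k) * (real (Suc k) * (real (Suc k) - 1) / 2 * y ^ (Suc k - 2))) sums P2"
      using summable_sums[OF P2_sm] unfolding P2_def by (subst sums_Suc_iff) (simp add: P_def)
    from sums_divide[OF this, of "2 * \<kappa>2"] show ?thesis
      using \<kappa>2 by (simp add: P_def mult_ac add.commute numeral_2_eq_2)
  qed
  have "(\<lambda>k. ((real k + 1) * pmf mu k * y ^ k - pmf mu k * y ^ k) / y) sums ((P1 / (4 * \<kappa>2) - (l y)^2 / (4 * \<kappa>2 * y)) / y)"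
    by (intro sums_divide sums_diff s1 s0)
  moreover have "((real k + 1) * pmf mu k * y ^ k - pmf mu k * y ^ k) / y = real k * pmf mu k * y ^ (k - 1)" for k
    using y by (cases k) (auto simp: field_simps)
  ultimately have g1: "(\<lambda>k. real k * pmf mu k * y ^ (k - 1)) sums ((P1 / (4 * \<kappa>2) - (l y)^2 / (4 * \<kappa>2 * y)) / y)"
    by simp
  have "(\<lambda>k. ((real k + 1) * real k * pmf mu k * y ^ (k - 1) - 2 * (real k * pmf mu k * y ^ (k - 1))) / y)
      sums ((P2 / (2 * \<kappa>2) - 2 * ((P1 / (4 * \<kappa>2) - (l y)^2 / (4 * \<kappa>2 * y)) / y)) / y)"
    by (intro sums_divide sums_diff sums_mult s2 g1)
  moreover have "((real k + 1) * real k * pmf mu k * y ^ (k - 1) - 2 * (real k * pmf mu k * y ^ (k - 1))) / y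
      = real k * (real k - 1) * pmf mu k * y ^ (k - 2)" for k
  proof -
    consider "k = 0" | "k = 1" | j where "k = Suc (Suc j)" by (metis One_nat_def not0_implies_Suc)
    then show ?thesis using y by cases (auto simp: field_simps)
  qed
  ultimately have g2: "(\<lambda>k. real k * (real k - 1) * pmf mu k * y ^ (k - 2))
      sums ((P2 / (2 * \<kappa>2) - 2 * ((P1 / (4 * \<kappa>2) - (l y)^2 / (4 * \<kappa>2 * y)) / y)) / y)"
    by simp
  have fin: "G_fin mu y" unfolding G_fin_def using s0 g1 g2 by (auto simp: sums_iff)
  have G0: "4 * \<kappa>2 * (y * G mu y) = (l y)^2"
    using s0 y \<kappa>2 unfolding G_def by (simp add: sums_iff)
  have G1: "G' mu y = (P1 / (4 * \<kappa>2) - (l y)^2 / (4 * \<kappa>2 * y)) / y"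
    using g1 unfolding G'_def by (simp add: sums_iff)
  have "y * G' mu y = P1 / (4 * \<kappa>2) - (l y)^2 / (4 * \<kappa>2 * y)"
    unfolding G1 using y by simp
  moreover have "(l y)^2 / (4 * \<kappa>2 * y) = G mu y" using G0 y \<kappa>2 by (simp add: field_simps)
  ultimately have "G mu y + y * G' mu y = P1 / (4 * \<kappa>2)" by simp
  then have "4 * \<kappa>2 * (G mu y + y * G' mu y) = P1" using \<kappa>2 by simp
  then have G1': "4 * \<kappa>2 * (G mu y + y * G' mu y) = 2 * \<sigma> * l y"
    using P1 by simp
  have "G'' mu y = (P2 / (2 * \<kappa>2) - 2 * G' mu y) / y"
    using g2 unfolding G''_def G1 by (simp add: sums_iff)
  then have "2 * \<kappa>2 * (2 * G' mu y + y * G'' mu y) = P2" using y \<kappa>2 by (simp add: field_simps)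
  then have G2: "2 * \<kappa>2 * (2 * G' mu y + y * G'' mu y) \<le> \<sigma>^2" using P2 by simp
  \<comment> \<open>The right side is \<open>P'^2 - 2 P P''\<close> at \<open>y\<close>, which would
    be 0 if \<open>P\<close> agreed with \<open>l^2\<close> to second order; the bound on
    \<open>P2\<close> makes it nonnegative.\<close>
  have "16 * \<kappa>2^2 * inflection mu y
      = (4 * \<kappa>2 * (G mu y + y * G' mu y))^2 - 4 * (4 * \<kappa>2 * (y * G mu y)) * (2 * \<kappa>2 * (2 * G' mu y + y * G'' mu y))"
    unfolding inflection_def by (simp add: power2_eq_square algebra_simps)
  also have "\<dots> \<ge> (2 * \<sigma> * l y)^2 - 4 * (l y)^2 * \<sigma>^2"
    unfolding G0 G1' using G2 by (intro diff_left_mono mult_left_mono) auto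
  finally have "0 \<le> 16 * \<kappa>2^2 * inflection mu y"
    by (simp add: power_mult_distrib mult_ac)
  then have infl: "0 \<le> inflection mu y" using \<kappa>2 by (simp add: zero_le_mult_iff)
  \<comment> \<open>The right side is \<open>2 P + (1 - y) P'\<close> at \<open>y\<close>, which by
    tangency is \<open>2 * l y\<close> times the height of the line at 1, and that height is
    1.\<close>
  have "4 * \<kappa>2 * phi mu y = 2 * (4 * \<kappa>2 * (y * G mu y)) + (1 - y) * (4 * \<kappa>2 * (G mu y + y * G' mu y))"
    unfolding phi_def by (simp add: power2_eq_square algebra_simps)
  also have "\<dots> = 2 * l y * (l y + (1 - y) * \<sigma>)"
    unfolding G0 G1' by (simp add: power2_eq_square algebra_simps)
  also have "l y + (1 - y) * \<sigma> = 1" by (simp add: l_def \<sigma>_def algebra_simps)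
  finally have phi: "2 * \<kappa>2 * phi mu y = l y" by simp
  then have "0 < phi mu y" using l_pos[of y] y \<kappa>2 by (metis zero_less_mult_pos zero_less_numeral less_imp_le less_trans mult_pos_pos zero_less_one)
  moreover have "4 * \<kappa>2 * (\<kappa>2 * (phi mu y)^2) = 4 * \<kappa>2 * (y * G mu y)"
    unfolding G0 phi[symmetric] by (simp add: power2_eq_square)
  then have "\<kappa>2 * (phi mu y)^2 = y * G mu y" using \<kappa>2 by simp
  then have "q * (1 - q) * (phi mu y)^2 = y * G mu y" by (simp only: \<kappa>2_def)
  ultimately show ?thesis using y fin infl by blast
qed

section \<open>A finite law from a tangency point\<close>

unbundle fps_syntax

text \<open>Coefficients of the square root with constant term \<open>b\<close> of the series with
  coefficients \<open>r\<close>, when \<open>r 0 = b^2\<close>. The explicit recursion allows signs,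
  monotonicity and differentiability in a parameter to be proved by induction on the degree.\<close>

fun sqrt_coeff :: "(nat \<Rightarrow> real) \<Rightarrow> real \<Rightarrow> nat \<Rightarrow> real" where
  "sqrt_coeff r b n = (if n = 0 then b else
     (r n - (\<Sum>i\<in>{1..<n}. sqrt_coeff r b i * sqrt_coeff r b (n - i))) / (2 * b))"

declare sqrt_coeff.simps [simp del]

lemma sqrt_coeff_0 [simp]: "sqrt_coeff r b 0 = b"
  by (subst sqrt_coeff.simps) simp

lemma sqrt_coeff_Suc:
  "0 < n \<Longrightarrow> sqrt_coeff r b n = (r n - (\<Sum>i\<in>{1..<n}. sqrt_coeff r b i * sqrt_coeff r b (n - i))) / (2 * b)"
  by (subst sqrt_coeff.simps) simp

lemma sum_conv_split_ends:
  fixes f :: "nat \<Rightarrow> real"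
  assumes "0 < n"
  shows "(\<Sum>i\<le>n. f i * f (n - i)) = 2 * f 0 * f n + (\<Sum>i\<in>{1..<n}. f i * f (n - i))"
proof -
  have "{..n} = insert 0 (insert n {1..<n})" using assms by auto
  then show ?thesis using assms by simp
qed

lemma sqrt_coeff_conv:
  assumes "b \<noteq> 0" "r 0 = b^2"
  shows "(\<Sum>i\<le>n. sqrt_coeff r b i * sqrt_coeff r b (n - i)) = r n"
proof (cases "n = 0")
  case True
  then show ?thesis using assms by (simp add: power2_eq_square)
next
  case False
  then show ?thesis
    using assms by (simp add: sum_conv_split_ends sqrt_coeff_Suc[of n])
qed

lemma fps_eq_if_square_eq:
  fixes f g :: "real fps"
  assumes "f * f = g * g" "f $ 0 = g $ 0" "g $ 0 \<noteq> 0"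
  shows "f = g"
proof -
  have "(f - g) * (f + g) = 0" using assms(1) by (simp add: algebra_simps)
  moreover have "(f + g) $ 0 \<noteq> 0" using assms by simp
  then have "f + g \<noteq> 0" by (metis fps_zero_nth)
  ultimately show ?thesis by simp
qed

text \<open>With \<open>P(x) = 4\<kappa>\<^sup>2 x G(x)\<close>, \<open>P_coeff\<close> are its coefficients and \<open>disc_coeff\<close> those of \<open>\<ell>\<^sup>2 - P\<close>, where
  \<open>\<ell>\<close> is the tangent line of \<open>P\<^sup>1\<^sup>/\<^sup>2\<close> at \<open>t\<close>.  This discriminant has a double zero at \<open>t\<close>;
  dividing by \<open>(t - x)\<^sup>2\<close> leaves the series with coefficients \<open>quot_coeff\<close>.\<close>

definition P_coeff :: "real \<Rightarrow> nat pmf \<Rightarrow> nat \<Rightarrow> real" where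
  "P_coeff \<kappa> mu n = (if n = 0 then 0 else 4 * \<kappa>^2 * pmf mu (n - 1))"

definition disc_coeff :: "real \<Rightarrow> nat pmf \<Rightarrow> real \<Rightarrow> nat \<Rightarrow> real" where
  "disc_coeff \<kappa> mu t n =
     (if n = 0 then (intercept \<kappa> mu t)^2 else if n = 1 then 2 * intercept \<kappa> mu t * slope \<kappa> mu t
      else if n = 2 then (slope \<kappa> mu t)^2 else 0) - P_coeff \<kappa> mu n"

definition delta_coeff :: "real \<Rightarrow> nat pmf \<Rightarrow> real \<Rightarrow> nat \<Rightarrow> real" where
  "delta_coeff \<kappa> mu t = sqrt_coeff (disc_coeff \<kappa> mu t) (intercept \<kappa> mu t)"

text \<open>At \<open>n + 2\<close> this is the coefficient of \<open>x^n\<close> in the second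
  divided difference \<open>(P(x) - P(t) - P'(t) (x - t)) / (x - t)^2\<close>. Subtracting it from
  the square of the slope gives the discriminant divided by \<open>(t - x)^2\<close>.\<close>

definition tail_sum :: "real \<Rightarrow> nat pmf \<Rightarrow> real \<Rightarrow> nat \<Rightarrow> real" where
  "tail_sum \<kappa> mu t n = (\<Sum>i. real (i + 1) * P_coeff \<kappa> mu (i + n) * t ^ i)"

definition quot_coeff :: "real \<Rightarrow> nat pmf \<Rightarrow> real \<Rightarrow> nat \<Rightarrow> real" where
  "quot_coeff \<kappa> mu t n = (if n = 0 then (intercept \<kappa> mu t / t)^2 else - tail_sum \<kappa> mu t (n + 2))"

definition root_coeff :: "real \<Rightarrow> nat pmf \<Rightarrow> real \<Rightarrow> nat \<Rightarrow> real" where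
  "root_coeff \<kappa> mu t = sqrt_coeff (quot_coeff \<kappa> mu t) (intercept \<kappa> mu t / t)"

locale tangent_lines =
  fixes \<kappa> :: real and mu :: "nat pmf"
  assumes \<kappa>: "0 < \<kappa>"
begin

abbreviation "b \<equiv> intercept \<kappa> mu"
abbreviation "\<sigma> \<equiv> slope \<kappa> mu"
abbreviation "P \<equiv> P_coeff \<kappa> mu"
abbreviation "R \<equiv> disc_coeff \<kappa> mu"
abbreviation "\<delta> \<equiv> delta_coeff \<kappa> mu"
abbreviation "V \<equiv> tail_sum \<kappa> mu"
abbreviation "E \<equiv> quot_coeff \<kappa> mu"
abbreviation "S \<equiv> root_coeff \<kappa> mu"

lemma P_nonneg: "0 \<le> P n"
  by (simp add: P_coeff_def)

text \<open>The two tangency conditions: the values and the first derivatives of \<open>P\<close>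
  and of the squared line agree at \<open>t\<close>.\<close>

lemma P_sums:
  assumes fin: "G_fin mu t" and t: "0 < t"
  shows "(\<lambda>k. P k * t ^ k) sums (b t + \<sigma> t * t)^2"
    and "(\<lambda>k. real k * P k * t ^ k) sums (2 * \<sigma> t * t * (b t + \<sigma> t * t))"
proof -
  have pos: "0 < G mu t" using G_pos[OF fin t] .
  have h: "(sqrt (t * G mu t))^2 = t * G mu t" "sqrt (t * G mu t) \<noteq> 0" using pos t by auto
  have "(b t + \<sigma> t * t)^2 = 4 * \<kappa>^2 * (t * G mu t)"
    unfolding tangent_value[OF pos t] by (simp only: power_mult_distrib h) simp
  moreover have "(\<lambda>k. 4 * \<kappa>^2 * (t * (pmf mu k * t ^ k))) sums (4 * \<kappa>^2 * (t * G mu t))"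
    by (intro sums_mult G_fin_sums(1)[OF fin])
  then have "(\<lambda>k. P (Suc k) * t ^ Suc k) sums (4 * \<kappa>^2 * (t * G mu t))"
    by (simp add: P_coeff_def mult_ac)
  then have "(\<lambda>k. P k * t ^ k) sums (4 * \<kappa>^2 * (t * G mu t))"
    by (subst (asm) sums_Suc_iff) (simp add: P_coeff_def)
  ultimately show "(\<lambda>k. P k * t ^ k) sums (b t + \<sigma> t * t)^2" by (simp only:)
  have "\<sigma> t * sqrt (t * G mu t) = \<kappa> * (G mu t + t * G' mu t)"
    using h(2) by (simp add: slope_def)
  then have "4 * \<kappa> * t * (\<sigma> t * sqrt (t * G mu t)) = 4 * \<kappa>^2 * (t * (t * G' mu t + G mu t))"
    by (simp only: power2_eq_square mult_ac add_ac)
  then have "2 * \<sigma> t * t * (b t + \<sigma> t * t) = 4 * \<kappa>^2 * (t * (t * G' mu t + G mu t))"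
    unfolding tangent_value[OF pos t] by (simp add: mult_ac)
  moreover have "(\<lambda>k. 4 * \<kappa>^2 * (t * (real k * pmf mu k * t ^ k + pmf mu k * t ^ k))) sums (4 * \<kappa>^2 * (t * (t * G' mu t + G mu t)))"
    by (intro sums_mult sums_add G_fin_sums(1,4)[OF fin])
  then have "(\<lambda>k. real (Suc k) * P (Suc k) * t ^ Suc k) sums (4 * \<kappa>^2 * (t * (t * G' mu t + G mu t)))"
    by (simp add: P_coeff_def algebra_simps)
  then have "(\<lambda>k. real k * P k * t ^ k) sums (4 * \<kappa>^2 * (t * (t * G' mu t + G mu t)))"
    by (subst (asm) sums_Suc_iff) (simp add: P_coeff_def)
  ultimately show "(\<lambda>k. real k * P k * t ^ k) sums (2 * \<sigma> t * t * (b t + \<sigma> t * t))" by (simp only:)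
qed

lemma summable_tail:
  assumes fin: "G_fin mu t" and t: "0 < t"
  shows "summable (\<lambda>i. P (i + n) * t ^ i)" "summable (\<lambda>i. real (i + 1) * P (i + n) * t ^ i)"
proof -
  note s = P_sums[OF fin t, THEN sums_summable, THEN summable_ignore_initial_segment, of n]
  have "summable (\<lambda>i. P (i + n) * t ^ (i + n) / t ^ n)" by (intro summable_divide s)
  moreover have "P (i + n) * t ^ (i + n) / t ^ n = P (i + n) * t ^ i" for i
    using t by (simp add: power_add)
  ultimately show 1: "summable (\<lambda>i. P (i + n) * t ^ i)" by simp
  have "summable (\<lambda>i. real (i + n) * P (i + n) * t ^ (i + n) / t ^ n + (1 - real n) * (P (i + n) * t ^ i))"
    by (intro summable_add summable_divide s summable_mult 1)
  moreover have "real (i + n) * P (i + n) * t ^ (i + n) / t ^ n + (1 - real n) * (P (i + n) * t ^ i)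
      = real (i + 1) * P (i + n) * t ^ i" for i
  proof -
    have *: "real (i + n) * P (i + n) * t ^ (i + n) / t ^ n = real (i + n) * (P (i + n) * t ^ i)"
      using t by (simp add: power_add)
    have "real (i + n) + (1 - real n) = real (i + 1)" by simp
    then show ?thesis unfolding * distrib_right[symmetric] by (simp only: mult.assoc)
  qed
  ultimately show "summable (\<lambda>i. real (i + 1) * P (i + n) * t ^ i)" by simp
qed

text \<open>Multiplication by \<open>(t - x)^2\<close>, read on coefficients. Each of
  \<open>U n = P n + t * U (n + 1)\<close> and \<open>V t n = t * V t (n + 1) + U n\<close> is one
  division by a linear factor, and \<open>U\<close> is eliminated.\<close>

lemma tail_sum_rec:
  assumes fin: "G_fin mu t" and t: "0 < t"
  shows "t^2 * V t (n + 2) - 2 * t * V t (n + 1) + V t n = P n"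
proof -
  define U where "U = (\<lambda>n. \<Sum>i. P (i + n) * t ^ i)"
  have U: "U n = P n + t * U (n + 1)" for n
    using suminf_split_head[OF summable_tail(1)[OF fin t, of n]] suminf_mult[OF summable_tail(1)[OF fin t, of "n + 1"], of t]
    by (simp add: U_def mult_ac)
  have VU: "V t n = t * V t (n + 1) + U n" for n
  proof -
    note s = summable_tail[OF fin t]
    have "(\<lambda>i. real (i + 1) * P (i + n) * t ^ i - P (i + n) * t ^ i) sums (V t n - U n)"
      unfolding tail_sum_def U_def by (intro sums_diff summable_sums s)
    then have "(\<lambda>i. real i * P (i + n) * t ^ i) sums (V t n - U n)"
      by (simp add: algebra_simps)
    then have "(\<lambda>i. real (Suc i) * P (Suc i + n) * t ^ Suc i) sums (V t n - U n)"
      by (subst sums_Suc_iff) simp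
    moreover have "(\<lambda>i. t * (real (i + 1) * P (i + (n + 1)) * t ^ i)) sums (t * V t (n + 1))"
      unfolding tail_sum_def by (intro sums_mult summable_sums s)
    then have "(\<lambda>i. real (Suc i) * P (Suc i + n) * t ^ Suc i) sums (t * V t (n + 1))"
      by (simp add: mult_ac)
    ultimately have "V t n - U n = t * V t (n + 1)" by (rule sums_unique2)
    then show ?thesis by simp
  qed
  have "t * V t (n + 2) = V t (n + 1) - U (n + 1)" using VU[of "n + 1"] by simp
  then have "t^2 * V t (n + 2) = t * (V t (n + 1) - U (n + 1))" by (metis power2_eq_square mult.assoc)
  then show ?thesis using VU[of n] U[of n] by (simp add: algebra_simps)
qed

lemma tail_sum_1_2:
  assumes fin: "G_fin mu t" and t: "0 < t"
  shows "V t 1 = 2 * \<sigma> t * (b t + \<sigma> t * t)" and "V t 2 = (\<sigma> t)^2 - (b t / t)^2"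
proof -
  let ?w = "b t + \<sigma> t * t"
  have "(\<lambda>i. real i * P i * t ^ i + P i * t ^ i) sums (2 * \<sigma> t * t * ?w + ?w^2)"
    by (intro sums_add P_sums[OF fin t])
  then have V0: "V t 0 = 2 * \<sigma> t * t * ?w + ?w^2"
    by (simp add: tail_sum_def sums_iff algebra_simps)
  have "(\<lambda>i. real (Suc i) * P (Suc i) * t ^ Suc i) sums (2 * \<sigma> t * t * ?w)"
    using P_sums(2)[OF fin t] by (subst sums_Suc_iff) simp
  then have "(\<lambda>i. t * (real (i + 1) * P (i + 1) * t ^ i)) sums (2 * \<sigma> t * t * ?w)"
    by (simp add: mult_ac)
  moreover have "(\<lambda>i. t * (real (i + 1) * P (i + 1) * t ^ i)) sums (t * V t 1)"
    unfolding tail_sum_def by (intro sums_mult summable_sums summable_tail[OF fin t])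
  ultimately have "t * V t 1 = 2 * \<sigma> t * t * ?w"
    using sums_unique2 by blast
  then have "t * V t 1 = t * (2 * \<sigma> t * ?w)" by (simp only: mult_ac)
  then show V1: "V t 1 = 2 * \<sigma> t * ?w" using t by simp
  have "t^2 * V t 2 = 2 * t * V t 1 - V t 0"
  proof -
    have "P 0 = 0" by (simp add: P_coeff_def)
    then show ?thesis
      using tail_sum_rec[OF fin t, of 0] unfolding add_0 by linarith
  qed
  also have "\<dots> = t^2 * ((\<sigma> t)^2 - (b t / t)^2)"
    unfolding V1 V0 using t by (simp add: power2_eq_square field_simps)
  finally show "V t 2 = (\<sigma> t)^2 - (b t / t)^2" using t by simp
qed

lemma tail_sum_nonneg: "G_fin mu t \<Longrightarrow> 0 < t \<Longrightarrow> 0 \<le> V t n"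
  unfolding tail_sum_def using P_nonneg by (intro suminf_nonneg summable_tail) auto

lemma tail_sum_mono:
  assumes "G_fin mu t" "0 < s" "s \<le> t"
  shows "V s n \<le> V t n"
proof -
  have "G_fin mu s" using G_fin_mono assms by auto
  then show ?thesis
    unfolding tail_sum_def using assms P_nonneg
    by (intro suminf_le summable_tail mult_left_mono power_mono) auto
qed

lemma slope_nonneg: "G_fin mu t \<Longrightarrow> 0 < t \<Longrightarrow> 0 \<le> \<sigma> t"
  unfolding slope_def using \<kappa> G_pos[of mu t] G'_nonneg[of mu t] by auto

lemma intercept_pos:
  assumes "G_fin mu t" "0 < t" "t * G' mu t < G mu t"
  shows "0 < b t"
  unfolding intercept_def using \<kappa> G_pos[of mu t] assms by auto

lemma intercept_le_slope:
  assumes "G_fin mu t" "0 < t"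
  shows "b t / t \<le> \<sigma> t"
proof -
  have "b t / t = \<kappa> * (G mu t - t * G' mu t) / sqrt (t * G mu t)"
    unfolding intercept_def using assms by simp
  also have "\<dots> \<le> \<sigma> t"
    unfolding slope_def using \<kappa> G_pos[OF assms] G'_nonneg[of mu t] assms
    by (intro divide_right_mono mult_left_mono) auto
  finally show ?thesis .
qed

lemma quot_coeff_nonpos: "G_fin mu t \<Longrightarrow> 0 < t \<Longrightarrow> 0 < n \<Longrightarrow> E t n \<le> 0"
  using tail_sum_nonneg[of t "n + 2"] by (simp add: quot_coeff_def)

text \<open>Only degrees 0, 1 and 2 see the squared line; there \<open>tail_sum_1_2\<close> supplies
  the boundary values. From degree 3 on the identity is \<open>tail_sum_rec\<close>.\<close>

lemma disc_eq_quot: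
  assumes fin: "G_fin mu t" and t: "0 < t"
  shows "(fps_const t - fps_X)^2 * Abs_fps (E t) = Abs_fps (R t)"
proof (rule fps_ext)
  fix n
  have eq: "(fps_const t - fps_X)^2 * Abs_fps (E t)
     = fps_const (t^2) * Abs_fps (E t) - fps_const (2 * t) * (fps_X * Abs_fps (E t)) + fps_X * (fps_X * Abs_fps (E t))"
  proof -
    have "fps_const (t^2) = fps_const t * fps_const t" "fps_const (2 * t) = 2 * fps_const t"
      by (simp_all add: power2_eq_square numeral_fps_const)
    then show ?thesis by (simp add: power2_eq_square algebra_simps)
  qed
  have nth: "((fps_const t - fps_X)^2 * Abs_fps (E t)) $ n
     = t^2 * E t n - (if n = 0 then 0 else 2 * t * E t (n - 1)) + (if n = 0 \<or> n = 1 then 0 else E t (n - 2))"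
    unfolding eq by (auto simp: numeral_2_eq_2)
  define \<beta> where "\<beta> = b t / t"
  have b: "b t = \<beta> * t" using t by (simp add: \<beta>_def)
  have V1: "V t 1 = 2 * \<sigma> t * (\<beta> * t + \<sigma> t * t)" and V2: "V t 2 = (\<sigma> t)^2 - \<beta>^2"
    by (simp only: tail_sum_1_2(1)[OF fin t] b) (simp only: tail_sum_1_2(2)[OF fin t] \<beta>_def)
  have E0: "E t 0 = \<beta>^2" by (simp add: quot_coeff_def \<beta>_def)
  have E: "E t k = - V t (k + 2)" if "0 < k" for k using that by (simp add: quot_coeff_def)
  have "n = 0 \<or> n = 1 \<or> n = 2 \<or> (\<exists>m. n = m + 3)" by presburger
  then consider "n = 0" | "n = 1" | "n = 2" | m where "n = m + 3" by blast
  then show "((fps_const t - fps_X)^2 * Abs_fps (E t)) $ n = Abs_fps (R t) $ n"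
  proof cases
    case 1
    have "R t 0 = (b t)^2" by (simp add: disc_coeff_def P_coeff_def)
    then show ?thesis unfolding nth unfolding 1 by (simp add: E0 b power_mult_distrib)
  next
    case 2
    have "t^2 * V t (1 + 2) = P 1 + 2 * t * V t 2 - V t 1"
      using tail_sum_rec[OF fin t, of 1] unfolding one_add_one by linarith
    moreover have "R t 1 = 2 * b t * \<sigma> t - P 1" by (simp add: disc_coeff_def)
    ultimately have "t^2 * (- V t (1 + 2)) - 2 * t * \<beta>^2 = R t 1"
      unfolding V1 V2 b by (simp add: power2_eq_square algebra_simps)
    then show ?thesis unfolding nth unfolding 2 using E[of 1] E0 by simp
  next
    case 3
    have "2 + (1::nat) = 1 + 2" by simp
    then have "t^2 * V t (2 + 2) = P 2 + 2 * t * V t (1 + 2) - V t 2"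
      using tail_sum_rec[OF fin t, of 2] by (simp only: algebra_simps)
    moreover have "R t 2 = (\<sigma> t)^2 - P 2" by (simp add: disc_coeff_def)
    ultimately have "t^2 * (- V t (2 + 2)) - 2 * t * (- V t (1 + 2)) + \<beta>^2 = R t 2"
      unfolding V2 by simp
    then show ?thesis unfolding nth unfolding 3 using E[of 1] E[of 2] E0 by simp
  next
    case (4 m)
    have "m + 3 + 1 = m + 2 + 2" "m + 3 = m + 1 + 2" by simp_all
    then have "t^2 * V t (m + 3 + 2) - 2 * t * V t (m + 2 + 2) + V t (m + 1 + 2) = P (m + 3)"
      using tail_sum_rec[OF fin t, of "m + 3"] by metis
    moreover have "R t (m + 3) = - P (m + 3)" by (simp add: disc_coeff_def)
    ultimately have "t^2 * E t (m + 3) - 2 * t * E t (m + 2) + E t (m + 1) = R t (m + 3)"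
      using E[of "m + 3"] E[of "m + 2"] E[of "m + 1"] by simp
    moreover have "m + 3 - 1 = m + 2" "m + 3 - 2 = m + 1" by simp_all
    ultimately show ?thesis unfolding nth unfolding 4 by simp
  qed
qed

lemma root_square:
  assumes "0 < t" "0 < b t"
  shows "Abs_fps (S t) * Abs_fps (S t) = Abs_fps (E t)"
proof (rule fps_ext)
  fix n
  have "(\<Sum>i\<le>n. S t i * S t (n - i)) = E t n"
    unfolding root_coeff_def using assms by (intro sqrt_coeff_conv) (auto simp: quot_coeff_def)
  then show "(Abs_fps (S t) * Abs_fps (S t)) $ n = Abs_fps (E t) $ n"
    by (simp add: fps_mult_nth atLeast0AtMost)
qed

lemma delta_square:
  assumes "0 < b t"
  shows "(\<Sum>i\<le>n. \<delta> t i * \<delta> t (n - i)) = R t n"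
  unfolding delta_coeff_def
  using assms by (intro sqrt_coeff_conv) (auto simp: disc_coeff_def P_coeff_def)

lemma delta_eq_root:
  assumes fin: "G_fin mu t" and t: "0 < t" "0 < b t"
  shows "Abs_fps (\<delta> t) = (fps_const t - fps_X) * Abs_fps (S t)"
proof (rule fps_eq_if_square_eq)
  have "Abs_fps (\<delta> t) * Abs_fps (\<delta> t) = Abs_fps (R t)"
    using delta_square[OF t(2)] by (intro fps_ext) (simp add: fps_mult_nth atLeast0AtMost)
  also have "\<dots> = (fps_const t - fps_X)^2 * (Abs_fps (S t) * Abs_fps (S t))"
    unfolding disc_eq_quot[OF fin t(1), symmetric] root_square[OF t] ..
  finally show "Abs_fps (\<delta> t) * Abs_fps (\<delta> t) =
    (fps_const t - fps_X) * Abs_fps (S t) * ((fps_const t - fps_X) * Abs_fps (S t))"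
    by (simp add: power2_eq_square mult_ac)
qed (use t in \<open>auto simp: delta_coeff_def root_coeff_def\<close>)

lemma delta_coeff_Suc:
  assumes "G_fin mu t" "0 < t" "0 < b t"
  shows "\<delta> t (Suc n) = t * S t (Suc n) - S t n"
  using arg_cong[OF delta_eq_root[OF assms], of "\<lambda>f. f $ Suc n"]
  by (simp add: left_diff_distrib)

lemma root_coeff_0 [simp]: "S t 0 = b t / t"
  by (simp add: root_coeff_def)

text \<open>Written for \<open>- S\<close> because beyond degree 0 every term on the right is then
  nonnegative, so that signs and comparisons follow by induction.\<close>

lemma root_coeff_rec:
  "0 < n \<Longrightarrow> - S t n = (- E t n + (\<Sum>i\<in>{1..<n}. (- S t i) * (- S t (n - i)))) / (2 * (b t / t))"
  unfolding root_coeff_def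
  by (subst sqrt_coeff_Suc, assumption, subst minus_divide_left) simp

lemma root_coeff_nonpos:
  assumes "G_fin mu t" "0 < t" "0 < b t" "0 < n"
  shows "S t n \<le> 0"
  using assms(4)
proof (induction n rule: less_induct)
  case (less n)
  have "0 \<le> - S t n"
    unfolding root_coeff_rec[OF less.prems]
    using assms quot_coeff_nonpos[OF assms(1,2) less.prems]
    by (intro divide_nonneg_nonneg add_nonneg_nonneg sum_nonneg mult_nonneg_nonneg) (auto simp: less.IH)
  then show ?case by simp
qed

text \<open>The recursion for \<open>- S\<close> increases with \<open>- E\<close> and with the
  earlier values and decreases with the constant term \<open>b t / t\<close>; all three move in the
  same direction with the tangency point.\<close>

lemma root_coeff_antimono:
  assumes fin: "G_fin mu t" and s: "0 < s" "s \<le> t" and b: "0 < b t" "b t / t \<le> b s / s" and "0 < n"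
  shows "- S s n \<le> - S t n"
  using \<open>0 < n\<close>
proof (induction n rule: less_induct)
  case (less n)
  have fins: "G_fin mu s" using G_fin_mono[OF fin] s by auto
  have t: "0 < t" using s by simp
  have bt: "0 < b t / t" using b t by simp
  then have "0 < b s / s" using b by linarith
  then have bs: "0 < b s" using s by (simp add: zero_less_divide_iff)
  have nn: "0 \<le> - S s i" "0 \<le> - S t i" if "0 < i" for i
    using root_coeff_nonpos[OF fins s(1) bs that] root_coeff_nonpos[OF fin t b(1) that] by auto
  have "- E s n \<le> - E t n"
    using tail_sum_mono[OF fin s, of "n + 2"] less.prems by (simp add: quot_coeff_def)
  moreover have "(\<Sum>i\<in>{1..<n}. (- S s i) * (- S s (n - i))) \<le> (\<Sum>i\<in>{1..<n}. (- S t i) * (- S t (n - i)))"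
    by (intro sum_mono mult_mono less.IH nn) auto
  moreover have "0 \<le> - E t n + (\<Sum>i\<in>{1..<n}. (- S t i) * (- S t (n - i)))"
    using quot_coeff_nonpos[OF fin t less.prems] by (intro add_nonneg_nonneg sum_nonneg mult_nonneg_nonneg nn) auto
  ultimately show ?case
    unfolding root_coeff_rec[OF less.prems] using bt b(2)
    by (intro frac_le) auto
qed

text \<open>\<open>S\<close> is a positive constant minus a series with nonnegative coefficients, so
  it inverts like a geometric series.\<close>

lemma inverse_root_nonneg:
  assumes "G_fin mu t" "0 < t" "0 < b t"
  shows "0 \<le> inverse (Abs_fps (S t)) $ n"
proof (induction n rule: less_induct)
  case (less n)
  let ?I = "inverse (Abs_fps (S t))"
  have pos: "0 < b t / t" using assms by simp
  then have inv: "Abs_fps (S t) * ?I = 1" by (subst mult.commute, intro inverse_mult_eq_1) (use assms in auto)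
  show ?case
  proof (cases "n = 0")
    case True
    then show ?thesis using assms by simp
  next
    case False
    have "0 = (\<Sum>i=0..n. S t i * ?I $ (n - i))"
      using arg_cong[OF inv, of "\<lambda>f. f $ n"] False by (simp add: fps_mult_nth)
    also have "\<dots> = b t / t * ?I $ n + (\<Sum>i=1..n. S t i * ?I $ (n - i))"
      by (simp add: sum.atLeast_Suc_atMost)
    finally have "b t / t * ?I $ n = (\<Sum>i=1..n. (- S t i) * ?I $ (n - i))"
      by (simp add: sum_negf)
    also have "\<dots> \<ge> 0"
      using root_coeff_nonpos[OF assms] by (intro sum_nonneg mult_nonneg_nonneg less.IH) auto
    finally show ?thesis using pos by (simp only: zero_le_mult_iff) auto
  qed
qed

lemma delta_coeff_0 [simp]: "\<delta> t 0 = b t"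
  by (simp add: delta_coeff_def)

section \<open>Dependence of the coefficients on the tangency point\<close>

lemma delta_coeff_rec:
  "0 < n \<Longrightarrow> \<delta> t n = (R t n - (\<Sum>i\<in>{1..<n}. \<delta> t i * \<delta> t (n - i))) / (2 * b t)"
  unfolding delta_coeff_def by (rule sqrt_coeff_Suc)

text \<open>Since \<open>b' = s g\<close> and \<open>\<sigma>' = - g\<close>, differentiating
  \<open>\<delta> * \<delta> = R\<close> gives \<open>2 \<delta> D = 2 g l (s - x)\<close>;
  cancelling \<open>s - x\<close> through \<open>\<delta> = (s - x) S\<close> leaves
  \<open>D S = g l\<close>. The bound \<open>g \<le> D 1\<close> is there to absorb the decrease of
  the slope in degree 1.\<close>

lemma DERIV_delta_coeff:
  assumes fin: "G_fin mu y" and s: "0 < s" "s < y" and pos: "\<And>t. 0 < t \<Longrightarrow> t < y \<Longrightarrow> 0 < b t"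
    and infl: "0 \<le> inflection mu s"
  shows "\<exists>D g. (\<forall>n. ((\<lambda>t. \<delta> t n) has_real_derivative D n) (at s)) \<and> (\<sigma> has_real_derivative - g) (at s)
    \<and> (\<forall>n\<ge>1. 0 \<le> D n) \<and> g \<le> D 1"
proof -
  define g where "g = \<kappa> * inflection mu s / (2 * sqrt (s * G mu s) ^ 3)"
  have fins: "G_fin mu s" using G_fin_mono[OF fin] s by auto
  have g: "0 \<le> g" unfolding g_def using \<kappa> infl G_pos[OF fins s(1)] s by auto
  have d\<sigma>: "(\<sigma> has_real_derivative - g) (at s)" and db: "(b has_real_derivative s * g) (at s)"
    using DERIV_tangent[OF fin s, of \<kappa>] unfolding g_def by auto
  have bs: "0 < b s" using pos s by simp
  define R' where "R' = (\<lambda>n::nat. if n = 0 then 2 * g * (b s * s) else if n = 1 then 2 * g * (\<sigma> s * s - b s)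
     else if n = 2 then - (2 * g * \<sigma> s) else 0)"
  have dR: "((\<lambda>t. R t n) has_real_derivative R' n) (at s)" for n
  proof -
    consider "n = 0" | "n = 1" | "n = 2" | "n > 2" by linarith
    then show ?thesis
      unfolding disc_coeff_def R'_def
      by cases (auto intro!: derivative_eq_intros d\<sigma> db simp: algebra_simps)
  qed
  \<comment> \<open>The recursion yields only the existence of the derivatives; their values come
    afterwards from the identity for the whole series.\<close>
  have "\<exists>d. ((\<lambda>t. \<delta> t n) has_real_derivative d) (at s)" for n
  proof (induction n rule: less_induct)
    case (less n)
    show ?case
    proof (cases "n = 0")
      case True
      then show ?thesis using db by auto
    next
      case False
      obtain D where D: "\<And>i. i < n \<Longrightarrow> ((\<lambda>t. \<delta> t i) has_real_derivative D i) (at s)"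
        using less.IH by metis
      have "((\<lambda>t. \<Sum>i\<in>{1..<n}. \<delta> t i * \<delta> t (n - i)) has_real_derivative
          (\<Sum>i\<in>{1..<n}. D i * \<delta> s (n - i) + D (n - i) * \<delta> s i)) (at s)"
        by (rule DERIV_sum, rule DERIV_mult; rule D; simp)
      from DERIV_divide[OF DERIV_diff[OF dR this] DERIV_cmult[OF db, of 2]] bs
      have "\<exists>d. ((\<lambda>t. (R t n - (\<Sum>i\<in>{1..<n}. \<delta> t i * \<delta> t (n - i))) / (2 * b t)) has_real_derivative d) (at s)"
        by fastforce
      moreover have "(\<lambda>t. \<delta> t n) = (\<lambda>t. (R t n - (\<Sum>i\<in>{1..<n}. \<delta> t i * \<delta> t (n - i))) / (2 * b t))"
        using False by (intro ext delta_coeff_rec) simp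
      ultimately show ?thesis by (simp only:)
    qed
  qed
  then obtain D where D: "\<And>n. ((\<lambda>t. \<delta> t n) has_real_derivative D n) (at s)" by metis
  have conv: "(\<Sum>i\<le>n. D i * \<delta> s (n - i) + D (n - i) * \<delta> s i) = R' n" for n
  proof (rule DERIV_unique)
    show "((\<lambda>t. \<Sum>i\<le>n. \<delta> t i * \<delta> t (n - i)) has_real_derivative
        (\<Sum>i\<le>n. D i * \<delta> s (n - i) + D (n - i) * \<delta> s i)) (at s)"
      by (intro DERIV_sum DERIV_mult D)
    show "((\<lambda>t. \<Sum>i\<le>n. \<delta> t i * \<delta> t (n - i)) has_real_derivative R' n) (at s)"
    proof (rule has_field_derivative_transform_within_open[OF dR])
      show "open {0<..<y}" "s \<in> {0<..<y}" using s by auto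
      show "R t n = (\<Sum>i\<le>n. \<delta> t i * \<delta> t (n - i))" if "t \<in> {0<..<y}" for t
        using delta_square[of t n] pos[of t] that by simp
    qed
  qed
  let ?D = "Abs_fps D" and ?l = "fps_const (b s) + fps_const (\<sigma> s) * fps_X"
  let ?x = "fps_const s - fps_X :: real fps" and ?S = "Abs_fps (S s)"
  have "?D * Abs_fps (\<delta> s) + Abs_fps (\<delta> s) * ?D = Abs_fps R'"
  proof (rule fps_ext)
    fix n
    have "(?D * Abs_fps (\<delta> s) + Abs_fps (\<delta> s) * ?D) $ n
        = (\<Sum>i\<le>n. D i * \<delta> s (n - i)) + (\<Sum>i\<le>n. \<delta> s i * D (n - i))"
      by (simp only: fps_add_nth fps_mult_nth atLeast0AtMost fps_nth_Abs_fps)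
    also have "\<dots> = R' n" unfolding conv[symmetric] by (simp add: sum.distrib mult.commute)
    finally show "(?D * Abs_fps (\<delta> s) + Abs_fps (\<delta> s) * ?D) $ n = Abs_fps R' $ n" by simp
  qed
  also have "Abs_fps R' = 2 * (fps_const g * (?l * ?x))"
  proof (rule fps_ext)
    fix n
    have "?l * ?x = fps_const (b s * s) + fps_const (\<sigma> s * s - b s) * fps_X - fps_const (\<sigma> s) * (fps_X * fps_X)"
      by (simp add: algebra_simps fps_const_mult[symmetric] fps_const_sub[symmetric] del: fps_const_mult fps_const_sub)
    then have "2 * (fps_const g * (?l * ?x)) = fps_const (2 * g) * (fps_const (b s * s) + fps_const (\<sigma> s * s - b s) * fps_X - fps_const (\<sigma> s) * (fps_X * fps_X))"
      by (simp add: numeral_fps_const)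
    moreover have "(fps_X * fps_X :: real fps) $ n = (if n = 2 then 1 else 0)"
      by (simp add: fps_X_power_nth power2_eq_square[symmetric])
    ultimately show "Abs_fps R' $ n = (2 * (fps_const g * (?l * ?x))) $ n"
      by (auto simp: R'_def fps_X_def)
  qed
  finally have "2 * (?x * (?D * ?S)) = 2 * (?x * (fps_const g * ?l))"
    unfolding delta_eq_root[OF fins s(1) bs] by (simp add: algebra_simps)
  moreover have "?x \<noteq> 0"
  proof
    assume "?x = 0"
    then have "?x $ 0 = 0" by simp
    then show False using s by simp
  qed
  ultimately have DS: "?D * ?S = fps_const g * ?l" by simp
  let ?I = "inverse ?S"
  have "?I * ?S = 1" by (rule inverse_mult_eq_1) (use bs s in simp)
  then have "?D = fps_const g * ?l * ?I"
    by (metis DS mult.assoc mult.commute mult.right_neutral)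
  also have "\<dots> = fps_const g * (fps_const (b s) * ?I + fps_const (\<sigma> s) * (fps_X * ?I))"
    by (simp only: distrib_left distrib_right mult_ac)
  finally have D_fps: "?D = fps_const g * (fps_const (b s) * ?I + fps_const (\<sigma> s) * (fps_X * ?I))" .
  have D_eq: "D n = g * (b s * ?I $ n + \<sigma> s * ?I $ (n - 1))" if "1 \<le> n" for n
    using arg_cong[OF D_fps, of "\<lambda>f. f $ n"] that by simp
  have I_nn: "0 \<le> ?I $ n" for n using inverse_root_nonneg[OF fins s(1) bs] .
  have \<sigma>: "0 \<le> \<sigma> s" using slope_nonneg[OF fins s(1)] .
  have "0 \<le> D n" if "1 \<le> n" for n
    unfolding D_eq[OF that] using g bs \<sigma> I_nn by simp
  moreover have "g \<le> D 1"
  proof -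
    have "?I $ 0 = s / b s" by simp
    moreover have "b s \<le> \<sigma> s * s"
      using intercept_le_slope[OF fins s(1)] s by (simp add: field_simps)
    ultimately have "1 \<le> \<sigma> s * ?I $ 0" using bs by simp
    then have "g * 1 \<le> g * (b s * ?I $ 1 + \<sigma> s * ?I $ 0)"
      using g bs I_nn[of 1] by (intro mult_left_mono) (auto intro: add_increasing)
    then show ?thesis using D_eq[of 1] by simp
  qed
  ultimately show ?thesis using D d\<sigma> by blast
qed

lemma continuous_on_delta_coeff:
  assumes fin: "G_fin mu y" and pos: "\<And>t. 0 < t \<Longrightarrow> t \<le> y \<Longrightarrow> 0 < b t"
  shows "continuous_on {0<..y} (\<lambda>t. \<delta> t n)"
proof (induction n rule: less_induct)
  case (less n)
  note c = continuous_on_tangent[OF fin, of \<kappa>]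
  show ?case
  proof (cases "n = 0")
    case True
    then show ?thesis using c by simp
  next
    case False
    have "continuous_on {0<..y} (\<lambda>t. R t n)"
    proof -
      consider "n = 1" | "n = 2" | "n > 2" using False by linarith
      then show ?thesis unfolding disc_coeff_def by cases (auto intro!: continuous_intros c)
    qed
    then have "continuous_on {0<..y} (\<lambda>t. (R t n - (\<Sum>i\<in>{1..<n}. \<delta> t i * \<delta> t (n - i))) / (2 * b t))"
      using pos by (intro continuous_on_divide continuous_on_diff continuous_on_sum continuous_on_mult
          continuous_on_const less.IH c) force+
    moreover have "(\<lambda>t. \<delta> t n) = (\<lambda>t. (R t n - (\<Sum>i\<in>{1..<n}. \<delta> t i * \<delta> t (n - i))) / (2 * b t))"
      using False by (intro ext delta_coeff_rec) simp
    ultimately show ?thesis by (simp only:)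
  qed
qed

text \<open>The coefficients are nondecreasing in the tangency point \<open>s\<close>, since their derivative is
  \<open>- \<sigma>'(s)\<close> times a coefficient of \<open>\<ell>\<^sub>s / S\<^sub>s\<close>, and their liminf for \<open>s \<rightarrow> 0\<close> is nonnegative.\<close>

lemma delta_coeff_nonneg:
  assumes two: "pmf mu 0 + pmf mu 1 < 1" and fin: "G_fin mu y" and y: "0 < y"
    and gt: "y * G' mu y < G mu y" and infl: "\<And>s. 0 < s \<Longrightarrow> s < y \<Longrightarrow> 0 \<le> inflection mu s" and n: "1 \<le> n"
  shows "0 \<le> \<delta> y n + (if n = 1 then \<sigma> y else 0)"
proof -
  have fins: "G_fin mu s" if "0 < s" "s \<le> y" for s using G_fin_mono[OF fin] that by auto
  have gts: "G mu y - y * G' mu y \<le> G mu s - s * G' mu s" if "0 < s" "s \<le> y" for s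
    using G_minus_antimono[OF two fin] that by auto
  have pos: "0 < b s" if "0 < s" "s \<le> y" for s
    using intercept_pos[OF fins[OF that] that(1)] gts[OF that] gt by simp
  have bmono: "b y / y \<le> b s / s" if s: "0 < s" "s \<le> y" for s
  proof -
    have eq: "b t / t = \<kappa> * (G mu t - t * G' mu t) / sqrt (t * G mu t)" if "0 < t" for t
      using that by (simp add: intercept_def)
    have "G mu s \<le> G mu y"
      by (rule sums_le[OF _ G_fin_sums(1)[OF fins[OF s]] G_fin_sums(1)[OF fin]])
         (use s in \<open>auto intro!: mult_left_mono power_mono\<close>)
    then have "s * G mu s \<le> y * G mu y"
      using s G_pos[OF fins[OF s] s(1)] by (intro mult_mono) auto
    then show ?thesis
      unfolding eq[OF s(1)] eq[OF y] using gts[OF s] gt \<kappa> s G_pos[OF fins[OF s] s(1)]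
      by (intro frac_le mult_left_mono) auto
  qed
  \<comment> \<open>In degree 1 the law has the coefficient of \<open>\<delta>\<close> plus the
    slope of the line, up to the factor \<open>2q\<close>, and only this sum has to be
    nonnegative.\<close>
  define \<Omega> where "\<Omega> = (\<lambda>s. \<delta> s n + (if n = 1 then \<sigma> s else 0))"
  have cont: "continuous_on {0<..y} \<Omega>"
    unfolding \<Omega>_def using continuous_on_delta_coeff[OF fin pos] continuous_on_tangent(1)[OF fin, of \<kappa>]
    by (cases "n = 1") (auto intro!: continuous_intros)
  have mono: "\<Omega> s \<le> \<Omega> y" if s: "0 < s" "s < y" for s
  proof (rule DERIV_nonneg_imp_increasing_open[of s y \<Omega>])
    show "s \<le> y" using s by simp
    show "continuous_on {s..y} \<Omega>" by (rule continuous_on_subset[OF cont]) (use s in auto)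
    fix x assume x: "s < x" "x < y"
    have "0 < x" using x s by simp
    then obtain D g where D: "\<And>n. ((\<lambda>t. \<delta> t n) has_real_derivative D n) (at x)" "(\<sigma> has_real_derivative - g) (at x)"
      "\<And>n. 1 \<le> n \<Longrightarrow> 0 \<le> D n" "g \<le> D 1"
      using DERIV_delta_coeff[OF fin _ x(2) pos infl] x by force
    have "(\<Omega> has_real_derivative D n + (if n = 1 then - g else 0)) (at x)"
      unfolding \<Omega>_def using D(1)[of n] D(2) by (cases "n = 1") (auto intro!: derivative_eq_intros)
    moreover have "0 \<le> D n + (if n = 1 then - g else 0)" using D(3)[OF n] D(4) by auto
    ultimately show "\<exists>d. (\<Omega> has_real_derivative d) (at x) \<and> 0 \<le> d" by blast
  qed
  \<comment> \<open>\<open>\<Omega> s\<close> is \<open>s * S s n\<close> plus a nonnegative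
    remainder, and \<open>S s n \<ge> S y n\<close>; the resulting bound vanishes as
    \<open>s\<close> tends to 0.\<close>
  have low: "- (s * (- S y n)) \<le> \<Omega> s" if s: "0 < s" "s < y" for s
  proof -
    obtain m where m: "n = Suc m" using n by (cases n) auto
    have s': "0 < s" "s \<le> y" using s by auto
    note F = fins[OF s'] s(1) pos[OF s']
    have "s * (- S s n) \<le> s * (- S y n)"
      using root_coeff_antimono[OF fin s' pos[OF y order_refl] bmono[OF s']] n s by (intro mult_left_mono) auto
    moreover have "s * S s n \<le> \<Omega> s"
    proof (cases "m = 0")
      case True
      then have "\<Omega> s = s * S s n - b s / s + \<sigma> s"
        using delta_coeff_Suc[OF F, of m] by (simp add: \<Omega>_def m)
      then show ?thesis using intercept_le_slope[OF F(1,2)] by simp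
    next
      case False
      then have "\<Omega> s = s * S s n - S s m"
        using delta_coeff_Suc[OF F, of m] by (simp add: \<Omega>_def m)
      then show ?thesis using root_coeff_nonpos[OF F, of m] False by simp
    qed
    ultimately show ?thesis by simp
  qed
  have "- (0 * (- S y n)) \<le> \<Omega> y"
  proof (rule tendsto_upperbound)
    show "((\<lambda>s. - (s * (- S y n))) \<longlongrightarrow> - (0 * (- S y n))) (at_right 0)"
      by (intro tendsto_intros)
    show "\<forall>\<^sub>F s in at_right 0. - (s * (- S y n)) \<le> \<Omega> y"
      using eventually_at_right_real[OF y]
    proof eventually_elim
      case (elim s)
      then show ?case using low[of s] mono[of s] by simp
    qed
  qed (simp add: trivial_limit_at_right_real)
  then show ?thesis by (simp add: \<Omega>_def)
qed

end

text \<open>\<open>m\<close> solves \<open>2\<beta>m = N + m\<^sup>2\<close> as power series, so inductively the partial sums of \<open>m\<close> at \<open>1\<close> do not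
  exceed the double root \<open>\<beta>\<close> of \<open>2\<beta>x = \<beta>\<^sup>2 + x\<^sup>2\<close>.\<close>

lemma quadratic_majorant_bounded:
  fixes m N :: "nat \<Rightarrow> real"
  assumes m: "\<And>k. 0 \<le> m k" "m 0 = 0" and \<beta>: "0 < \<beta>"
    and rec: "\<And>k. 0 < k \<Longrightarrow> 2 * \<beta> * m k = N k + (\<Sum>i\<in>{1..<k}. m i * m (k - i))"
    and N: "\<And>K. (\<Sum>k\<in>{1..K}. N k) \<le> \<beta>^2"
  shows "(\<Sum>k\<le>K. m k) \<le> \<beta>"
proof (induction K)
  case 0
  then show ?case using m \<beta> by simp
next
  case (Suc K)
  define c where "c = (\<lambda>k. \<Sum>i\<le>k. m i * m (k - i))"
  have rec': "2 * \<beta> * m k = N k + c k" if "0 < k" for k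
    using rec[OF that] sum_conv_split_ends[OF that, of m] m by (simp add: c_def)
  have c0: "c 0 = 0" using m by (simp add: c_def)
  have shift: "(\<Sum>k\<le>Suc K. f k) = (\<Sum>k\<in>{1..Suc K}. f k)" if "f 0 = 0" for f :: "nat \<Rightarrow> real"
  proof (rule sum.mono_neutral_right)
    show "\<forall>k\<in>{..Suc K} - {1..Suc K}. f k = 0"
    proof
      fix k assume "k \<in> {..Suc K} - {1..Suc K}"
      then have "k = 0" by auto
      then show "f k = 0" using that by simp
    qed
  qed auto
  have "(\<Sum>k\<le>Suc K. c k) = (\<Sum>(i, j)\<in>{(i, j). i + j \<le> Suc K}. m i * m j)"
    unfolding c_def by (rule sum.triangle_reindex_eq[symmetric])
  \<comment> \<open>A pair with an index \<open>Suc K\<close> has its other index 0, and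
    \<open>m 0 = 0\<close>; so only partial sums up to \<open>K\<close> enter, as the induction
    requires.\<close>
  also have "\<dots> = (\<Sum>(i, j)\<in>{(i, j). i + j \<le> Suc K \<and> i \<le> K \<and> j \<le> K}. m i * m j)"
  proof (rule sum.mono_neutral_right)
    show "finite {(i, j). i + j \<le> Suc K}"
      by (rule finite_subset[of _ "{..Suc K} \<times> {..Suc K}"]) auto
    show "\<forall>x\<in>{(i, j). i + j \<le> Suc K} - {(i, j). i + j \<le> Suc K \<and> i \<le> K \<and> j \<le> K}. (case x of (i, j) \<Rightarrow> m i * m j) = 0"
    proof
      fix x assume x: "x \<in> {(i, j). i + j \<le> Suc K} - {(i, j). i + j \<le> Suc K \<and> i \<le> K \<and> j \<le> K}"
      obtain i j where ij: "x = (i, j)" by (cases x)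
      then have "i = 0 \<or> j = 0" using x by auto
      then show "(case x of (i, j) \<Rightarrow> m i * m j) = 0" using ij m(2) by auto
    qed
  qed (rule Collect_mono, clarsimp)
  also have "\<dots> \<le> (\<Sum>(i, j)\<in>{..K} \<times> {..K}. m i * m j)"
  proof (rule sum_mono2)
    show "0 \<le> (case z of (i, j) \<Rightarrow> m i * m j)" for z by (cases z) (simp add: m(1))
  qed (simp, clarsimp)
  also have "\<dots> = (\<Sum>k\<le>K. m k) * (\<Sum>k\<le>K. m k)"
    by (simp add: sum_product sum.cartesian_product)
  also have "\<dots> \<le> \<beta> * \<beta>"
    using Suc m \<beta> by (intro mult_mono sum_nonneg) auto
  finally have c_le: "(\<Sum>k\<le>Suc K. c k) \<le> \<beta> * \<beta>" .
  have "2 * \<beta> * (\<Sum>k\<le>Suc K. m k) = (\<Sum>k\<in>{1..Suc K}. 2 * \<beta> * m k)"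
    unfolding shift[of m, OF m(2)] by (rule sum_distrib_left)
  also have "\<dots> = (\<Sum>k\<in>{1..Suc K}. N k) + (\<Sum>k\<in>{1..Suc K}. c k)"
    unfolding sum.distrib[symmetric] by (intro sum.cong) (auto simp: rec')
  finally have "2 * \<beta> * (\<Sum>k\<le>Suc K. m k) = (\<Sum>k\<in>{1..Suc K}. N k) + (\<Sum>k\<le>Suc K. c k)"
    unfolding shift[of c, OF c0] .
  then have "2 * \<beta> * (\<Sum>k\<le>Suc K. m k) \<le> 2 * \<beta> * \<beta>"
    using N[of "Suc K"] c_le by (simp add: power2_eq_square)
  then show ?case using \<beta> by simp
qed

text \<open>\<open>Q\<close> consists of the coefficients of \<open>1 / (y - x)^2\<close>, summable
  at 1 because \<open>y > 1\<close>. Hence \<open>E\<close>, the Cauchy product of \<open>R\<close>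
  and \<open>Q\<close>, converges at 1, with the sign of the sum of \<open>R\<close>.\<close>

lemma (in tangent_lines) summable_quot_coeff:
  assumes fin: "G_fin mu y" and y: "1 < y" and "0 \<le> (\<Sum>n. R y n)" and R: "summable (\<lambda>n. \<bar>R y n\<bar>)"
  shows "\<exists>L\<ge>0. E y sums L"
proof -
  define H Q where "H = (\<lambda>k::nat. 1 / y ^ (k + 1))" and "Q = (\<lambda>k::nat. real (k + 1) / y ^ (k + 2))"
  let ?x = "fps_const y - fps_X :: real fps"
  have H: "?x * Abs_fps H = 1"
  proof (rule fps_ext)
    fix n show "(?x * Abs_fps H) $ n = (1 :: real fps) $ n"
      using y by (cases n) (simp_all add: left_diff_distrib H_def)
  qed
  have "Abs_fps H * Abs_fps H = Abs_fps Q"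
  proof (rule fps_ext)
    fix n
    have "H i * H (n - i) = 1 / y ^ (n + 2)" if "i \<le> n" for i
      using that by (simp add: H_def power_add[symmetric])
    then show "(Abs_fps H * Abs_fps H) $ n = Abs_fps Q $ n"
      by (simp add: fps_mult_nth Q_def)
  qed
  then have "?x^2 * Abs_fps Q = (?x * Abs_fps H) * (?x * Abs_fps H)"
    by (simp add: power2_eq_square mult_ac)
  then have xQ: "?x^2 * Abs_fps Q = 1" unfolding H by simp
  have "Abs_fps (E y) = (?x^2 * Abs_fps Q) * Abs_fps (E y)" unfolding xQ by simp
  also have "\<dots> = Abs_fps (R y) * Abs_fps Q"
    unfolding disc_eq_quot[OF fin order_less_trans[OF zero_less_one y], symmetric] by (simp only: mult_ac)
  finally have E: "E y n = (\<Sum>i\<le>n. R y i * Q (n - i))" for n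
    by (metis (no_types, lifting) fps_mult_nth fps_nth_Abs_fps atLeast0AtMost sum.cong)
  have "summable (\<lambda>k. real (Suc k) * (1 / y) ^ k)"
    using geometric_deriv_sums[of "1 / y"] y by (simp add: sums_iff)
  then have "summable (\<lambda>k. real (Suc k) * (1 / y) ^ k * (1 / y^2))" by (rule summable_mult2)
  moreover have "real (Suc k) * (1 / y) ^ k * (1 / y^2) = Q k" for k
    by (simp add: Q_def power_divide power_add power2_eq_square)
  ultimately have Q: "summable Q" by (simp only:)
  have Q0: "0 \<le> Q k" for k using y by (simp add: Q_def)
  have "(\<lambda>n. (\<Sum>i\<le>n. R y i * Q (n - i)) * 1 ^ n) sums ((\<Sum>k. R y k * 1 ^ k) * (\<Sum>k. Q k * 1 ^ k))"
    using R Q Q0 by (intro Cauchy_product_power_sums) auto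
  then have "E y sums ((\<Sum>k. R y k) * (\<Sum>k. Q k))"
    by (simp add: E[symmetric])
  moreover have "0 \<le> (\<Sum>k. R y k) * (\<Sum>k. Q k)"
    by (intro mult_nonneg_nonneg assms(3) suminf_nonneg Q Q0)
  ultimately show ?thesis by blast
qed

section \<open>Construction of the invariant law\<close>

lemma exists_fixed_point_law:
  fixes mu :: "nat pmf"
  assumes q: "1/2 < q" "q < 1" and \<kappa>_def: "\<kappa> = sqrt (q * (1 - q))"
    and two: "pmf mu 0 + pmf mu 1 < 1" and fin: "G_fin mu y" and y: "1 < y"
    and gt: "y * G' mu y < G mu y" and infl: "\<And>s. 0 < s \<Longrightarrow> s < y \<Longrightarrow> 0 \<le> inflection mu s"
    and through: "slope \<kappa> mu y + intercept \<kappa> mu y = 1"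
  shows "\<exists>p. parking_step q mu p = p"
proof -
  have \<kappa>2: "\<kappa>^2 = q * (1 - q)" unfolding \<kappa>_def using q by simp
  have \<kappa>: "0 < \<kappa>" unfolding \<kappa>_def using q by simp
  interpret tangent_lines \<kappa> mu by unfold_locales (rule \<kappa>)
  have y0: "0 < y" using y by simp
  have by0: "0 < b y" using intercept_pos[OF fin y0 gt] .
  have \<sigma>0: "0 \<le> \<sigma> y" using slope_nonneg[OF fin y0] .
  define l where "l = (\<lambda>x. b y + \<sigma> y * x)"
  define lc where "lc = (\<lambda>k::nat. if k = 0 then b y else if k = 1 then \<sigma> y else 0)"
  define l2 where "l2 = (\<lambda>k::nat. if k = 0 then (b y)^2 else if k = 1 then 2 * b y * \<sigma> y else if k = 2 then (\<sigma> y)^2 else 0)"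
  have R_eq: "R y k = l2 k - P k" for k by (simp add: disc_coeff_def l2_def)
  have lc_sums: "(\<lambda>k. lc k * x ^ k) sums l x" for x
  proof -
    have "(\<lambda>k. lc k * x ^ k) sums (\<Sum>k\<in>{0,1}. lc k * x ^ k)"
      by (rule sums_finite) (auto simp: lc_def)
    then show ?thesis by (simp add: lc_def l_def)
  qed
  have l2_sums: "(\<lambda>k. l2 k * x ^ k) sums (l x)^2" for x
  proof -
    have "(\<lambda>k. l2 k * x ^ k) sums (\<Sum>k\<in>{0,1,2}. l2 k * x ^ k)"
      by (rule sums_finite) (auto simp: l2_def)
    then show ?thesis by (simp add: l2_def l_def power2_eq_square algebra_simps)
  qed
  have P_sums: "(\<lambda>k. P k * x ^ k) sums (4 * \<kappa>^2 * (x * G mu x))" if "0 \<le> x" "x \<le> 1" for x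
  proof -
    have "summable (\<lambda>k. pmf mu k * x ^ k)"
      by (rule summable_rabs_cancel[OF expectation_power_pmf(2)]) (use that in simp)
    then have "(\<lambda>k. 4 * \<kappa>^2 * (x * (pmf mu k * x ^ k))) sums (4 * \<kappa>^2 * (x * G mu x))"
      unfolding G_def by (intro sums_mult summable_sums)
    then have "(\<lambda>k. P (Suc k) * x ^ Suc k) sums (4 * \<kappa>^2 * (x * G mu x))"
      by (simp add: P_coeff_def mult_ac)
    then show ?thesis by (subst (asm) sums_Suc_iff) (simp add: P_coeff_def)
  qed
  have R_sums: "(\<lambda>k. R y k * x ^ k) sums ((l x)^2 - 4 * \<kappa>^2 * (x * G mu x))" if "0 \<le> x" "x \<le> 1" for x
    using sums_diff[OF l2_sums[of x] P_sums[OF that]] by (simp add: R_eq left_diff_distrib)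
  have G1: "G mu 1 = 1" using expectation_power_pmf(1)[of 1 mu] by simp
  have l1: "l 1 = 1" using through by (simp add: l_def)
  have "(l 1)^2 - 4 * \<kappa>^2 * (1 * G mu 1) = (2 * q - 1)^2"
    unfolding l1 G1 \<kappa>2 by (simp add: power2_eq_square algebra_simps)
  then have R1: "R y sums (2 * q - 1)^2" using R_sums[of 1] by simp
  have R_abs: "summable (\<lambda>n. \<bar>R y n\<bar>)"
  proof -
    have "summable (\<lambda>n. \<bar>l2 n\<bar>)" by (rule summable_finite[of "{0,1,2}"]) (auto simp: l2_def)
    moreover have "summable P" using P_sums[of 1] by (simp add: sums_iff)
    ultimately have "summable (\<lambda>n. \<bar>l2 n\<bar> + P n)" by (rule summable_add)
    then show ?thesis
      by (rule summable_comparison_test'[where N = 0]) (use P_nonneg in \<open>auto simp: R_eq intro: order_trans[OF abs_triangle_ineq4]\<close>)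
  qed
  define \<beta> where "\<beta> = b y / y"
  have \<beta>: "0 < \<beta>" using by0 y0 by (simp add: \<beta>_def)
  have "0 \<le> (\<Sum>n. R y n)" using R1 by (simp add: sums_iff)
  then obtain L where L: "0 \<le> L" "E y sums L" using summable_quot_coeff[OF fin y _ R_abs] by blast
  define m where "m = (\<lambda>k. if k = 0 then 0 else - S y k)"
  have m0: "0 \<le> m k" for k using root_coeff_nonpos[OF fin y0 by0, of k] by (simp add: m_def)
  have N: "(\<Sum>k\<in>{1..K}. - E y k) \<le> \<beta>^2" for K
  proof -
    have "(\<lambda>k. - E y (Suc k)) sums (- (L - E y 0))"
      using L(2) by (intro sums_minus) (subst sums_Suc_iff, simp)
    then have "(\<Sum>k<K. - E y (Suc k)) \<le> E y 0 - L"
      using quot_coeff_nonpos[OF fin y0] by (intro sum_le_suminf[THEN order_trans]) (auto simp: sums_iff)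
    moreover have "(\<Sum>k\<in>{1..K}. - E y k) = (\<Sum>k<K. - E y (Suc k))"
      by (rule sum.reindex_bij_witness[where i = Suc and j = "\<lambda>k. k - 1"]) auto
    ultimately show ?thesis using L(1) by (simp add: quot_coeff_def \<beta>_def)
  qed
  \<comment> \<open>\<open>S * S = E\<close> becomes \<open>2 \<beta> m = - E + m * m\<close> in
    positive degrees, with \<open>\<beta>\<close> the constant term of \<open>S\<close>. The bound
    by \<open>\<beta>\<close> makes \<open>S\<close> summable at 1, with a nonnegative sum.\<close>
  have T: "(\<Sum>k\<le>K. m k) \<le> \<beta>" for K
  proof (rule quadratic_majorant_bounded[OF m0 _ \<beta> _ N])
    fix k :: nat assume k: "0 < k"
    have "(\<Sum>i\<in>{1..<k}. (- S y i) * (- S y (k - i))) = (\<Sum>i\<in>{1..<k}. m i * m (k - i))"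
      by (intro sum.cong) (auto simp: m_def)
    then have "m k = (- E y k + (\<Sum>i\<in>{1..<k}. m i * m (k - i))) / (2 * \<beta>)"
      using root_coeff_rec[OF k, of y] k by (simp only: m_def \<beta>_def) simp
    then show "2 * \<beta> * m k = - E y k + (\<Sum>i\<in>{1..<k}. m i * m (k - i))" using \<beta> by (simp add: field_simps)
  qed (simp add: m_def)
  have T': "(\<Sum>k<K. m k) \<le> \<beta>" for K
  proof -
    have "(\<Sum>k<K. m k) \<le> (\<Sum>k\<le>K. m k)" using m0 by (intro sum_mono2) auto
    then show ?thesis using T[of K] by linarith
  qed
  have m_sm: "summable m" using m0 T' by (rule summableI_nonneg_bounded)
  have M: "suminf m \<le> \<beta>" using m_sm T' by (rule suminf_le_const)
  have S_sums: "S y sums (\<beta> - suminf m)"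
  proof -
    have "(\<lambda>k. (if k = 0 then \<beta> else 0) - m k) sums (\<beta> - suminf m)"
      using sums_single[of 0 "\<lambda>_. \<beta>"] by (intro sums_diff summable_sums m_sm) simp
    moreover have "(\<lambda>k. (if k = 0 then \<beta> else 0) - m k) = S y"
      by (auto simp: m_def \<beta>_def fun_eq_iff)
    ultimately show ?thesis by simp
  qed
  have \<delta>_sums: "\<delta> y sums ((y - 1) * (\<beta> - suminf m))"
  proof -
    have "(\<lambda>k. case k of 0 \<Rightarrow> 0 | Suc j \<Rightarrow> S y j) sums (\<beta> - suminf m + 0)"
      using sums_Suc[of "\<lambda>k. case k of 0 \<Rightarrow> 0 | Suc j \<Rightarrow> S y j" "\<beta> - suminf m"] S_sums by simp
    then have "(\<lambda>k. y * S y k - (case k of 0 \<Rightarrow> 0 | Suc j \<Rightarrow> S y j)) sums (y * (\<beta> - suminf m) - (\<beta> - suminf m))"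
      using sums_diff[OF sums_mult[OF S_sums]] by simp
    moreover have "y * S y k - (case k of 0 \<Rightarrow> 0 | Suc j \<Rightarrow> S y j) = \<delta> y k" for k
      using y0 by (cases k) (simp_all add: delta_coeff_Suc[OF fin y0 by0])
    ultimately show ?thesis by (simp add: algebra_simps)
  qed
  define \<Lambda> where "\<Lambda> = (\<lambda>k. (\<delta> y k + lc k) / (2 * q))"
  have \<Lambda>_nn: "0 \<le> \<Lambda> k" for k
  proof (cases "k = 0")
    case True
    then show ?thesis using by0 q by (simp add: \<Lambda>_def lc_def)
  next
    case False
    then show ?thesis
      using delta_coeff_nonneg[OF two fin y0 gt infl, of k] q by (cases "k = 1") (auto simp: \<Lambda>_def lc_def)
  qed
  have \<Lambda>_sm: "summable \<Lambda>"
    using \<delta>_sums lc_sums[of 1] unfolding \<Lambda>_def by (intro summable_divide summable_add) (auto simp: sums_iff)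
  have \<delta>_eq: "\<delta> y k = 2 * q * \<Lambda> k - lc k" for k using q by (simp add: \<Lambda>_def)
  define \<Delta> where "\<Delta> = (\<lambda>x. \<Sum>k. \<delta> y k * x ^ k)"
  have \<delta>_abs: "summable (\<lambda>k. \<bar>\<delta> y k * x ^ k\<bar>)" if "0 \<le> x" "x \<le> 1" for x
  proof (rule summable_comparison_test'[where N = 0])
    show "summable (\<lambda>k. 2 * q * \<Lambda> k + \<bar>lc k\<bar>)"
      by (intro summable_add summable_mult \<Lambda>_sm summable_finite[of "{0,1}"]) (auto simp: lc_def)
    fix k
    have "\<bar>\<delta> y k * x ^ k\<bar> \<le> \<bar>\<delta> y k\<bar>"
      using that by (simp add: abs_mult power_abs mult_left_le power_le_one)
    also have "\<dots> \<le> 2 * q * \<Lambda> k + \<bar>lc k\<bar>"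
      unfolding \<delta>_eq using \<Lambda>_nn[of k] q by (intro order_trans[OF abs_triangle_ineq4]) auto
    finally show "norm \<bar>\<delta> y k * x ^ k\<bar> \<le> 2 * q * \<Lambda> k + \<bar>lc k\<bar>" by simp
  qed
  have \<Delta>2: "(\<Delta> x)^2 = (l x)^2 - 4 * \<kappa>^2 * (x * G mu x)" if "0 \<le> x" "x \<le> 1" for x
  proof (rule sums_unique2)
    show "(\<lambda>n. R y n * x ^ n) sums (\<Delta> x)^2"
      using Cauchy_product_power_sums[OF \<delta>_abs[OF that] \<delta>_abs[OF that]]
      by (simp add: delta_square[OF by0] \<Delta>_def power2_eq_square)
  qed (rule R_sums[OF that])
  \<comment> \<open>The quadratic determines only the square of \<open>\<Delta> 1\<close>. The
    factor \<open>y - 1\<close> and the nonnegative sum of \<open>S\<close> select the root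
    \<open>2 * q - 1\<close>, which gives \<open>\<Lambda>\<close> total mass 1.\<close>
  have "\<Delta> 1 = (y - 1) * (\<beta> - suminf m)" using \<delta>_sums by (simp add: \<Delta>_def sums_iff)
  then have "0 \<le> \<Delta> 1" using y M by simp
  moreover have "(\<Delta> 1)^2 = (2 * q - 1)^2"
    using \<Delta>2[of 1] l1 G1 \<kappa>2 by (simp add: power2_eq_square algebra_simps)
  ultimately have \<Delta>1: "\<Delta> 1 = 2 * q - 1" using q by (simp add: power2_eq_iff_nonneg)
  have \<Lambda>_sums: "(\<lambda>k. \<Lambda> k * x ^ k) sums ((\<Delta> x + l x) / (2 * q))" if "0 \<le> x" "x \<le> 1" for x
  proof -
    have "(\<lambda>k. \<delta> y k * x ^ k) sums \<Delta> x"
      unfolding \<Delta>_def using \<delta>_abs[OF that] by (intro summable_sums) (rule summable_rabs_cancel)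
    then have "(\<lambda>k. (\<delta> y k * x ^ k + lc k * x ^ k) / (2 * q)) sums ((\<Delta> x + l x) / (2 * q))"
      by (intro sums_divide sums_add lc_sums)
    then show ?thesis by (simp add: \<Lambda>_def distrib_right)
  qed
  have "(\<integral>\<^sup>+k. ennreal (\<Lambda> k) \<partial>count_space UNIV) = (\<Sum>k. ennreal (\<Lambda> k))"
    by (rule nn_integral_count_space_nat)
  also have "\<Lambda> sums 1" using \<Lambda>_sums[of 1] q by (simp add: \<Delta>1 l1)
  then have "(\<Sum>k. ennreal (\<Lambda> k)) = ennreal 1" by (rule suminf_ennreal_eq[OF \<Lambda>_nn])
  finally have "(\<integral>\<^sup>+k. ennreal (\<Lambda> k) \<partial>count_space UNIV) = 1" by simp
  then have pmf_p: "pmf (embed_pmf \<Lambda>) k = \<Lambda> k" for k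
    using \<Lambda>_nn by (intro pmf_embed_pmf) auto
  show ?thesis
  proof (intro exI fixed_point_if_equation)
    show "0 < q" "q < 1" using q by auto
    fix x :: real assume x: "0 < x" "x < 1"
    have F: "G (embed_pmf \<Lambda>) x = (\<Delta> x + l x) / (2 * q)"
      using \<Lambda>_sums[of x] x by (simp add: G_def pmf_p sums_iff)
    have "2 * q * \<Lambda> 0 = 2 * b y" using q by (simp add: \<Lambda>_def lc_def)
    then have "q * \<Lambda> 0 = b y" by simp
    moreover have "q * G (embed_pmf \<Lambda>) x = (\<Delta> x + l x) / 2" unfolding F using q by simp
    moreover have "x + b y * (1 - x) = l x"
    proof -
      have "\<sigma> y = 1 - b y" using through by simp
      then show ?thesis unfolding l_def by (simp only:) (simp add: algebra_simps)
    qed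
    \<comment> \<open>With \<open>q F = (l + \<Delta>) / 2\<close>, the second factor of the
      equation is the other root \<open>(l - \<Delta>) / 2\<close>, so the product reduces to
      \<open>l^2 - \<Delta>^2\<close>.\<close>
    ultimately have K: "x - q * (G (embed_pmf \<Lambda>) x - pmf (embed_pmf \<Lambda>) 0 * (1 - x)) = (l x - \<Delta> x) / 2"
      unfolding pmf_p right_diff_distrib mult.assoc[symmetric] by (simp add: field_simps)
    have "G (embed_pmf \<Lambda>) x * (x - q * (G (embed_pmf \<Lambda>) x - pmf (embed_pmf \<Lambda>) 0 * (1 - x)))
        = ((\<Delta> x + l x) * (l x - \<Delta> x)) / (4 * q)"
      unfolding K unfolding F by simp
    also have "(\<Delta> x + l x) * (l x - \<Delta> x) = (l x)^2 - (\<Delta> x)^2"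
      by (simp add: power2_eq_square algebra_simps)
    also have "((l x)^2 - (\<Delta> x)^2) / (4 * q) = (1 - q) * x * G mu x"
      using \<Delta>2[of x] x q by (simp add: \<kappa>2)
    finally show "G (embed_pmf \<Lambda>) x * (x - q * (G (embed_pmf \<Lambda>) x - pmf (embed_pmf \<Lambda>) 0 * (1 - x))) = (1 - q) * x * G mu x" .
  qed
qed

unbundle no fps_syntax

section \<open>The criterion\<close>

theorem theorem1:
  fixes q :: real and mu :: "nat pmf"
  assumes "1/2 < q" and "q < 1"
    and "pmf mu 0 + pmf mu 1 < 1"
    and "crit_set mu \<noteq> {}"
  shows "subcritical q mu \<longleftrightarrow>
           (let tc = Inf (crit_set mu) in
              tc > 1 \<and> tc * G mu tc / (phi mu tc)^2 \<le> q * (1 - q))"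
proof -
  note q = assms(1,2) and two = assms(3)
  obtain tc where tc: "tc \<in> crit_set mu" using assms(4) by blast
  note crit = crit_point_props[OF two tc]
  have "0 < tc" and fin: "G_fin mu tc" using tc by (auto simp: crit_set_def)
  have Inf_tc: "Inf (crit_set mu) = tc" using crit(4) by simp
  define \<kappa> where "\<kappa> = sqrt (q * (1 - q))"
  have \<kappa>: "0 < \<kappa>" "\<kappa>^2 = q * (1 - q)" using q by (simp_all add: \<kappa>_def)
  have Gtc: "0 < G mu tc" using G_pos[OF fin \<open>0 < tc\<close>] .
  define h where "h = sqrt (tc * G mu tc)"
  have h: "0 < h" "h^2 = tc * G mu tc" using Gtc \<open>0 < tc\<close> by (simp_all add: h_def)
  \<comment> \<open>The height at 1 of the tangent line at \<open>t\<close>; when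
    \<open>tc > 1\<close>, the second half of the criterion says
    \<open>\<tau> tc \<ge> 1\<close>.\<close>
  define \<tau> where "\<tau> = (\<lambda>t. slope \<kappa> mu t + intercept \<kappa> mu t)"
  have \<tau>_tc: "\<tau> tc = \<kappa> * phi mu tc / h" by (simp add: \<tau>_def slope_plus_intercept h_def)
  have cont: "continuous_on {0<..tc} \<tau>"
    unfolding \<tau>_def by (intro continuous_intros continuous_on_tangent fin)
  have phi_pos: "0 < phi mu tc" if "1 < tc"
  proof -
    have "(tc - 1) * (tc * G' mu tc) \<le> (tc - 1) * G mu tc"
      using crit(1) that by (intro mult_left_mono) auto
    then have "2 * G mu tc \<le> phi mu tc" by (simp add: phi_def algebra_simps)
    then show ?thesis using Gtc by linarith
  qed
  have criterion: "tc * G mu tc / (phi mu tc)^2 \<le> q * (1 - q) \<longleftrightarrow> 1 \<le> \<tau> tc" if "1 < tc"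
  proof -
    have "tc * G mu tc / (phi mu tc)^2 \<le> q * (1 - q) \<longleftrightarrow> h^2 \<le> (\<kappa> * phi mu tc)^2"
      using phi_pos[OF that] by (simp add: h(2) \<kappa>(2) power_mult_distrib pos_divide_le_eq)
    also have "\<dots> \<longleftrightarrow> h \<le> \<kappa> * phi mu tc"
      using h(1) \<kappa>(1) phi_pos[OF that] by (simp add: power2_le_iff_abs_le)
    also have "\<dots> \<longleftrightarrow> 1 \<le> \<tau> tc" unfolding \<tau>_tc using h(1) by (simp add: pos_le_divide_eq)
    finally show ?thesis .
  qed
  have "subcritical q mu \<longleftrightarrow> 1 < tc \<and> 1 \<le> \<tau> tc"
  proof
    assume "subcritical q mu"
    then obtain p where p: "\<And>x. 0 < x \<Longrightarrow> x < 1 \<Longrightarrow>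
      G p x * (x - q * (G p x - pmf p 0 * (1 - x))) = (1 - q) * x * G mu x"
      using subcritical_imp_equation[of q mu] q by auto
    obtain y where y: "1 < y" "G_fin mu y" "0 \<le> inflection mu y" "0 < phi mu y"
      "q * (1 - q) * (phi mu y)^2 = y * G mu y"
      using right_tangent_point[OF q two pmf_0_pos[OF two tc] p] by blast
    \<comment> \<open>Beyond \<open>tc\<close> the sign of \<open>inflection\<close> would be
      negative, against the second-order condition at \<open>y\<close>.\<close>
    have "y \<le> tc" using crit(3)[OF _ y(2)] y(3) by force
    have "(\<kappa> * phi mu y)^2 = y * G mu y" unfolding power_mult_distrib \<kappa>(2) by (rule y(5))
    then have "sqrt (y * G mu y) = \<kappa> * phi mu y"
      using \<kappa>(1) y(4) by (metis real_sqrt_abs abs_of_pos mult_pos_pos)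
    then have "\<tau> y = 1" using \<kappa>(1) y(4) by (simp add: \<tau>_def slope_plus_intercept)
    moreover have "\<tau> y \<le> \<tau> tc"
    proof (rule DERIV_nonneg_imp_increasing_open[of y tc \<tau>])
      show "y \<le> tc" by fact
      show "continuous_on {y..tc} \<tau>" by (rule continuous_on_subset[OF cont]) (use y(1) in auto)
      fix t assume t: "y < t" "t < tc"
      have t0: "0 < t" using t y(1) by simp
      define g where "g = \<kappa> * inflection mu t / (2 * sqrt (t * G mu t) ^ 3)"
      have "0 \<le> g"
        unfolding g_def using \<kappa>(1) crit(2)[OF t0 t(2)] G_pos[OF G_fin_mono[OF fin] t0] t t0 by auto
      moreover have "(\<tau> has_real_derivative - g + t * g) (at t)"
        unfolding \<tau>_def g_def by (intro DERIV_add DERIV_tangent[OF fin t0 t(2)])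
      moreover have "0 \<le> - g + t * g"
        using mult_right_mono[of 1 t g] \<open>0 \<le> g\<close> t y(1) by simp
      ultimately show "\<exists>d. (\<tau> has_real_derivative d) (at t) \<and> 0 \<le> d" by blast
    qed
    ultimately show "1 < tc \<and> 1 \<le> \<tau> tc" using y(1) \<open>y \<le> tc\<close> by simp
  next
    assume tc1: "1 < tc \<and> 1 \<le> \<tau> tc"
    \<comment> \<open>At \<open>t = 1\<close> the tangent has height \<open>2 * \<kappa>\<close> at
      1, below 1 because \<open>q > 1/2\<close>; the intermediate value theorem then finds the
      tangent through (1,1).\<close>
    have "G mu 1 = 1" using expectation_power_pmf(1)[of 1 mu] by simp
    then have "\<tau> 1 = 2 * \<kappa>" by (simp add: \<tau>_def slope_plus_intercept phi_def)
    moreover have "(2 * \<kappa>)^2 < 1^2"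
    proof -
      have "0 < (2 * q - 1)^2" using q by simp
      moreover have "(2 * \<kappa>)^2 = 4 * (q * (1 - q))" by (simp add: power_mult_distrib \<kappa>(2))
      moreover have "4 * (q * (1 - q)) = 1^2 - (2 * q - 1)^2"
        by (simp add: power2_eq_square algebra_simps)
      ultimately show ?thesis by linarith
    qed
    then have "2 * \<kappa> < 1" by (rule power_less_imp_less_base) simp
    ultimately have \<tau>1: "\<tau> 1 < 1" by simp
    have "continuous_on {1..tc} \<tau>" by (rule continuous_on_subset[OF cont]) auto
    then obtain y where y: "1 \<le> y" "y \<le> tc" "\<tau> y = 1"
      using IVT'[of \<tau> 1 1 tc] \<tau>1 tc1 by auto
    then have y1: "1 < y" using \<tau>1 by (cases "y = 1") auto
    have "\<exists>p. parking_step q mu p = p"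
    proof (rule exists_fixed_point_law[OF q \<kappa>_def two _ y1])
      show "G_fin mu y" using G_fin_mono[OF fin] y by simp
      show "y * G' mu y < G mu y" using G_minus_antimono[OF two fin, of y] crit(1) y by simp
      show "0 \<le> inflection mu s" if "0 < s" "s < y" for s using crit(2)[of s] that y by simp
      show "slope \<kappa> mu y + intercept \<kappa> mu y = 1" using y(3) by (simp add: \<tau>_def)
    qed
    then show "subcritical q mu" using subcritical_if_fixed_point by blast
  qed
  then show ?thesis unfolding Let_def Inf_tc using criterion by blast
qed

end
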